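(* Let $p=p_n$ be a sequence of positive integers such that $p_n/(\log n)^2\to\infty$ as $n\to\infty$. Let $\tau_n>0$ with $\tau_n\to\tau>0$, let $\kappa_n=\tau_n p_n^{3/4}/\sqrt n$, and let $\boldsymbol{\mu}_n\in\mathbb{S}^{p_n-1}$ be an arbitrary sequence of location parameters. For each $n$ let $\boldsymbol{X}_1,\dots,\boldsymbol{X}_n$ be i.i.d. with the Fisher-von Mises-Langevin distribution $\mathrm{FvML}(\kappa_n,\boldsymbol{\mu}_n)$ on $\mathbb{S}^{p_n-1}$. Then $$P_n=p_n\cdot\max_{1\le i<j\le n}(\boldsymbol{X}_i^{\top}\boldsymbol{X}_j)^2-4\log n+\log\log n$$ converges in distribution, as $n\to\infty$, to the law with CDF $G(x)=\exp\left(-(8\pi)^{-1/2}e^{-x/2}\right)$, $x\in\mathbb{R}$.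
   Context: $\mathbb{S}^{p-1}=\{x\in\mathbb{R}^p:\|x\|_2=1\}$. For $\kappa>0$ and $\boldsymbol{\mu}\in\mathbb{S}^{p-1}$, $\mathrm{FvML}(\kappa,\boldsymbol{\mu})$ is the probability distribution on $\mathbb{S}^{p-1}$ whose density with respect to the uniform distribution on $\mathbb{S}^{p-1}$ is proportional to $\exp(\kappa\boldsymbol{\mu}^{\top}\boldsymbol{x})$. *)

theory Defs
  imports "HOL-Probability.Probability" "HOL-Real_Asymp.Real_Asymp"
begin

text \<open>
  Since the dimension \<open>p\<close> varies along a sequence, a vector of \<open>\<real>\<^sup>p\<close> is a function
  \<^typ>\<open>nat \<Rightarrow> real\<close> that is extensional on the index set \<^term>\<open>{..<p::nat}\<close>, i.e. an element of
  the space of the product measure over that index set.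
\<close>

definition vinner :: "nat \<Rightarrow> (nat \<Rightarrow> real) \<Rightarrow> (nat \<Rightarrow> real) \<Rightarrow> real" where
  "vinner p x y = (\<Sum>k<p. x k * y k)"

definition unit_sphere :: "nat \<Rightarrow> (nat \<Rightarrow> real) set" where
  "unit_sphere p = {x \<in> {..<p} \<rightarrow>\<^sub>E UNIV. L2_set x {..<p} = 1}"

definition unit_ball :: "nat \<Rightarrow> (nat \<Rightarrow> real) set" where
  "unit_ball p = {x \<in> {..<p} \<rightarrow>\<^sub>E UNIV. L2_set x {..<p} \<le> 1}"

definition vnormalize :: "nat \<Rightarrow> (nat \<Rightarrow> real) \<Rightarrow> (nat \<Rightarrow> real)" where
  "vnormalize p x = (\<lambda>k\<in>{..<p}. x k / L2_set x {..<p})"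

text \<open>
  The uniform distribution on the sphere is normalized surface measure, obtained as the cone
  measure: a Borel set \<open>A\<close> of the sphere gets the mass
  \<open>vol {t x | x \<in> A, 0 < t \<le> 1} / vol (unit_ball p)\<close>.  The origin, where normalization
  is meaningless, is a null set.  For \<open>p = 1\<close> this is the uniform distribution on the two points
  \<open>1\<close> and \<open>-1\<close>.
\<close>

definition uniform_sphere :: "nat \<Rightarrow> (nat \<Rightarrow> real) measure" where
  "uniform_sphere p =
     restrict_space
       (distr (uniform_measure (\<Pi>\<^sub>M k\<in>{..<p}. lborel) (unit_ball p))
              (\<Pi>\<^sub>M k\<in>{..<p}. borel) (vnormalize p))
       (unit_sphere p)"

definition FvML :: "nat \<Rightarrow> real \<Rightarrow> (nat \<Rightarrow> real) \<Rightarrow> (nat \<Rightarrow> real) measure" where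
  "FvML p \<kappa> \<mu> =
     density (uniform_sphere p)
       (\<lambda>x. ennreal (exp (\<kappa> * vinner p \<mu> x) / (LINT y|uniform_sphere p. exp (\<kappa> * vinner p \<mu> y))))"

definition max_sq_inner :: "nat \<Rightarrow> nat \<Rightarrow> (nat \<Rightarrow> nat \<Rightarrow> real) \<Rightarrow> real" where
  "max_sq_inner p n x = Max ((\<lambda>(i, j). (vinner p (x i) (x j))\<^sup>2) ` {(i, j). 1 \<le> i \<and> i < j \<and> j \<le> n})"

definition limit_cdf :: "real \<Rightarrow> real" where
  "limit_cdf x = exp (- ((8 * pi) powr (- 1 / 2) * exp (- x / 2)))"

definition limit_law :: "real measure" where
  "limit_law = interval_measure limit_cdf"

lemma limit_cdf_mono: "x \<le> y \<Longrightarrow> limit_cdf x \<le> limit_cdf y"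
  unfolding limit_cdf_def by (auto intro!: mult_left_mono)

lemma limit_cdf_tendsto:
  "(limit_cdf \<longlongrightarrow> 0) at_bot" "(limit_cdf \<longlongrightarrow> 1) at_top"
proof -
  define c :: real where "c = (8 * pi) powr (- 1 / 2)"
  have c: "c > 0" unfolding c_def by simp
  have eq: "limit_cdf = (\<lambda>x. exp (- (c * exp (- x / 2))))"
    by (simp add: limit_cdf_def c_def fun_eq_iff)
  show "(limit_cdf \<longlongrightarrow> 0) at_bot" "(limit_cdf \<longlongrightarrow> 1) at_top"
    unfolding eq using c by real_asymp+
qed

lemma isCont_limit_cdf: "isCont limit_cdf x"
  unfolding limit_cdf_def by (intro continuous_intros) auto

lemma limit_law: "real_distribution limit_law" "cdf limit_law = limit_cdf"
proof -
  have cont: "continuous (at_right a) limit_cdf" for a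
    using isCont_limit_cdf continuous_at_imp_continuous_at_within by blast
  show "real_distribution limit_law" unfolding limit_law_def
    by (intro real_distribution_interval_measure limit_cdf_mono cont limit_cdf_tendsto)
  show "cdf limit_law = limit_cdf" unfolding limit_law_def
    by (intro cdf_interval_measure limit_cdf_mono cont limit_cdf_tendsto)
qed

lemma L2_set_measurable [measurable]:
  "(\<lambda>x. L2_set x {..<p}) \<in> borel_measurable (\<Pi>\<^sub>M k\<in>{..<p}. borel)"
  unfolding L2_set_def by measurable

lemma vnormalize_measurable [measurable]:
  "vnormalize p \<in> (\<Pi>\<^sub>M k\<in>{..<p}. borel) \<rightarrow>\<^sub>M (\<Pi>\<^sub>M k\<in>{..<p}. borel)"
  unfolding vnormalize_def by measurable

lemma vinner_measurable:
  "vinner p \<mu> \<in> borel_measurable (\<Pi>\<^sub>M k\<in>{..<p}. borel)"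
  unfolding vinner_def[abs_def] by measurable

lemma sets_PiM_lborel: "sets (\<Pi>\<^sub>M k\<in>{..<p}. lborel :: real measure) = sets (\<Pi>\<^sub>M k\<in>{..<p}. borel)"
  by (intro sets_PiM_cong) auto

lemma unit_ball_sets: "unit_ball p \<in> sets (\<Pi>\<^sub>M k\<in>{..<p}. borel)"
proof -
  have "unit_ball p = {x \<in> space (\<Pi>\<^sub>M k\<in>{..<p}. borel). L2_set x {..<p} \<le> 1}"
    by (auto simp: unit_ball_def space_PiM)
  also have "\<dots> \<in> sets (\<Pi>\<^sub>M k\<in>{..<p}. borel)" by measurable
  finally show ?thesis .
qed

lemma unit_sphere_sets: "unit_sphere p \<in> sets (\<Pi>\<^sub>M k\<in>{..<p}. borel)"
proof -
  have "unit_sphere p = {x \<in> space (\<Pi>\<^sub>M k\<in>{..<p}. borel). L2_set x {..<p} = 1}"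
    by (auto simp: unit_sphere_def space_PiM)
  also have "\<dots> \<in> sets (\<Pi>\<^sub>M k\<in>{..<p}. borel)" by measurable
  finally show ?thesis .
qed

lemma space_uniform_sphere [simp]: "space (uniform_sphere p) = unit_sphere p"
  by (auto simp: uniform_sphere_def space_restrict_space space_PiM unit_sphere_def)

lemma emeasure_PiM_box:
  assumes "a \<le> b"
  shows "emeasure (\<Pi>\<^sub>M k\<in>{..<p}. lborel) (\<Pi>\<^sub>E k\<in>{..<p}. {a..b::real}) = ennreal ((b - a) ^ p)"
proof -
  interpret product_sigma_finite "\<lambda>_::nat. lborel :: real measure" ..
  show ?thesis using assms by (subst emeasure_PiM) (auto simp: ennreal_power)
qed

lemma emeasure_unit_ball_finite: "emeasure (\<Pi>\<^sub>M k\<in>{..<p}. lborel) (unit_ball p) \<noteq> \<infinity>"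
proof -
  let ?B = "\<Pi>\<^sub>E k\<in>{..<p}. {-1..1::real}"
  have "unit_ball p \<subseteq> ?B"
  proof
    fix x assume x: "x \<in> unit_ball p"
    have "\<bar>x k\<bar> \<le> 1" if "k < p" for k
    proof -
      have "\<bar>x k\<bar> \<le> L2_set (\<lambda>i. \<bar>x i\<bar>) {..<p}"
        using that by (intro member_le_L2_set) auto
      also have "\<dots> = L2_set x {..<p}" by (simp add: L2_set_def)
      finally show ?thesis using x by (auto simp: unit_ball_def)
    qed
    then show "x \<in> ?B" using x by (auto simp: unit_ball_def PiE_iff abs_le_iff minus_le_iff)
  qed
  moreover have "?B \<in> sets (\<Pi>\<^sub>M k\<in>{..<p}. lborel)" by (intro sets_PiM_I_finite) auto
  ultimately have "emeasure (\<Pi>\<^sub>M k\<in>{..<p}. lborel) (unit_ball p)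
      \<le> emeasure (\<Pi>\<^sub>M k\<in>{..<p}. lborel) ?B"
    by (rule emeasure_mono)
  also have "\<dots> < \<infinity>" by (subst emeasure_PiM_box) auto
  finally show ?thesis by simp
qed

lemma emeasure_unit_ball_pos:
  assumes "p > 0"
  shows "emeasure (\<Pi>\<^sub>M k\<in>{..<p}. lborel) (unit_ball p) \<noteq> 0"
proof -
  let ?B = "\<Pi>\<^sub>E k\<in>{..<p}. {0..1 / real p}"
  have "?B \<subseteq> unit_ball p"
  proof
    fix x assume x: "x \<in> ?B"
    have "L2_set x {..<p} \<le> (\<Sum>i<p. \<bar>x i\<bar>)" by (rule L2_set_le_sum_abs)
    also have "\<dots> \<le> (\<Sum>i<p. 1 / real p)" using x by (intro sum_mono) (auto simp: PiE_iff)
    also have "\<dots> = 1" using assms by simp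
    finally show "x \<in> unit_ball p" using x by (auto simp: unit_ball_def PiE_iff)
  qed
  moreover have "unit_ball p \<in> sets (\<Pi>\<^sub>M k\<in>{..<p}. lborel)"
    using unit_ball_sets sets_PiM_lborel by auto
  ultimately have "emeasure (\<Pi>\<^sub>M k\<in>{..<p}. lborel) ?B \<le> emeasure (\<Pi>\<^sub>M k\<in>{..<p}. lborel) (unit_ball p)"
    by (rule emeasure_mono)
  then have "ennreal ((1 / real p - 0) ^ p) \<le> emeasure (\<Pi>\<^sub>M k\<in>{..<p}. lborel) (unit_ball p)"
    by (subst (asm) emeasure_PiM_box) auto
  moreover have "ennreal ((1 / real p - 0) ^ p) > 0" using assms by simp
  ultimately show ?thesis by (auto dest: leD)
qed

lemma prob_space_uniform_sphere:
  assumes "p > 0"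
  shows "prob_space (uniform_sphere p)"
proof -
  let ?L = "\<Pi>\<^sub>M k\<in>{..<p}. lborel :: real measure" and ?R = "\<Pi>\<^sub>M k\<in>{..<p}. borel :: real measure"
  let ?U = "uniform_measure ?L (unit_ball p)"
  interpret product_sigma_finite "\<lambda>_::nat. lborel :: real measure" ..
  have UL: "unit_ball p \<in> sets ?L" using unit_ball_sets sets_PiM_lborel by auto
  interpret U: prob_space ?U
    by (rule prob_space_uniform_measure) (use emeasure_unit_ball_pos[OF assms] emeasure_unit_ball_finite in auto)
  have meas: "vnormalize p \<in> ?U \<rightarrow>\<^sub>M ?R"
    using vnormalize_measurable
    by (subst measurable_cong_sets[OF _ refl, where M' = ?R]) (simp_all add: sets_PiM_lborel)
  interpret D: prob_space "distr ?U ?R (vnormalize p)" using meas by (rule U.prob_space_distr)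
  have Z: "emeasure ?L {\<lambda>k\<in>{..<p}. 0} = 0"
  proof -
    have "{\<lambda>k\<in>{..<p}. 0::real} = (\<Pi>\<^sub>E k\<in>{..<p}. {0..0})" by auto
    then show ?thesis using emeasure_PiM_box[of 0 0 p] assms by simp
  qed
  have "{\<lambda>k\<in>{..<p}. 0::real} = (\<Pi>\<^sub>E k\<in>{..<p}. {0..0})" by auto
  moreover have "(\<Pi>\<^sub>E k\<in>{..<p}. {0..0::real}) \<in> sets ?L"
    by (rule sets_PiM_I_finite) auto
  ultimately have Zs: "{\<lambda>k\<in>{..<p}. 0::real} \<in> sets ?L" by (simp only:)
  have AE0: "AE x in ?L. x \<noteq> (\<lambda>k\<in>{..<p}. 0)"
    by (rule AE_I[OF _ Z Zs]) auto
  have "AE x in ?U. vnormalize p x \<in> unit_sphere p"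
  proof (rule AE_uniform_measureI[OF UL])
    show "AE x in ?L. x \<in> unit_ball p \<longrightarrow> vnormalize p x \<in> unit_sphere p"
      using AE0
    proof eventually_elim
      fix x :: "nat \<Rightarrow> real" assume x: "x \<noteq> (\<lambda>k\<in>{..<p}. 0)"
      show "x \<in> unit_ball p \<longrightarrow> vnormalize p x \<in> unit_sphere p"
      proof
        assume b: "x \<in> unit_ball p"
        then have "L2_set x {..<p} \<noteq> 0" using x
          by (auto simp: L2_set_eq_0_iff unit_ball_def PiE_iff extensional_def fun_eq_iff split: if_splits)
        then have n: "L2_set x {..<p} > 0" using L2_set_nonneg[of x "{..<p}"] by linarith
        have "L2_set (vnormalize p x) {..<p} = L2_set (\<lambda>k. (1 / L2_set x {..<p}) * x k) {..<p}"
          by (intro L2_set_cong) (auto simp: vnormalize_def)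
        also have "\<dots> = (1 / L2_set x {..<p}) * L2_set x {..<p}"
          using n by (intro L2_set_right_distrib[symmetric]) auto
        also have "\<dots> = 1" using n by simp
        finally show "vnormalize p x \<in> unit_sphere p" by (auto simp: unit_sphere_def vnormalize_def)
      qed
    qed
  qed
  moreover have S: "{x \<in> space ?R. x \<in> unit_sphere p} \<in> sets ?R"
    using unit_sphere_sets[of p] by (auto simp: space_PiM unit_sphere_def)
  ultimately have "AE x in distr ?U ?R (vnormalize p). x \<in> unit_sphere p"
    by (subst AE_distr_iff[OF meas]) (auto simp: S)
  then have "emeasure (distr ?U ?R (vnormalize p)) (unit_sphere p) = 1"
    using unit_sphere_sets by (intro D.emeasure_eq_1_AE) auto
  then show ?thesis
    unfolding uniform_sphere_def
    by (intro prob_space_restrict_space) (use unit_sphere_sets in auto)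
qed

lemma prob_space_FvML:
  assumes "p > 0"
  shows "prob_space (FvML p \<kappa> \<mu>)"
proof -
  interpret prob_space "uniform_sphere p" using assms by (rule prob_space_uniform_sphere)
  let ?f = "\<lambda>x. exp (\<kappa> * vinner p \<mu> x)"
  let ?Z = "LINT y|uniform_sphere p. ?f y"
  have sub: "sets (uniform_sphere p) = sets (restrict_space (\<Pi>\<^sub>M k\<in>{..<p}. borel) (unit_sphere p))"
    unfolding uniform_sphere_def by (intro sets_restrict_space_cong) simp
  have m: "vinner p \<mu> \<in> borel_measurable (uniform_sphere p)"
    using measurable_restrict_space1[OF vinner_measurable] measurable_cong_sets[OF sub refl] by blast
  have bd: "\<bar>vinner p \<mu> x\<bar> \<le> L2_set \<mu> {..<p}" if "x \<in> unit_sphere p" for x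
  proof -
    have "\<bar>vinner p \<mu> x\<bar> \<le> (\<Sum>k<p. \<bar>\<mu> k\<bar> * \<bar>x k\<bar>)"
      unfolding vinner_def by (rule order_trans[OF sum_abs]) (simp add: abs_mult)
    also have "\<dots> \<le> L2_set \<mu> {..<p} * L2_set x {..<p}" by (rule L2_set_mult_ineq)
    finally show ?thesis using that by (simp add: unit_sphere_def)
  qed
  have bd': "\<bar>\<kappa> * vinner p \<mu> x\<bar> \<le> \<bar>\<kappa>\<bar> * L2_set \<mu> {..<p}" if "x \<in> unit_sphere p" for x
    using bd[OF that] by (simp add: abs_mult mult_left_mono)
  have int: "integrable (uniform_sphere p) ?f"
  proof (rule integrable_const_bound[where B = "exp (\<bar>\<kappa>\<bar> * L2_set \<mu> {..<p})"])
    show "AE x in uniform_sphere p. norm (?f x) \<le> exp (\<bar>\<kappa>\<bar> * L2_set \<mu> {..<p})"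
      using bd' by (intro AE_I2) (auto simp: abs_le_iff)
  qed (use m in measurable)
  have "exp (- (\<bar>\<kappa>\<bar> * L2_set \<mu> {..<p})) = (LINT y|uniform_sphere p. exp (- (\<bar>\<kappa>\<bar> * L2_set \<mu> {..<p})))"
    using prob_space by simp
  also have "\<dots> \<le> ?Z"
    using bd' int by (intro integral_mono) (auto simp: abs_le_iff minus_le_iff)
  finally have Z: "?Z > 0" by (meson exp_gt_zero order_less_le_trans)
  have [measurable]: "?f \<in> borel_measurable (uniform_sphere p)" using m by measurable
  show ?thesis unfolding FvML_def
  proof (rule prob_spaceI)
    have "(\<integral>\<^sup>+ x. ennreal (?f x / ?Z) \<partial>uniform_sphere p) = ennreal (LINT x|uniform_sphere p. ?f x / ?Z)"
      using Z int by (intro nn_integral_eq_integral) auto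
    also have "\<dots> = 1" using Z by simp
    finally have one: "(\<integral>\<^sup>+ x. ennreal (?f x / ?Z) \<partial>uniform_sphere p) = 1" .
    show "emeasure (density (uniform_sphere p) (\<lambda>x. ennreal (?f x / ?Z)))
        (space (density (uniform_sphere p) (\<lambda>x. ennreal (?f x / ?Z)))) = 1"
      unfolding space_density
      by (subst emeasure_density)
         (use one in \<open>simp_all add: nn_integral_set_ennreal del: space_uniform_sphere\<close>)
  qed
qed

end

theory Submission imports Defs begin

text \<open>
  Fix \<open>x\<close> and put \<open>t = 4 log n - log log n + x\<close>.  Call a pair \<open>i < j\<close> exceeding if
  \<open>p (X\<^sub>i \<bullet> X\<^sub>j)\<^sup>2 > t\<close>.  The event \<open>P\<^sub>n \<le> x\<close> says that no pair exceeds, and the claimed limit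
  \<open>exp (- L)\<close> with \<open>L = (8 \<pi>) powr (- 1 / 2) * exp (- x / 2)\<close> is the probability that a Poisson
  variable of mean \<open>L\<close> vanishes.  So the theorem is a Poisson approximation for the number of
  exceeding pairs.

  \<^emph>\<open>Poisson approximation.\<close>  Pairs without a common index are independent.  The lemma
  \<open>void_probability_poisson\<close> therefore bounds the error by sums over couples of pairs that do have a
  common index, and two facts suffice: a given pair exceeds with probability asymptotic to
  \<open>2 L / n\<^sup>2\<close>, and two given pairs with one common index both exceed with probability
  \<open>o(1 / n\<^sup>3)\<close>.

  \<^emph>\<open>The uniform distribution.\<close>  If the points are uniform on the sphere, then given \<open>X\<^sub>i\<close> the products
  \<open>X\<^sub>i \<bullet> X\<^sub>j\<close> and \<open>X\<^sub>i \<bullet> X\<^sub>l\<close> are independent, and each has the law of one coordinate of a uniform point.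
  Hence the second probability is the square of the first.  One coordinate has a density
  proportional to \<open>(1 - u\<^sup>2) powr ((p - 3) / 2)\<close> (\<open>distr_sphere_coordinate\<close>), which gives the first
  probability up to a factor tending to 1 (\<open>coord_tail_asymp\<close>).  The growth condition on \<open>p\<close> is what
  turns \<open>(1 - t / p) powr (p / 2)\<close> into \<open>exp (- t / 2)\<close> for \<open>t\<close> of the order of \<open>log n\<close>.

  \<^emph>\<open>The FvML distribution.\<close>  Both events depend on inner products only.  By rotation invariance the
  joint density \<open>exp (\<kappa> \<mu> \<bullet> (x\<^sub>1 + \<dots> + x\<^sub>k)) / Z ^ k\<close> may be averaged over a uniform \<open>\<mu>\<close>, and it
  becomes \<open>g (\<kappa> |x\<^sub>1 + \<dots> + x\<^sub>k|) / g \<kappa> ^ k\<close>, where \<open>g\<close> is the moment generating function of one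
  coordinate (\<open>emeasure_FvML_sample\<close>).  A comparison of power series shows
  \<open>exp y * (1 - y\<^sup>2 / p) \<le> g s \<le> exp y\<close> for \<open>y = s\<^sup>2 / (2 p)\<close> (\<open>coord_mgf_bounds\<close>).  Since
  \<open>|x\<^sub>1 + \<dots> + x\<^sub>k|\<^sup>2\<close> is \<open>k\<close> plus the sum of the products \<open>x\<^sub>i \<bullet> x\<^sub>j\<close> over \<open>i \<noteq> j\<close>, the averaged density is
  \<open>exp (\<kappa>\<^sup>2 / (2 p) * (\<Sum>i\<noteq>j. x\<^sub>i \<bullet> x\<^sub>j))\<close> up to a factor \<open>1 + O(\<kappa> ^ 4 / p ^ 3)\<close>.  For
  \<open>\<kappa> = \<tau> p powr (3 / 4) / sqrt n\<close> the error \<open>\<kappa> ^ 4 / p ^ 3\<close> equals \<open>\<tau> ^ 4 / n\<^sup>2\<close>, and the exponent is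
  \<open>\<tau>\<^sup>2 / (2 n)\<close> times a variable with Gaussian tails of bounded scale.  So the exponent is
  negligible outside an event whose probability decays faster than any power of \<open>n\<close>, and both
  probabilities are asymptotically the same as for uniform points
  (\<open>FvML_sample_comparison\<close>).
\<close>

section \<open>Poisson approximation for dissociated events\<close>

lemma (in prob_space) indep_var_cong_space:
  assumes "indep_var S X T Y"
    and "\<And>\<omega>. \<omega> \<in> space M \<Longrightarrow> X \<omega> = X' \<omega>" "\<And>\<omega>. \<omega> \<in> space M \<Longrightarrow> Y \<omega> = Y' \<omega>"
  shows "indep_var S X' T Y'"
proof -
  have "X -` A \<inter> space M = X' -` A \<inter> space M" "Y -` A \<inter> space M = Y' -` A \<inter> space M" for A
    using assms(2,3) by auto
  then show ?thesis
    using assms(1) measurable_cong[of M X X' S] measurable_cong[of M Y Y' T] assms(2,3)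
    unfolding indep_var_eq by simp
qed

lemma measurable_card_events:
  assumes "finite C" "\<And>b. b \<in> C \<Longrightarrow> E b \<in> sets M"
  shows "(\<lambda>x. card {b \<in> C. x \<in> E b}) \<in> M \<rightarrow>\<^sub>M count_space UNIV"
proof -
  have "(\<lambda>x. \<Sum>b\<in>C. (indicator (E b) x :: nat)) \<in> M \<rightarrow>\<^sub>M count_space UNIV"
  proof (rule measurable_sum_nat)
    fix b assume "b \<in> C"
    then have [measurable]: "E b \<in> sets M" using assms by auto
    have "(\<lambda>x. if x \<in> E b then 1 else 0 :: nat) \<in> M \<rightarrow>\<^sub>M count_space UNIV" by measurable
    then show "(\<lambda>x. indicator (E b) x :: nat) \<in> M \<rightarrow>\<^sub>M count_space UNIV"
      by (simp add: indicator_def)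
  qed
  moreover have "(\<lambda>x. \<Sum>b\<in>C. (indicator (E b) x :: nat)) = (\<lambda>x. card {b \<in> C. x \<in> E b})"
    using assms(1) by (simp add: fun_eq_iff sum.If_cases indicator_def Int_def)
  ultimately show ?thesis by simp
qed

lemma (in prob_space) integrable_bounded:
  fixes f :: "'a \<Rightarrow> real"
  assumes "f \<in> borel_measurable M" "\<And>\<omega>. \<bar>f \<omega>\<bar> \<le> C"
  shows "integrable M f"
  using assms by (intro integrable_const_bound[where B = C]) auto

text \<open>
  Let \<open>W\<close> count the events that occur and let \<open>\<phi> s\<close> be the expectation of \<open>s ^ W\<close>, so that \<open>\<phi> 0\<close> is
  the probability in question.  Its derivative is the sum over \<open>i\<close> of the expectations of
  \<open>s ^ (W - 1)\<close> on \<open>E i\<close>.  For \<open>s\<close> in the unit interval, removing the events in \<open>B i\<close> from the exponent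
  changes the power by at most the number of those that occur, and what remains is independent of
  \<open>E i\<close>.  Hence \<open>\<phi>\<close> solves the equation \<open>\<phi>' = lam * \<phi>\<close> of the Poisson generating function up to the
  stated error.  It is integrated from \<open>s = 1\<close>, where \<open>\<phi>\<close> is 1, to \<open>s = 0\<close>.
\<close>

lemma (in prob_space) void_probability_poisson:
  fixes E :: "'i \<Rightarrow> 'a set" and B :: "'i \<Rightarrow> 'i set"
  assumes I: "finite I" and E [measurable]: "\<And>i. i \<in> I \<Longrightarrow> E i \<in> events"
    and B: "\<And>i. i \<in> I \<Longrightarrow> B i \<subseteq> I" "\<And>i. i \<in> I \<Longrightarrow> i \<in> B i"
    and indep: "\<And>i. i \<in> I \<Longrightarrow>
      indep_var (count_space UNIV) (indicator (E i)) (count_space UNIV) (\<lambda>\<omega>. card {j \<in> I - B i. \<omega> \<in> E j})"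
  shows "\<bar>prob {\<omega> \<in> space M. \<forall>i\<in>I. \<omega> \<notin> E i} - exp (- (\<Sum>i\<in>I. prob (E i)))\<bar>
    \<le> (\<Sum>i\<in>I. \<Sum>j\<in>B i. prob (E i) * prob (E j)) + (\<Sum>i\<in>I. \<Sum>j\<in>B i - {i}. prob (E i \<inter> E j))"
proof -
  define N where "N A \<omega> = card {j \<in> A. \<omega> \<in> E j}" for A \<omega>
  have fin: "finite A" if "A \<subseteq> I" for A using that I finite_subset by blast
  have N_sum: "real (N A \<omega>) = (\<Sum>j\<in>A. indicator (E j) \<omega>)" if "A \<subseteq> I" for A \<omega>
    using fin[OF that] by (simp add: N_def sum.If_cases indicator_def Int_def)
  have N_meas [measurable]: "N A \<in> measurable M (count_space UNIV)" if "A \<subseteq> I" for A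
    unfolding N_def using that E by (intro measurable_card_events fin) auto
  have N_le: "N A \<omega> \<le> card I" if "A \<subseteq> I" for A \<omega>
    unfolding N_def using that I by (intro card_mono) auto
  have N_split: "N (A \<union> C) \<omega> = N A \<omega> + N C \<omega>" if "A \<subseteq> I" "C \<subseteq> I" "A \<inter> C = {}" for A C \<omega>
  proof -
    have "{j \<in> A \<union> C. \<omega> \<in> E j} = {j \<in> A. \<omega> \<in> E j} \<union> {j \<in> C. \<omega> \<in> E j}" by auto
    then show ?thesis unfolding N_def
      using fin[OF that(1)] fin[OF that(2)] that(3) by (simp add: card_Un_disjoint disjoint_iff)
  qed
  have E_N: "expectation (\<lambda>\<omega>. real (N A \<omega>)) = (\<Sum>j\<in>A. prob (E j))" if "A \<subseteq> I" for A
  proof -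
    have "expectation (\<lambda>\<omega>. real (N A \<omega>)) = expectation (\<lambda>\<omega>. \<Sum>j\<in>A. indicator (E j) \<omega>)"
      using N_sum[OF that] by simp
    also have "\<dots> = (\<Sum>j\<in>A. expectation (indicator (E j)))"
      using that E by (intro Bochner_Integration.integral_sum) (auto intro!: integrable_bounded[where C = 1])
    finally show ?thesis using that E by (simp add: subset_iff cong: sum.cong)
  qed
  define lam where "lam = (\<Sum>i\<in>I. prob (E i))"
  define \<epsilon> where "\<epsilon> = (\<Sum>i\<in>I. \<Sum>j\<in>B i. prob (E i) * prob (E j)) + (\<Sum>i\<in>I. \<Sum>j\<in>B i - {i}. prob (E i \<inter> E j))"
  define \<phi> where "\<phi> s = expectation (\<lambda>\<omega>. s ^ N I \<omega>)" for s :: real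
  define \<phi>' where "\<phi>' s = expectation (\<lambda>\<omega>. real (N I \<omega>) * s ^ (N I \<omega> - 1))" for s :: real
  let ?P = "\<lambda>k. prob {\<omega> \<in> space M. N I \<omega> = k}"
  have fin_exp: "expectation (\<lambda>\<omega>. f (N I \<omega>)) = (\<Sum>k\<le>card I. ?P k * f k)" for f :: "nat \<Rightarrow> real"
  proof -
    have "f (N I \<omega>) = (\<Sum>k\<le>card I. f k * indicator {\<omega> \<in> space M. N I \<omega> = k} \<omega>)"
      if "\<omega> \<in> space M" for \<omega>
    proof -
      have "(\<Sum>k\<le>card I. f k * indicator {\<omega> \<in> space M. N I \<omega> = k} \<omega>)
          = (\<Sum>k\<le>card I. if k = N I \<omega> then f k else 0)"
        using that by (intro sum.cong) auto
      then show ?thesis using N_le[of I \<omega>] by simp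
    qed
    then have "expectation (\<lambda>\<omega>. f (N I \<omega>))
        = expectation (\<lambda>\<omega>. \<Sum>k\<le>card I. f k * indicator {\<omega> \<in> space M. N I \<omega> = k} \<omega>)"
      by (intro Bochner_Integration.integral_cong) auto
    also have "\<dots> = (\<Sum>k\<le>card I. expectation (\<lambda>\<omega>. f k * indicator {\<omega> \<in> space M. N I \<omega> = k} \<omega>))"
      by (intro Bochner_Integration.integral_sum integrable_mult_right integrable_bounded[where C = 1]) auto
    also have "\<dots> = (\<Sum>k\<le>card I. ?P k * f k)"
      by (intro sum.cong refl) (simp add: Int_absorb2[OF Collect_restrict])
    finally show ?thesis .
  qed
  have \<phi>_der: "(\<phi> has_real_derivative \<phi>' s) (at s)" for s
  proof -
    have "\<phi> = (\<lambda>s. \<Sum>k\<le>card I. ?P k * s ^ k)"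
      unfolding \<phi>_def fun_eq_iff using fin_exp[of "\<lambda>k. s ^ k" for s] by simp
    moreover have "\<phi>' s = (\<Sum>k\<le>card I. ?P k * (real k * s ^ (k - 1)))"
      unfolding \<phi>'_def using fin_exp[of "\<lambda>k. real k * s ^ (k - 1)"] by simp
    ultimately show ?thesis by (auto intro!: derivative_eq_intros sum.cong)
  qed
  have \<phi>1: "\<phi> 1 = 1" by (simp add: \<phi>_def prob_space)
  have \<phi>0: "\<phi> 0 = prob {\<omega> \<in> space M. \<forall>i\<in>I. \<omega> \<notin> E i}"
  proof -
    have Z: "N I \<omega> = 0 \<longleftrightarrow> (\<forall>i\<in>I. \<omega> \<notin> E i)" for \<omega> using I by (auto simp: N_def)
    have "\<phi> 0 = expectation (indicator {\<omega> \<in> space M. \<forall>i\<in>I. \<omega> \<notin> E i})"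
      unfolding \<phi>_def using Z
      by (intro Bochner_Integration.integral_cong) (auto simp: power_0_left split: split_indicator)
    then show ?thesis by (simp add: Int_absorb2[OF Collect_restrict])
  qed
  have err: "\<bar>\<phi>' s - lam * \<phi> s\<bar> \<le> \<epsilon>" if s: "0 \<le> s" "s \<le> 1" for s
  proof -
    have pow01: "0 \<le> s ^ k" "s ^ k \<le> 1" for k using s by (auto intro: power_le_one)
    have pow_diff: "\<bar>s ^ (a + b) - s ^ b\<bar> = s ^ b * (1 - s ^ a)" for a b
    proof -
      have "s ^ (a + b) - s ^ b = - (s ^ b * (1 - s ^ a))" by (simp add: power_add algebra_simps)
      moreover have "s ^ b * (1 - s ^ a) \<ge> 0" using pow01 by (intro mult_nonneg_nonneg) auto
      ultimately show ?thesis by simp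
    qed
    \<comment> \<open>a crude Bernoulli inequality: removing an exponent costs at most that exponent\<close>
    have bern: "1 - s ^ k \<le> real k" for k
      using pow01[of k] by (cases k) auto
    have sI: "(\<lambda>\<omega>. s ^ N A \<omega>) \<in> borel_measurable M" if "A \<subseteq> I" for A
      using that by measurable
    have nI: "(\<lambda>\<omega>. real (N A \<omega>)) \<in> borel_measurable M" if "A \<subseteq> I" for A
      using that by measurable
    have int_s: "integrable M (\<lambda>\<omega>. s ^ N A \<omega>)" if "A \<subseteq> I" for A
      using pow01 sI[OF that] by (intro integrable_bounded[where C = 1]) auto
    have int_n: "integrable M (\<lambda>\<omega>. real (N A \<omega>))" if "A \<subseteq> I" for A
      using N_le[OF that] nI[OF that] by (intro integrable_bounded[where C = "real (card I)"]) auto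
    define D where "D i = expectation (\<lambda>\<omega>. indicator (E i) \<omega> * s ^ (N I \<omega> - 1))" for i
    have \<phi>'_D: "\<phi>' s = (\<Sum>i\<in>I. D i)"
    proof -
      have "\<phi>' s = expectation (\<lambda>\<omega>. \<Sum>i\<in>I. indicator (E i) \<omega> * s ^ (N I \<omega> - 1))"
        unfolding \<phi>'_def by (simp add: N_sum sum_distrib_right)
      also have "\<dots> = (\<Sum>i\<in>I. D i)" unfolding D_def
        using pow01 E by (intro Bochner_Integration.integral_sum integrable_bounded[where C = 1])
          (auto simp: abs_mult indicator_def)
      finally show ?thesis .
    qed
    have "\<bar>D i - prob (E i) * \<phi> s\<bar> \<le> (\<Sum>j\<in>B i. prob (E i) * prob (E j)) + (\<Sum>j\<in>B i - {i}. prob (E i \<inter> E j))"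
      if i: "i \<in> I" for i
    proof -
      let ?V = "N (I - B i)" and ?Z = "N (B i - {i})"
      let ?d = "\<lambda>\<omega>. indicator (E i) \<omega> * s ^ (N I \<omega> - 1) - indicator (E i) \<omega> * s ^ ?V \<omega>"
      note [measurable] = E[OF i]
      have sub: "I - B i \<subseteq> I" "B i - {i} \<subseteq> I" "B i \<subseteq> I" using B(1)[OF i] by auto
      have W: "N I \<omega> = N (B i) \<omega> + ?V \<omega>" for \<omega>
        using N_split[of "B i" "I - B i" \<omega>] sub by (simp add: Un_absorb1)
      have W1: "N I \<omega> - 1 = ?Z \<omega> + ?V \<omega>" if "\<omega> \<in> E i" for \<omega>
      proof -
        have "N (B i) \<omega> = N {i} \<omega> + ?Z \<omega>"
          using N_split[of "{i}" "B i - {i}" \<omega>] sub i B(2)[OF i] by (simp add: insert_absorb)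
        moreover have "{j \<in> {i}. \<omega> \<in> E j} = {i}" using that by auto
        ultimately show ?thesis using W[of \<omega>] by (simp add: N_def)
      qed
      have iv: "expectation (\<lambda>\<omega>. indicator (E i) \<omega> * s ^ ?V \<omega>) = prob (E i) * expectation (\<lambda>\<omega>. s ^ ?V \<omega>)"
      proof -
        have "indep_var borel (real \<circ> indicator (E i)) borel ((\<lambda>k. s ^ k) \<circ> ?V)"
          unfolding N_def[abs_def] by (rule indep_var_compose[OF indep[OF i]]) auto
        moreover have "real \<circ> indicator (E i) = indicator (E i)"
          by (auto simp: fun_eq_iff indicator_def)
        ultimately have "expectation (\<lambda>\<omega>. indicator (E i) \<omega> * ((\<lambda>k. s ^ k) \<circ> ?V) \<omega>)
            = expectation (indicator (E i)) * expectation ((\<lambda>k. s ^ k) \<circ> ?V)"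
          by (intro indep_var_lebesgue_integral)
             (auto simp: o_def intro!: integrable_bounded[where C = 1] int_s sub)
        then show ?thesis by (simp add: o_def)
      qed
      have "\<bar>D i - expectation (\<lambda>\<omega>. indicator (E i) \<omega> * s ^ ?V \<omega>)\<bar>
          = \<bar>expectation (\<lambda>\<omega>. ?d \<omega>)\<bar>"
        unfolding D_def using pow01 sub
        by (subst Bochner_Integration.integral_diff) (auto intro!: integrable_bounded[where C = 1] simp: abs_mult indicator_def)
      also have "\<dots> \<le> expectation (\<lambda>\<omega>. \<bar>?d \<omega>\<bar>)"
        by (rule integral_abs_bound)
      also have "\<dots> \<le> expectation (\<lambda>\<omega>. \<Sum>j\<in>B i - {i}. indicator (E i \<inter> E j) \<omega>)"
      proof (rule integral_mono)
        show "integrable M (\<lambda>\<omega>. \<bar>?d \<omega>\<bar>)"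
          using pow01 sub
          by (intro integrable_abs Bochner_Integration.integrable_diff)
             (auto intro!: integrable_bounded[where C = 1] simp: abs_mult indicator_def)
        show "integrable M (\<lambda>\<omega>. \<Sum>j\<in>B i - {i}. indicator (E i \<inter> E j) \<omega> :: real)"
          using sub E by (intro Bochner_Integration.integrable_sum integrable_bounded[where C = 1]) auto
        fix \<omega>
        show "\<bar>?d \<omega>\<bar>
            \<le> (\<Sum>j\<in>B i - {i}. indicator (E i \<inter> E j) \<omega>)"
        proof (cases "\<omega> \<in> E i")
          case True
          have "\<bar>s ^ (?Z \<omega> + ?V \<omega>) - s ^ ?V \<omega>\<bar> = s ^ ?V \<omega> * (1 - s ^ ?Z \<omega>)"
            by (rule pow_diff)
          also have "\<dots> \<le> 1 * real (?Z \<omega>)"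
            using pow01 bern by (intro mult_mono) auto
          also have "\<dots> = (\<Sum>j\<in>B i - {i}. indicator (E i \<inter> E j) \<omega>)"
            using True N_sum[OF sub(2), of \<omega>] by (simp add: indicator_inter_arith)
          finally show ?thesis using True W1[OF True] by simp
        qed (simp add: sum_nonneg)
      qed
      also have "\<dots> = (\<Sum>j\<in>B i - {i}. prob (E i \<inter> E j))"
      proof (subst Bochner_Integration.integral_sum)
        show "integrable M (indicator (E i \<inter> E j) :: 'a \<Rightarrow> real)" if "j \<in> B i - {i}" for j
          using sub that E by (intro integrable_bounded[where C = 1]) auto
        show "(\<Sum>j\<in>B i - {i}. expectation (indicator (E i \<inter> E j))) = (\<Sum>j\<in>B i - {i}. prob (E i \<inter> E j))"
          using sub E i by (intro sum.cong refl) (auto simp: subset_iff)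
      qed
      finally have 1: "\<bar>D i - prob (E i) * expectation (\<lambda>\<omega>. s ^ ?V \<omega>)\<bar> \<le> (\<Sum>j\<in>B i - {i}. prob (E i \<inter> E j))"
        unfolding iv .
      have "\<bar>expectation (\<lambda>\<omega>. s ^ ?V \<omega>) - \<phi> s\<bar> = \<bar>expectation (\<lambda>\<omega>. s ^ ?V \<omega> - s ^ N I \<omega>)\<bar>"
        unfolding \<phi>_def using int_s sub by (subst Bochner_Integration.integral_diff) auto
      also have "\<dots> \<le> expectation (\<lambda>\<omega>. \<bar>s ^ ?V \<omega> - s ^ N I \<omega>\<bar>)"
        by (rule integral_abs_bound)
      also have "\<dots> \<le> expectation (\<lambda>\<omega>. real (N (B i) \<omega>))"
      proof (rule integral_mono)
        show "integrable M (\<lambda>\<omega>. \<bar>s ^ ?V \<omega> - s ^ N I \<omega>\<bar>)"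
          using int_s sub by (intro integrable_abs Bochner_Integration.integrable_diff) auto
        show "integrable M (\<lambda>\<omega>. real (N (B i) \<omega>))" using int_n sub by auto
        fix \<omega>
        have "\<bar>s ^ ?V \<omega> - s ^ (N (B i) \<omega> + ?V \<omega>)\<bar> = s ^ ?V \<omega> * (1 - s ^ N (B i) \<omega>)"
          using pow_diff by (simp add: abs_minus_commute)
        also have "\<dots> \<le> 1 * real (N (B i) \<omega>)" using pow01 bern by (intro mult_mono) auto
        finally show "\<bar>s ^ ?V \<omega> - s ^ N I \<omega>\<bar> \<le> real (N (B i) \<omega>)" unfolding W by simp
      qed
      also have "\<dots> = (\<Sum>j\<in>B i. prob (E j))" using E_N sub by auto
      finally have 2: "\<bar>expectation (\<lambda>\<omega>. s ^ ?V \<omega>) - \<phi> s\<bar> \<le> (\<Sum>j\<in>B i. prob (E j))" .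
      have "\<bar>prob (E i) * expectation (\<lambda>\<omega>. s ^ ?V \<omega>) - prob (E i) * \<phi> s\<bar>
          = prob (E i) * \<bar>expectation (\<lambda>\<omega>. s ^ ?V \<omega>) - \<phi> s\<bar>"
        by (simp add: abs_mult flip: right_diff_distrib)
      also have "\<dots> \<le> (\<Sum>j\<in>B i. prob (E i) * prob (E j))"
        unfolding sum_distrib_left[symmetric] using 2 by (intro mult_left_mono) auto
      finally show ?thesis using 1 by linarith
    qed
    then have "(\<Sum>i\<in>I. \<bar>D i - prob (E i) * \<phi> s\<bar>) \<le> \<epsilon>"
      unfolding \<epsilon>_def sum.distrib[symmetric] by (intro sum_mono) auto
    moreover have "\<bar>\<phi>' s - lam * \<phi> s\<bar> \<le> (\<Sum>i\<in>I. \<bar>D i - prob (E i) * \<phi> s\<bar>)"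
      unfolding \<phi>'_D lam_def sum_distrib_right sum_subtractf[symmetric] by (rule sum_abs)
    ultimately show ?thesis by linarith
  qed
  have lam0: "lam \<ge> 0" by (simp add: lam_def sum_nonneg)
  define \<psi> where "\<psi> s = exp (lam * (1 - s)) * \<phi> s" for s
  have "(\<psi> has_real_derivative exp (lam * (1 - s)) * (\<phi>' s - lam * \<phi> s)) (at s)" for s
    unfolding \<psi>_def by (auto intro!: derivative_eq_intros \<phi>_der simp: algebra_simps)
  then obtain s where s: "0 < s" "s < 1" "\<psi> 1 - \<psi> 0 = (1 - 0) * (exp (lam * (1 - s)) * (\<phi>' s - lam * \<phi> s))"
    using MVT2[of 0 1 \<psi> "\<lambda>s. exp (lam * (1 - s)) * (\<phi>' s - lam * \<phi> s)"] by auto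
  have "\<bar>\<psi> 1 - \<psi> 0\<bar> = exp (lam * (1 - s)) * \<bar>\<phi>' s - lam * \<phi> s\<bar>" using s by (simp add: abs_mult)
  also have "\<dots> \<le> exp lam * \<epsilon>"
    using s lam0 err[of s] by (intro mult_mono) (auto intro: mult_left_le)
  finally have b: "\<bar>1 - exp lam * \<phi> 0\<bar> \<le> exp lam * \<epsilon>" by (simp add: \<psi>_def \<phi>1)
  have "\<phi> 0 - exp (- lam) = exp (- lam) * (exp lam * \<phi> 0 - 1)"
    by (simp add: right_diff_distrib mult.assoc[symmetric] flip: exp_add)
  then have "\<bar>\<phi> 0 - exp (- lam)\<bar> = exp (- lam) * \<bar>1 - exp lam * \<phi> 0\<bar>"
    by (simp add: abs_mult abs_minus_commute)
  also have "\<dots> \<le> exp (- lam) * (exp lam * \<epsilon>)" using b by (intro mult_left_mono) auto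
  also have "\<dots> = \<epsilon>" by (simp add: mult.assoc[symmetric] flip: exp_add)
  finally show ?thesis by (simp add: \<phi>0 lam_def \<epsilon>_def)
qed

section \<open>Lebesgue measure on coordinate functions and its reflections\<close>

abbreviation leb :: "nat \<Rightarrow> (nat \<Rightarrow> real) measure" where
  "leb p \<equiv> \<Pi>\<^sub>M k\<in>{..<p}. lborel"

abbreviation bor :: "nat \<Rightarrow> (nat \<Rightarrow> real) measure" where
  "bor p \<equiv> \<Pi>\<^sub>M k\<in>{..<p}. borel"

lemma sets_leb [measurable_cong]: "sets (leb p) = sets (bor p)"
  by (rule sets_PiM_lborel)

lemma space_bor: "space (bor p) = {..<p} \<rightarrow>\<^sub>E UNIV"
  by (simp add: space_PiM)

lemma space_leb: "space (leb p) = {..<p} \<rightarrow>\<^sub>E UNIV"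
  by (simp add: space_PiM)

lemma sigma_finite_leb: "sigma_finite_measure (leb p)"
proof -
  interpret product_sigma_finite "\<lambda>_::nat. lborel :: real measure" ..
  show ?thesis by (rule sigma_finite) simp
qed

text \<open>
  Scalings yield the homogeneity of the volume, while translations (\<open>c = 1\<close>) and point reflections
  (\<open>c = - 1\<close>) are what the invariance under isometries is derived from.
\<close>

lemma nn_integral_leb_affine:
  fixes a :: "nat \<Rightarrow> real" and c :: real
  assumes f [measurable]: "f \<in> borel_measurable (bor p)" and c: "c \<noteq> 0"
  shows "(\<integral>\<^sup>+x. f x \<partial>leb p) = ennreal (\<bar>c\<bar> ^ p) * (\<integral>\<^sup>+x. f (\<lambda>k\<in>{..<p}. a k + c * x k) \<partial>leb p)"
proof -
  interpret product_sigma_finite "\<lambda>_::nat. lborel :: real measure" ..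
  define T where "T = (\<lambda>x::nat \<Rightarrow> real. \<lambda>k\<in>{..<p}. a k + c * x k)"
  have T [measurable]: "T \<in> bor p \<rightarrow>\<^sub>M bor p" unfolding T_def by measurable
  have T' [measurable]: "T \<in> leb p \<rightarrow>\<^sub>M leb p" by measurable
  have "density (distr (leb p) (leb p) T) (\<lambda>_. ennreal (\<bar>c\<bar> ^ p)) = leb p"
  proof (rule PiM_eqI)
    fix A :: "nat \<Rightarrow> real set" assume A: "\<And>i. i \<in> {..<p} \<Longrightarrow> A i \<in> sets lborel"
    have sA: "Pi\<^sub>E {..<p} A \<in> sets (leb p)" using A by (intro sets_PiM_I_finite) auto
    have vim: "T -` Pi\<^sub>E {..<p} A \<inter> space (leb p) = Pi\<^sub>E {..<p} (\<lambda>k. (\<lambda>x. a k + c * x) -` A k)"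
      by (auto simp: T_def space_PiM PiE_iff)
    have one: "emeasure lborel (A k) = ennreal \<bar>c\<bar> * emeasure lborel ((\<lambda>x. a k + c * x) -` A k)"
      if "k < p" for k
    proof -
      have [measurable]: "A k \<in> sets borel" using A[of k] that by simp
      have m: "(\<lambda>x. a k + c * x) -` A k \<in> sets borel"
        by (rule measurable_sets_borel[OF _ \<open>A k \<in> sets borel\<close>]) measurable
      have "emeasure lborel (A k) = (\<integral>\<^sup>+x. indicator (A k) x \<partial>lborel)" by simp
      also have "\<dots> = ennreal \<bar>c\<bar> * (\<integral>\<^sup>+x. indicator (A k) (a k + c * x) \<partial>lborel)"
        by (rule nn_integral_real_affine) (use c in auto)
      also have "(\<integral>\<^sup>+x. indicator (A k) (a k + c * x) \<partial>lborel)
          = (\<integral>\<^sup>+x. indicator ((\<lambda>x. a k + c * x) -` A k) x \<partial>lborel)"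
        by (intro nn_integral_cong) (auto split: split_indicator)
      also have "\<dots> = emeasure lborel ((\<lambda>x. a k + c * x) -` A k)" using m by simp
      finally show ?thesis .
    qed
    have mk: "(\<lambda>x. a k + c * x) -` A k \<in> sets lborel" if "k < p" for k
    proof -
      have [measurable]: "A k \<in> sets borel" using A[of k] that by simp
      have "(\<lambda>x. a k + c * x) -` A k \<in> sets borel"
        by (rule measurable_sets_borel[OF _ \<open>A k \<in> sets borel\<close>]) measurable
      then show ?thesis by simp
    qed
    have "emeasure (density (distr (leb p) (leb p) T) (\<lambda>_. ennreal (\<bar>c\<bar> ^ p))) (Pi\<^sub>E {..<p} A)
        = ennreal (\<bar>c\<bar> ^ p) * emeasure (leb p) (T -` Pi\<^sub>E {..<p} A \<inter> space (leb p))"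
      using sA by (simp add: emeasure_density_const emeasure_distr)
    also have "\<dots> = (\<Prod>k<p. ennreal \<bar>c\<bar>) * (\<Prod>k<p. emeasure lborel ((\<lambda>x. a k + c * x) -` A k))"
      unfolding vim using mk by (subst emeasure_PiM) (auto simp: ennreal_power)
    also have "\<dots> = (\<Prod>k<p. emeasure lborel (A k))"
      unfolding prod.distrib[symmetric] using one by (intro prod.cong) auto
    finally show "emeasure (density (distr (leb p) (leb p) T) (\<lambda>_. ennreal (\<bar>c\<bar> ^ p))) (Pi\<^sub>E {..<p} A)
        = (\<Prod>k\<in>{..<p}. emeasure lborel (A k))" .
  qed auto
  then have "(\<integral>\<^sup>+x. f x \<partial>leb p) = (\<integral>\<^sup>+x. f x \<partial>density (distr (leb p) (leb p) T) (\<lambda>_. ennreal (\<bar>c\<bar> ^ p)))"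
    by simp
  also have "\<dots> = (\<integral>\<^sup>+x. ennreal (\<bar>c\<bar> ^ p) * f (T x) \<partial>leb p)"
    by (subst nn_integral_density, measurable) (subst nn_integral_distr, measurable)
  also have "\<dots> = ennreal (\<bar>c\<bar> ^ p) * (\<integral>\<^sup>+x. f (T x) \<partial>leb p)"
    by (rule nn_integral_cmult) measurable
  finally show ?thesis by (simp add: T_def)
qed

lemma vinner_commute: "vinner p x y = vinner p y x"
  by (simp add: vinner_def mult.commute)

lemma vinner_self: "vinner p x x = (L2_set x {..<p})\<^sup>2"
  by (simp add: vinner_def L2_set_def sum_nonneg power2_eq_square)

lemma vinner_self_nonneg: "0 \<le> vinner p x x"
  by (simp add: vinner_self)

lemma L2_set_vinner: "L2_set x {..<p} = sqrt (vinner p x x)"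
  by (simp add: vinner_self)

lemma coord_measurable_bor:
  assumes "f \<in> M \<rightarrow>\<^sub>M bor p" "k < p"
  shows "(\<lambda>x. f x k) \<in> borel_measurable M"
  using assms(2) by (intro measurable_compose[OF assms(1) measurable_component_singleton]) simp

lemma vinner_measurable_pair:
  assumes "f \<in> M \<rightarrow>\<^sub>M bor p" "g \<in> M \<rightarrow>\<^sub>M bor p"
  shows "(\<lambda>x. vinner p (f x) (g x)) \<in> borel_measurable M"
  unfolding vinner_def
  by (intro borel_measurable_sum borel_measurable_times coord_measurable_bor[OF assms(1)] coord_measurable_bor[OF assms(2)]) auto

text \<open>
  The Householder reflection in the hyperplane orthogonal to \<open>v\<close>.
\<close>

definition vrefl :: "nat \<Rightarrow> (nat \<Rightarrow> real) \<Rightarrow> (nat \<Rightarrow> real) \<Rightarrow> nat \<Rightarrow> real" where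
  "vrefl p v x = (\<lambda>k\<in>{..<p}. x k - 2 * vinner p v x / vinner p v v * v k)"

lemma vrefl_measurable [measurable]: "vrefl p v \<in> bor p \<rightarrow>\<^sub>M bor p"
proof -
  have [measurable]: "vinner p v \<in> borel_measurable (bor p)" by (rule vinner_measurable)
  show ?thesis unfolding vrefl_def by measurable
qed

lemma vrefl_ext [simp]: "vrefl p v x \<in> {..<p} \<rightarrow>\<^sub>E UNIV"
  by (auto simp: vrefl_def)

lemma vinner_vrefl_left:
  "vinner p (vrefl p v x) y = vinner p x y - 2 * vinner p v x / vinner p v v * vinner p v y"
proof -
  have "vinner p (\<lambda>k\<in>{..<p}. x k - c * v k) y = vinner p x y - c * vinner p v y" for c
    by (simp add: vinner_def sum_subtractf sum_distrib_left algebra_simps)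
  then show ?thesis unfolding vrefl_def .
qed

lemma vinner_vrefl:
  assumes "vinner p v v \<noteq> 0"
  shows "vinner p (vrefl p v x) (vrefl p v y) = vinner p x y"
  using assms
  by (simp add: vinner_vrefl_left vinner_commute[of p _ "vrefl p v y"] vinner_commute[of p y])

lemma L2_set_vrefl:
  "vinner p v v \<noteq> 0 \<Longrightarrow> L2_set (vrefl p v x) {..<p} = L2_set x {..<p}"
  by (simp add: L2_set_vinner vinner_vrefl)

lemma vrefl_swap:
  assumes "x \<in> {..<p} \<rightarrow>\<^sub>E UNIV" "y \<in> {..<p} \<rightarrow>\<^sub>E UNIV" "vinner p x x = vinner p y y" "x \<noteq> y"
  shows "vinner p (\<lambda>k. x k - y k) (\<lambda>k. x k - y k) \<noteq> 0" "vrefl p (\<lambda>k. x k - y k) x = y"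
proof -
  let ?v = "\<lambda>k. x k - y k"
  obtain k where k: "k < p" "x k \<noteq> y k"
    using assms(1,2,4) by (metis PiE_ext lessThan_iff)
  have "(x k - y k)\<^sup>2 \<le> vinner p ?v ?v"
    unfolding vinner_def power2_eq_square using k by (intro member_le_sum) auto
  moreover have "0 < (x k - y k)\<^sup>2" using k by simp
  ultimately show nz: "vinner p ?v ?v \<noteq> 0" by linarith
  have "vinner p ?v ?v = vinner p x x - 2 * vinner p x y + vinner p y y"
    by (simp add: vinner_def algebra_simps sum.distrib sum_subtractf sum_distrib_left)
  also have "\<dots> = 2 * vinner p ?v x"
    using assms(3) by (simp add: vinner_def algebra_simps sum.distrib sum_subtractf)
  finally have eq: "2 * vinner p ?v x / vinner p ?v ?v = 1" using nz by simp
  show "vrefl p ?v x = y"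
  proof
    fix i show "vrefl p ?v x i = y i"
      unfolding vrefl_def eq using assms(2) by (auto simp: PiE_iff extensional_def)
  qed
qed

text \<open>
  The argument is the uniqueness of translation invariant measures.  Both integrals are multiplied
  by the volume of the unit ball \<open>B\<close>, and the order of integration is exchanged in the double integral of
  \<open>f (H x + y) * indicator B y\<close>.  Translation invariance is used once in each order, and the isometry
  \<open>H\<close> maps the ball onto itself.
\<close>

lemma nn_integral_leb_vrefl:
  assumes f [measurable]: "f \<in> borel_measurable (bor p)" and v: "vinner p v v \<noteq> 0" and p: "p > 0"
  shows "(\<integral>\<^sup>+x. f (vrefl p v x) \<partial>leb p) = (\<integral>\<^sup>+x. f x \<partial>leb p)"
proof -
  interpret pair_sigma_finite "leb p" "leb p"
    using sigma_finite_leb by (simp add: pair_sigma_finite_def)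
  define b :: "(nat \<Rightarrow> real) \<Rightarrow> ennreal" where "b = indicator (unit_ball p)"
  have [measurable]: "unit_ball p \<in> sets (bor p)" by (rule unit_ball_sets)
  have b [measurable]: "b \<in> borel_measurable (bor p)" unfolding b_def by measurable
  define ad where "ad = (\<lambda>x y::nat \<Rightarrow> real. \<lambda>k\<in>{..<p}. x k + y k)"
  define sb where "sb = (\<lambda>x y::nat \<Rightarrow> real. \<lambda>k\<in>{..<p}. y k - x k)"
  have ad_m [measurable]: "(\<lambda>z. ad (g z) (h z)) \<in> N \<rightarrow>\<^sub>M bor p"
    if "g \<in> N \<rightarrow>\<^sub>M bor p" "h \<in> N \<rightarrow>\<^sub>M bor p" for g h and N :: "'z measure"
    unfolding ad_def
    by (intro measurable_restrict borel_measurable_add coord_measurable_bor[OF that(1)] coord_measurable_bor[OF that(2)]) auto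
  have sb_m [measurable]: "(\<lambda>z. sb (g z) (h z)) \<in> N \<rightarrow>\<^sub>M bor p"
    if "g \<in> N \<rightarrow>\<^sub>M bor p" "h \<in> N \<rightarrow>\<^sub>M bor p" for g h and N :: "'z measure"
    unfolding sb_def
    by (intro measurable_restrict borel_measurable_diff coord_measurable_bor[OF that(1)] coord_measurable_bor[OF that(2)]) auto
  have trans: "(\<integral>\<^sup>+y. h (ad a y) \<partial>leb p) = (\<integral>\<^sup>+y. h y \<partial>leb p)"
    if "h \<in> borel_measurable (bor p)" for h a
    using nn_integral_leb_affine[OF that, of 1 a] by (simp add: ad_def)
  have neg: "(\<integral>\<^sup>+y. h (sb y a) \<partial>leb p) = (\<integral>\<^sup>+y. h y \<partial>leb p)"
    if "h \<in> borel_measurable (bor p)" for h a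
    using nn_integral_leb_affine[OF that, of "-1" a] by (simp add: sb_def)
  let ?H = "vrefl p v"
  define c where "c z = 2 * vinner p v z / vinner p v v" for z
  have H_def: "?H z = (\<lambda>k\<in>{..<p}. z k - c z * v k)" for z
    by (simp add: vrefl_def c_def)
  have add: "?H (ad x (?H y)) = ad y (?H x)"
    if "x \<in> space (leb p)" "y \<in> space (leb p)" for x y
  proof -
    have "vinner p v (ad x (?H y)) = vinner p v x + vinner p v (?H y)"
      by (simp add: vinner_def ad_def algebra_simps sum.distrib)
    moreover have "vinner p v (?H y) = - vinner p v y"
      using v by (subst vinner_commute, subst vinner_vrefl_left) (simp add: vinner_commute)
    ultimately have cxy: "c (ad x (?H y)) = c x - c y"
      by (simp add: c_def diff_divide_distrib right_diff_distrib)
    show ?thesis unfolding H_def[of "ad x (?H y)"] cxy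
      by (auto simp: fun_eq_iff H_def ad_def algebra_simps)
  qed
  have sub: "b (sb (?H x) y) = b (sb x (?H y))"
    if "x \<in> space (leb p)" "y \<in> space (leb p)" for x y
  proof -
    have "vinner p v (sb x (?H y)) = vinner p v (?H y) - vinner p v x"
      by (simp add: vinner_def sb_def algebra_simps sum_subtractf)
    moreover have "vinner p v (?H y) = - vinner p v y"
      using v by (subst vinner_commute, subst vinner_vrefl_left) (simp add: vinner_commute)
    ultimately have cxy: "c (sb x (?H y)) = - c y - c x"
      by (simp add: c_def diff_divide_distrib right_diff_distrib)
    have "?H (sb x (?H y)) = sb (?H x) y" unfolding H_def[of "sb x (?H y)"] cxy
      by (auto simp: fun_eq_iff H_def sb_def algebra_simps)
    then have "L2_set (sb (?H x) y) {..<p} = L2_set (sb x (?H y)) {..<p}"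
      using L2_set_vrefl[OF v, of "sb x (?H y)"] by simp
    then show ?thesis by (auto simp: b_def unit_ball_def sb_def split: split_indicator)
  qed
  let ?B = "\<integral>\<^sup>+y. b y \<partial>leb p"
  have B: "?B = emeasure (leb p) (unit_ball p)"
    unfolding b_def by (rule nn_integral_indicator) measurable
  have "(\<integral>\<^sup>+x. f (?H x) \<partial>leb p) * ?B = (\<integral>\<^sup>+y. (\<integral>\<^sup>+x. f (?H x) \<partial>leb p) * b y \<partial>leb p)"
    by (simp add: nn_integral_cmult)
  also have "\<dots> = (\<integral>\<^sup>+y. (\<integral>\<^sup>+x. f (ad y (?H x)) * b y \<partial>leb p) \<partial>leb p)"
  proof (rule nn_integral_cong)
    fix y assume y: "y \<in> space (leb p)"
    have [measurable]: "y \<in> space (bor p)" using y by (simp add: space_PiM)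
    have "(\<integral>\<^sup>+x. f (?H x) \<partial>leb p) = (\<integral>\<^sup>+x. f (?H (ad (?H y) x)) \<partial>leb p)"
      by (rule trans[symmetric]) measurable
    also have "\<dots> = (\<integral>\<^sup>+x. f (ad y (?H x)) \<partial>leb p)"
      using add y by (intro nn_integral_cong) (simp add: ad_def add.commute)
    moreover have "(\<lambda>x. f (ad y (?H x))) \<in> borel_measurable (leb p)" by measurable
    ultimately show "(\<integral>\<^sup>+x. f (?H x) \<partial>leb p) * b y = (\<integral>\<^sup>+x. f (ad y (?H x)) * b y \<partial>leb p)"
      by (simp add: nn_integral_multc)
  qed
  also have "\<dots> = (\<integral>\<^sup>+x. (\<integral>\<^sup>+y. f (ad y (?H x)) * b y \<partial>leb p) \<partial>leb p)"
    by (rule Fubini') measurable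
  also have "\<dots> = (\<integral>\<^sup>+x. (\<integral>\<^sup>+y. f y * b (sb x (?H y)) \<partial>leb p) \<partial>leb p)"
  proof (rule nn_integral_cong)
    fix x assume x: "x \<in> space (leb p)"
    have [measurable]: "x \<in> space (bor p)" using x by (simp add: space_PiM)
    have "(\<integral>\<^sup>+y. f y * b (sb (?H x) y) \<partial>leb p)
        = (\<integral>\<^sup>+y. f (ad (?H x) y) * b (sb (?H x) (ad (?H x) y)) \<partial>leb p)"
      by (rule trans[symmetric]) measurable
    also have "\<dots> = (\<integral>\<^sup>+y. f (ad y (?H x)) * b y \<partial>leb p)"
    proof (rule nn_integral_cong)
      fix y assume "y \<in> space (leb p)"
      then have "sb (?H x) (ad (?H x) y) = y"
        by (auto simp: fun_eq_iff sb_def ad_def space_PiM PiE_iff extensional_def)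
      then show "f (ad (?H x) y) * b (sb (?H x) (ad (?H x) y)) = f (ad y (?H x)) * b y"
        by (simp add: ad_def add.commute)
    qed
    finally show "(\<integral>\<^sup>+y. f (ad y (?H x)) * b y \<partial>leb p) = (\<integral>\<^sup>+y. f y * b (sb x (?H y)) \<partial>leb p)"
      using sub[OF x] by (simp cong: nn_integral_cong)
  qed
  also have "\<dots> = (\<integral>\<^sup>+y. (\<integral>\<^sup>+x. f y * b (sb x (?H y)) \<partial>leb p) \<partial>leb p)"
    by (rule Fubini') measurable
  also have "\<dots> = (\<integral>\<^sup>+y. f y * ?B \<partial>leb p)"
  proof (rule nn_integral_cong)
    fix y assume y: "y \<in> space (leb p)"
    have [measurable]: "y \<in> space (bor p)" using y by (simp add: space_PiM)
    have "(\<integral>\<^sup>+x. b (sb x (?H y)) \<partial>leb p) = ?B" by (rule neg) measurable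
    moreover have "(\<lambda>x. b (sb x (?H y))) \<in> borel_measurable (leb p)" by measurable
    ultimately show "(\<integral>\<^sup>+x. f y * b (sb x (?H y)) \<partial>leb p) = f y * ?B"
      by (simp add: nn_integral_cmult)
  qed
  also have "\<dots> = (\<integral>\<^sup>+y. f y \<partial>leb p) * ?B"
    by (rule nn_integral_multc) measurable
  finally show ?thesis
    using emeasure_unit_ball_pos[OF p] emeasure_unit_ball_finite[of p] unfolding B
    by (simp add: mult.commute[of _ "emeasure (leb p) (unit_ball p)"] ennreal_mult_cancel_left)
qed

section \<open>The uniform distribution on the sphere\<close>

lemma sets_uniform_sphere:
  "sets (uniform_sphere p) = sets (restrict_space (bor p) (unit_sphere p))"
  unfolding uniform_sphere_def by (intro sets_restrict_space_cong) simp

lemma sphere_sub_space: "unit_sphere p \<subseteq> space (bor p)"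
  by (auto simp: unit_sphere_def space_bor)

lemma sets_uniform_sphere_iff:
  "A \<in> sets (uniform_sphere p) \<longleftrightarrow> A \<in> sets (bor p) \<and> A \<subseteq> unit_sphere p"
  unfolding sets_uniform_sphere
  using unit_sphere_sets by (subst sets_restrict_space_iff) (auto simp: sphere_sub_space)

lemma measurable_uniform_sphere_bor:
  assumes "f \<in> M \<rightarrow>\<^sub>M uniform_sphere p" shows "f \<in> M \<rightarrow>\<^sub>M bor p"
proof -
  have "f \<in> M \<rightarrow>\<^sub>M restrict_space (bor p) (unit_sphere p)"
    using assms measurable_cong_sets[OF refl sets_uniform_sphere] by blast
  then show ?thesis by (simp add: measurable_restrict_space2_iff)
qed

lemma measurable_into_uniform_sphere:
  assumes "f \<in> M \<rightarrow>\<^sub>M bor p" "\<And>x. x \<in> space M \<Longrightarrow> f x \<in> unit_sphere p"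
  shows "f \<in> M \<rightarrow>\<^sub>M uniform_sphere p"
proof -
  have "f \<in> M \<rightarrow>\<^sub>M restrict_space (bor p) (unit_sphere p)"
    using assms by (simp add: measurable_restrict_space2_iff)
  then show ?thesis using measurable_cong_sets[OF refl sets_uniform_sphere] by blast
qed

lemma vinner_measurable_sphere:
  assumes "f \<in> M \<rightarrow>\<^sub>M uniform_sphere p" "g \<in> M \<rightarrow>\<^sub>M uniform_sphere p"
  shows "(\<lambda>x. vinner p (f x) (g x)) \<in> borel_measurable M"
  using assms by (intro vinner_measurable_pair measurable_uniform_sphere_bor)

lemma vinner_measurable_sphere_const:
  assumes "f \<in> M \<rightarrow>\<^sub>M uniform_sphere p"
  shows "(\<lambda>x. vinner p y (f x)) \<in> borel_measurable M"
  by (rule measurable_compose[OF measurable_uniform_sphere_bor[OF assms] vinner_measurable])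

lemma coord_measurable_sphere:
  assumes "f \<in> M \<rightarrow>\<^sub>M uniform_sphere p" "k < p"
  shows "(\<lambda>x. f x k) \<in> borel_measurable M"
  by (rule coord_measurable_bor[OF measurable_uniform_sphere_bor[OF assms(1)] assms(2)])

lemma emeasure_uniform_sphere:
  assumes A: "A \<in> sets (uniform_sphere p)"
  shows "emeasure (uniform_sphere p) A =
    emeasure (leb p) {x \<in> unit_ball p. vnormalize p x \<in> A} / emeasure (leb p) (unit_ball p)"
proof -
  have [measurable]: "unit_ball p \<in> sets (bor p)" by (rule unit_ball_sets)
  have A': "A \<in> sets (bor p)" "A \<subseteq> unit_sphere p" using A by (auto simp: sets_uniform_sphere_iff)
  note A'(1) [measurable]
  let ?U = "uniform_measure (leb p) (unit_ball p)"
  have m: "vnormalize p \<in> ?U \<rightarrow>\<^sub>M bor p" by measurable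
  have "emeasure (uniform_sphere p) A = emeasure (distr ?U (bor p) (vnormalize p)) A"
    unfolding uniform_sphere_def
    by (rule emeasure_restrict_space) (use A' unit_sphere_sets sphere_sub_space in \<open>auto simp: Int_absorb2\<close>)
  also have "\<dots> = emeasure ?U (vnormalize p -` A \<inter> space ?U)"
    using m A'(1) by (rule emeasure_distr)
  also have "\<dots> = emeasure (leb p) (unit_ball p \<inter> (vnormalize p -` A \<inter> space ?U)) / emeasure (leb p) (unit_ball p)"
  proof (rule emeasure_uniform_measure)
    show "unit_ball p \<in> sets (leb p)" by measurable
    have "vnormalize p -` A \<inter> space (leb p) \<in> sets (leb p)"
      by (rule measurable_sets[OF _ A'(1)]) measurable
    then show "vnormalize p -` A \<inter> space ?U \<in> sets (leb p)" by simp
  qed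
  also have "unit_ball p \<inter> (vnormalize p -` A \<inter> space ?U) = {x \<in> unit_ball p. vnormalize p x \<in> A}"
    by (auto simp: unit_ball_def space_PiM)
  finally show ?thesis .
qed

lemma vrefl_sphere_iff:
  assumes "vinner p v v \<noteq> 0" "x \<in> {..<p} \<rightarrow>\<^sub>E UNIV"
  shows "vrefl p v x \<in> unit_sphere p \<longleftrightarrow> x \<in> unit_sphere p"
  using assms by (auto simp: unit_sphere_def L2_set_vrefl)

lemma vrefl_measurable_sphere [measurable]:
  "vinner p v v \<noteq> 0 \<Longrightarrow> vrefl p v \<in> uniform_sphere p \<rightarrow>\<^sub>M uniform_sphere p"
  by (rule measurable_into_uniform_sphere,
      rule measurable_compose[OF measurable_uniform_sphere_bor[OF measurable_ident_sets[OF refl]] vrefl_measurable])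
     (auto simp: unit_sphere_def L2_set_vrefl)

lemma vnormalize_vrefl:
  "vnormalize p (vrefl p v x) = vrefl p v (vnormalize p x)" if "vinner p v v \<noteq> 0"
proof -
  define c where "c z = 2 * vinner p v z / vinner p v v" for z
  have H: "vrefl p v z = (\<lambda>k\<in>{..<p}. z k - c z * v k)" for z
    by (simp add: vrefl_def c_def)
  have "vinner p v (vnormalize p x) = vinner p v x / L2_set x {..<p}"
    by (simp add: vinner_def vnormalize_def sum_divide_distrib)
  then have c: "c (vnormalize p x) = c x / L2_set x {..<p}"
    by (simp add: c_def)
  show ?thesis
    unfolding H[of "vnormalize p x"] c
    using L2_set_vrefl[OF that, of x]
    by (auto simp: fun_eq_iff vnormalize_def H[of x] diff_divide_distrib)
qed

lemma distr_uniform_sphere_vrefl: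
  assumes p: "p > 0" and v: "vinner p v v \<noteq> 0"
  shows "distr (uniform_sphere p) (uniform_sphere p) (vrefl p v) = uniform_sphere p"
proof (rule measure_eqI)
  fix A assume "A \<in> sets (distr (uniform_sphere p) (uniform_sphere p) (vrefl p v))"
  then have A: "A \<in> sets (uniform_sphere p)" by simp
  then have A': "A \<in> sets (bor p)" "A \<subseteq> unit_sphere p" by (auto simp: sets_uniform_sphere_iff)
  have [measurable]: "unit_ball p \<in> sets (bor p)" by (rule unit_ball_sets)
  note A'(1) [measurable] v [simp]
  have m: "vrefl p v \<in> uniform_sphere p \<rightarrow>\<^sub>M uniform_sphere p" using v by measurable
  define A2 where "A2 = vrefl p v -` A \<inter> space (uniform_sphere p)"
  have A2: "A2 \<in> sets (uniform_sphere p)" unfolding A2_def using m A by (rule measurable_sets)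
  define E where "E = {x \<in> unit_ball p. vnormalize p x \<in> A}"
  have E [measurable]: "E \<in> sets (bor p)"
  proof -
    have "E = unit_ball p \<inter> (vnormalize p -` A \<inter> space (bor p))"
      by (auto simp: E_def unit_ball_def space_bor)
    also have "\<dots> \<in> sets (bor p)" by (intro sets.Int measurable_sets[OF _ A'(1)]) measurable
    finally show ?thesis .
  qed
  have E2: "{x \<in> unit_ball p. vnormalize p x \<in> A2} \<in> sets (bor p)"
  proof -
    have "{x \<in> unit_ball p. vnormalize p x \<in> A2} = unit_ball p \<inter> (vnormalize p -` A2 \<inter> space (bor p))"
      by (auto simp: unit_ball_def space_bor)
    also have "\<dots> \<in> sets (bor p)"
      using A2 by (intro sets.Int measurable_sets[of _ _ "bor p"]) (auto simp: sets_uniform_sphere_iff)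
    finally show ?thesis .
  qed
  have iff: "vrefl p v x \<in> E \<longleftrightarrow> x \<in> {x \<in> unit_ball p. vnormalize p x \<in> A2}" if "x \<in> space (leb p)" for x
  proof -
    have "vnormalize p x \<in> {..<p} \<rightarrow>\<^sub>E UNIV" by (auto simp: vnormalize_def)
    then show ?thesis using that A'(2) vrefl_sphere_iff[OF v, of "vnormalize p x"]
      by (auto simp: E_def A2_def unit_ball_def space_PiM L2_set_vrefl vnormalize_vrefl)
  qed
  have "emeasure (leb p) E = (\<integral>\<^sup>+x. indicator E x \<partial>leb p)" by simp
  also have "\<dots> = (\<integral>\<^sup>+x. indicator E (vrefl p v x) \<partial>leb p)"
    by (rule nn_integral_leb_vrefl[symmetric]) (use v p in auto)
  also have "\<dots> = (\<integral>\<^sup>+x. indicator {x \<in> unit_ball p. vnormalize p x \<in> A2} x \<partial>leb p)"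
    using iff by (intro nn_integral_cong) (auto split: split_indicator)
  also have "\<dots> = emeasure (leb p) {x \<in> unit_ball p. vnormalize p x \<in> A2}"
    using E2 by (intro nn_integral_indicator) (simp add: sets_leb)
  finally show "emeasure (distr (uniform_sphere p) (uniform_sphere p) (vrefl p v)) A = emeasure (uniform_sphere p) A"
    using m A A2 by (simp add: emeasure_distr emeasure_uniform_sphere E_def A2_def[symmetric, simplified])
qed simp

section \<open>The law of one coordinate\<close>

lemma one_minus_square_pos:
  fixes u :: real
  assumes "u \<in> {-1<..<1}" shows "0 < 1 - u\<^sup>2"
  using assms by (simp add: abs_square_less_1 abs_less_iff)



text \<open>
  This is the substitution \<open>t = r * cot \<alpha>\<close>, \<open>v = cos \<alpha>\<close>.  Its inverse \<open>v = t / sqrt (r\<^sup>2 + t\<^sup>2)\<close> is the last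
  coordinate of the normalization of a vector with last coordinate \<open>t\<close> whose other
  coordinates have norm \<open>r\<close>.
\<close>

lemma nn_integral_cot_substitution:
  fixes F :: "real \<Rightarrow> real" and r :: real
  assumes F [measurable]: "F \<in> borel_measurable borel" and F0: "\<And>t. F t \<ge> 0" and r: "r > 0"
  shows "(\<integral>\<^sup>+t. ennreal (F t) \<partial>lborel) =
    (\<integral>\<^sup>+v. ennreal (F (r * (v / sqrt (1 - v\<^sup>2))) * (r * (1 - v\<^sup>2) powr (- 3 / 2))) * indicator {-1<..<1} v \<partial>lborel)"
proof -
  define h where "h v = r * (v / sqrt (1 - v\<^sup>2))" for v
  define h' where "h' v = r * (1 - v\<^sup>2) powr (- 3 / 2)" for v
  have der: "(h has_real_derivative h' v) (at v)" if v: "v \<in> {-1<..<1}" for v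
  proof -
    let ?s = "sqrt (1 - v\<^sup>2)"
    have s: "?s > 0" "?s\<^sup>2 = 1 - v\<^sup>2" using one_minus_square_pos[OF v] by auto
    have e: "(1 - v\<^sup>2) powr (- 3 / 2) = 1 / ?s ^ 3"
    proof -
      have "(1 - v\<^sup>2) powr (- 3 / 2) = (?s powr 2) powr (- 3 / 2)"
        using s by simp
      also have "\<dots> = ?s powr (- real 3)" by (simp add: powr_powr)
      also have "\<dots> = 1 / ?s ^ 3" using s(1) by (subst powr_minus_divide, subst powr_realpow) auto
      finally show ?thesis .
    qed
    have "(h has_real_derivative r * ((1 * ?s - v * (- v / ?s)) / (?s * ?s))) (at v)"
      unfolding h_def
      by (rule derivative_eq_intros refl | use one_minus_square_pos[OF v] in \<open>simp add: divide_simps\<close>)+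
    moreover have "(1 * ?s - v * (- v / ?s)) / (?s * ?s) = 1 / ?s ^ 3"
      using s by (simp add: field_simps power2_eq_square power3_eq_cube)
    then have "r * ((1 * ?s - v * (- v / ?s)) / (?s * ?s)) = h' v"
      unfolding h'_def e by (simp only:)
    ultimately show ?thesis by (simp only:)
  qed
  have h'0: "h' v \<ge> 0" for v using r by (simp add: h'_def)
  have mono: "h v \<le> h w" if "-1 < v" "v \<le> w" "w < 1" for v w
    by (rule deriv_nonneg_imp_mono[where g = h and g' = h' and a = v and b = w])
       (use that der h'0 in auto)
  \<comment> \<open>the substitution rule holds on compact intervals; these exhaust the open interval\<close>
  define a where "a n = 1 - 1 / real (n + 2)" for n :: nat
  have a: "0 < a n" "a n < 1" for n by (auto simp: a_def field_simps)
  have a_mono: "a m \<le> a n" if "m \<le> n" for m n using that by (auto simp: a_def field_simps)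
  have [measurable]: "h \<in> borel_measurable borel" "h' \<in> borel_measurable borel"
    unfolding h_def[abs_def] h'_def[abs_def] by measurable
  let ?M = "density lborel (\<lambda>t. ennreal (F t))"
  let ?N = "density lborel (\<lambda>v. ennreal (F (h v) * h' v))"
  have eq: "emeasure ?M {h (- a n)..h (a n)} = emeasure ?N {- a n..a n}" for n
  proof -
    have an: "x \<in> {- a n..a n} \<Longrightarrow> x \<in> {-1<..<1}" for x using a[of n] by auto
    have "(\<integral>\<^sup>+x. F x * indicator {h (- a n)..h (a n)} x \<partial>lborel) =
             (\<integral>\<^sup>+x. F (h x) * h' x * indicator {- a n..a n} x \<partial>lborel)"
    proof (rule nn_integral_substitution)
      show "set_borel_measurable borel {h (- a n)..h (a n)} F"
        unfolding set_borel_measurable_def by measurable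
      show "(h has_real_derivative h' x) (at x)" if "x \<in> {- a n..a n}" for x
        using der an that by blast
      show "continuous_on {- a n..a n} h'"
        unfolding h'_def using one_minus_square_pos an by (intro continuous_intros) fastforce
    qed (use h'0 a[of n] in auto)
    then show ?thesis using F0 h'0
      by (subst (1 2) emeasure_density) (auto simp: ennreal_mult' ennreal_indicator[symmetric])
  qed
  have U1: "(\<Union>n. {- a n..a n}) = {-1<..<1}"
  proof (intro equalityI subsetI)
    fix x :: real assume x: "x \<in> {-1<..<1}"
    then have "1 - \<bar>x\<bar> > 0" by auto
    then obtain n where "1 / real (Suc n) < 1 - \<bar>x\<bar>" by (metis nat_approx_posE)
    moreover have "1 / real (n + 2) \<le> 1 / real (Suc n)" by (simp add: field_simps)
    ultimately have "\<bar>x\<bar> \<le> a n" unfolding a_def by linarith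
    then show "x \<in> (\<Union>n. {- a n..a n})" by (intro UN_I[of n]) (auto simp: abs_le_iff)
  next
    fix x assume "x \<in> (\<Union>n. {- a n..a n})"
    then obtain n where "- a n \<le> x" "x \<le> a n" by auto
    then show "x \<in> {-1<..<1}" using a[of n] by auto
  qed
  have U2: "(\<Union>n. {h (- a n)..h (a n)}) = UNIV"
  proof (intro equalityI subsetI UNIV_I)
    fix t :: real
    let ?R = "sqrt (r\<^sup>2 + t\<^sup>2)"
    define w where "w = t / ?R"
    have R: "?R > 0" "?R\<^sup>2 = r\<^sup>2 + t\<^sup>2" using r by (auto intro: add_pos_nonneg)
    have "r\<^sup>2 + t\<^sup>2 \<noteq> 0" using R r by simp
    then have "r\<^sup>2 / (r\<^sup>2 + t\<^sup>2) + t\<^sup>2 / (r\<^sup>2 + t\<^sup>2) = 1"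
      by (metis add_divide_distrib divide_self)
    moreover have w2: "w\<^sup>2 = t\<^sup>2 / (r\<^sup>2 + t\<^sup>2)" by (simp only: w_def power_divide R(2))
    moreover have r2: "(r / ?R)\<^sup>2 = r\<^sup>2 / (r\<^sup>2 + t\<^sup>2)" by (simp only: power_divide R(2))
    ultimately have eq: "1 - w\<^sup>2 = (r / ?R)\<^sup>2" by linarith
    have sq: "sqrt (1 - w\<^sup>2) = r / ?R"
      unfolding eq by (simp only: real_sqrt_abs abs_of_pos[OF divide_pos_pos[OF r R(1)]])
    have "1 - w\<^sup>2 > 0" unfolding eq by (intro zero_less_power divide_pos_pos r R(1))
    then have w: "w \<in> {-1<..<1}" by (simp add: abs_square_less_1 abs_less_iff)
    have "r * ((t / z) / (r / z)) = t" if "z > 0" for z using r that by simp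
    from this[OF R(1)] have hw: "h w = t" unfolding h_def sq unfolding w_def .
    have "w \<in> (\<Union>n. {- a n..a n})" unfolding U1 by (rule w)
    then obtain n where "- a n \<le> w" "w \<le> a n" by auto
    then have "h (- a n) \<le> h w" "h w \<le> h (a n)" using a[of n] by (auto intro!: mono)
    then show "t \<in> (\<Union>n. {h (- a n)..h (a n)})" unfolding hw by (intro UN_I[of n]) auto
  qed
  have "(\<lambda>n. emeasure ?M {h (- a n)..h (a n)}) \<longlonglongrightarrow> emeasure ?M (\<Union>n. {h (- a n)..h (a n)})"
  proof (rule Lim_emeasure_incseq)
    show "incseq (\<lambda>n. {h (- a n)..h (a n)})"
    proof (rule incseq_SucI)
      fix n
      have "h (a n) \<le> h (a (Suc n))" "h (- a (Suc n)) \<le> h (- a n)"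
        using a[of n] a[of "Suc n"] a_mono[of n "Suc n"] by (auto intro!: mono)
      then show "{h (- a n)..h (a n)} \<subseteq> {h (- a (Suc n))..h (a (Suc n))}" by auto
    qed
  qed auto
  moreover have "(\<lambda>n. emeasure ?N {- a n..a n}) \<longlonglongrightarrow> emeasure ?N (\<Union>n. {- a n..a n})"
  proof (rule Lim_emeasure_incseq)
    show "incseq (\<lambda>n. {- a n..a n})"
    proof (rule incseq_SucI)
      fix n show "{- a n..a n} \<subseteq> {- a (Suc n)..a (Suc n)}" using a_mono[of n "Suc n"] by auto
    qed
  qed auto
  ultimately have "emeasure ?M UNIV = emeasure ?N {-1<..<1}"
    unfolding eq U1 U2 by (rule LIMSEQ_unique)
  then show ?thesis
    by (simp add: emeasure_density h_def h'_def)
qed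

text \<open>
  For fixed other coordinates \<open>y\<close> the substitution above replaces the last coordinate by its
  normalized value \<open>u\<close>, at the price of the Jacobian \<open>|y| * (1 - u\<^sup>2) powr (- 3 / 2)\<close>, and the vector lies in
  the unit ball iff \<open>|y| \<le> sqrt (1 - u\<^sup>2)\<close>.  The integral of \<open>|y|\<close> over that ball scales like
  \<open>(1 - u\<^sup>2) powr ((q + 1) / 2)\<close>, and the exponents add up to \<open>(q - 2) / 2\<close>.  The constant \<open>K\<close> is determined
  afterwards by the total mass.
\<close>

lemma distr_sphere_coordinate:
  assumes q: "q \<ge> 1"
  shows "\<exists>K. distr (uniform_sphere (Suc q)) borel (\<lambda>x. x q) =
    density lborel (\<lambda>u. K * ennreal (indicator {-1<..<1} u * (1 - u\<^sup>2) powr ((real q - 2) / 2)))"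
proof -
  let ?p = "Suc q"
  interpret product_sigma_finite "\<lambda>_::nat. lborel :: real measure" ..
  interpret PS: pair_sigma_finite "leb q" lborel
    using sigma_finite_leb by (simp add: pair_sigma_finite_def lborel.sigma_finite_measure_axioms)
  define N where "N y = L2_set y {..<q}" for y :: "nat \<Rightarrow> real"
  have [measurable]: "N \<in> borel_measurable (bor q)" unfolding N_def by measurable
  have N0: "N y \<ge> 0" for y by (simp add: N_def)
  define K0 where "K0 = (\<integral>\<^sup>+y. ennreal (N y) * indicator {y. N y \<le> 1} y \<partial>leb q)"
  define V where "V = emeasure (leb ?p) (unit_ball ?p)"
  have AEN: "AE y in leb q. N y > 0"
  proof (rule AE_I)
    have "{\<lambda>k\<in>{..<q}. 0::real} = (\<Pi>\<^sub>E k\<in>{..<q}. {0..0})" by auto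
    then show "emeasure (leb q) {\<lambda>k\<in>{..<q}. 0::real} = 0"
      using emeasure_PiM_box[of 0 0 q] q by simp
    have "(\<Pi>\<^sub>E k\<in>{..<q}. {0..0::real}) \<in> sets (leb q)" by (rule sets_PiM_I_finite) auto
    then show "{\<lambda>k\<in>{..<q}. 0::real} \<in> sets (leb q)"
      using \<open>{\<lambda>k\<in>{..<q}. 0::real} = (\<Pi>\<^sub>E k\<in>{..<q}. {0..0})\<close> by (simp only:)
    show "{x \<in> space (leb q). \<not> 0 < N x} \<subseteq> {\<lambda>k\<in>{..<q}. 0::real}"
    proof
      fix x assume "x \<in> {x \<in> space (leb q). \<not> 0 < N x}"
      then have x: "x \<in> {..<q} \<rightarrow>\<^sub>E UNIV" "N x = 0" using N0[of x] by (auto simp: space_leb)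
      then have "x = (\<lambda>k\<in>{..<q}. 0)"
        by (auto simp: N_def L2_set_eq_0_iff PiE_iff extensional_def fun_eq_iff)
      then show "x \<in> {\<lambda>k\<in>{..<q}. 0}" by simp
    qed
  qed
  let ?d = "\<lambda>u. ennreal (indicator {-1<..<1} u * (1 - u\<^sup>2) powr ((real q - 2) / 2))"
  have main: "emeasure (leb ?p) {x \<in> unit_ball ?p. vnormalize ?p x \<in> unit_sphere ?p \<and> vnormalize ?p x q \<in> A}
      = K0 * (\<integral>\<^sup>+u. ?d u * indicator A u \<partial>lborel)"
    if A [measurable]: "A \<in> sets borel" for A
  proof -
    define E where "E = {x \<in> unit_ball ?p. vnormalize ?p x \<in> unit_sphere ?p \<and> vnormalize ?p x q \<in> A}"
    have [measurable]: "unit_ball ?p \<in> sets (bor ?p)" "unit_sphere ?p \<in> sets (bor ?p)"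
      by (rule unit_ball_sets unit_sphere_sets)+
    have [measurable]: "(\<lambda>x. vnormalize ?p x q) \<in> borel_measurable (bor ?p)"
      by (rule measurable_compose[OF vnormalize_measurable measurable_component_singleton]) auto
    have Eb: "E \<in> sets (bor ?p)"
    proof -
      have "E = {x \<in> space (bor ?p). x \<in> unit_ball ?p \<and> vnormalize ?p x \<in> unit_sphere ?p \<and> vnormalize ?p x q \<in> A}"
        by (auto simp: E_def unit_ball_def space_bor)
      also have "\<dots> \<in> sets (bor ?p)" by measurable
      finally show ?thesis .
    qed
    then have E [measurable]: "E \<in> sets (leb ?p)" by (simp add: sets_leb)
    define G where "G r t = (indicator A (t / sqrt (r\<^sup>2 + t\<^sup>2)) * indicator {t. r\<^sup>2 + t\<^sup>2 \<le> 1} t :: real)" for r t :: real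
    let ?R = "\<lambda>u y. ennreal (N y) * indicator {y. N y \<le> sqrt (1 - u\<^sup>2)} y :: ennreal"
      and ?w = "\<lambda>u. ennreal ((1 - u\<^sup>2) powr (- 3 / 2)) * indicator {-1<..<1} u * indicator A u"
    have ins: "{..<?p} = insert q {..<q}" by auto
    have "emeasure (leb ?p) E = (\<integral>\<^sup>+x. indicator E x \<partial>leb ?p)" using E by simp
    also have "\<dots> = (\<integral>\<^sup>+y. (\<integral>\<^sup>+t. indicator E (y(q := t)) \<partial>lborel) \<partial>leb q)"
      using E unfolding ins by (intro product_nn_integral_insert) auto
    also have "\<dots> = (\<integral>\<^sup>+y. (\<integral>\<^sup>+u. ?R u y * ?w u \<partial>lborel) \<partial>leb q)"
    proof (rule nn_integral_cong_AE, use AEN AE_space in eventually_elim)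
      fix y assume y: "N y > 0" "y \<in> space (leb q)"
      have "indicator E (y(q := t)) = ennreal (G (N y) t)" for t
      proof -
        let ?x = "y(q := t)"
        have sm: "(\<Sum>k<q. (if k = q then t else y k)\<^sup>2) = (\<Sum>k<q. (y k)\<^sup>2)" by (intro sum.cong) auto
        have L: "L2_set ?x {..<?p} = sqrt ((N y)\<^sup>2 + t\<^sup>2)"
          by (simp add: L2_set_def N_def sm sum_nonneg)
        have Lp: "sqrt ((N y)\<^sup>2 + t\<^sup>2) > 0" using y by (auto intro: add_pos_nonneg)
        have ext: "?x \<in> {..<?p} \<rightarrow>\<^sub>E UNIV"
          using y(2) by (auto simp: space_leb PiE_iff extensional_def)
        have "L2_set (vnormalize ?p ?x) {..<?p} = L2_set (\<lambda>k. (1 / L2_set ?x {..<?p}) * ?x k) {..<?p}"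
          by (intro L2_set_cong) (auto simp: vnormalize_def)
        also have "\<dots> = (1 / L2_set ?x {..<?p}) * L2_set ?x {..<?p}"
          using L Lp by (intro L2_set_right_distrib[symmetric]) auto
        also have "\<dots> = 1" unfolding L using Lp by (metis less_irrefl nonzero_eq_divide_eq times_divide_eq_left mult_1)
        finally have 1: "vnormalize ?p ?x \<in> unit_sphere ?p"
          by (simp add: unit_sphere_def) (simp add: vnormalize_def)
        have 2: "vnormalize ?p ?x q = t / sqrt ((N y)\<^sup>2 + t\<^sup>2)"
          using L by (simp add: vnormalize_def)
        have 3: "?x \<in> unit_ball ?p \<longleftrightarrow> (N y)\<^sup>2 + t\<^sup>2 \<le> 1"
          using ext L by (simp add: unit_ball_def)
        show ?thesis using 1 2 3 by (auto simp: E_def G_def split: split_indicator)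
      qed
      then have "(\<integral>\<^sup>+t. indicator E (y(q := t)) \<partial>lborel) = (\<integral>\<^sup>+t. ennreal (G (N y) t) \<partial>lborel)" by simp
      also have "\<dots> = (\<integral>\<^sup>+v. ennreal (G (N y) (N y * (v / sqrt (1 - v\<^sup>2))) * (N y * (1 - v\<^sup>2) powr (- 3 / 2)))
          * indicator {-1<..<1} v \<partial>lborel)"
        by (rule nn_integral_cot_substitution) (use y in \<open>auto simp: G_def[abs_def]\<close>)
      also have "\<dots> = (\<integral>\<^sup>+u. ?R u y * ?w u \<partial>lborel)"
      proof (rule nn_integral_cong)
        fix u :: real
        show "ennreal (G (N y) (N y * (u / sqrt (1 - u\<^sup>2))) * (N y * (1 - u\<^sup>2) powr (- 3 / 2))) * indicator {-1<..<1} u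
          = ?R u y * ?w u"
        proof (cases "u \<in> {-1<..<1}")
          case True
          then have pos: "1 - u\<^sup>2 > 0" by (rule one_minus_square_pos)
          let ?t = "N y * (u / sqrt (1 - u\<^sup>2))"
          have sq: "(N y)\<^sup>2 + ?t\<^sup>2 = (N y)\<^sup>2 / (1 - u\<^sup>2)"
            using pos by (simp add: power_mult_distrib power_divide field_simps)
          then have "sqrt ((N y)\<^sup>2 + ?t\<^sup>2) = N y / sqrt (1 - u\<^sup>2)"
            using N0[of y] by (simp add: real_sqrt_divide)
          then have 1: "?t / sqrt ((N y)\<^sup>2 + ?t\<^sup>2) = u" using pos y by simp
          have "(N y)\<^sup>2 + ?t\<^sup>2 \<le> 1 \<longleftrightarrow> (N y)\<^sup>2 \<le> 1 - u\<^sup>2" unfolding sq using pos by simp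
          also have "\<dots> \<longleftrightarrow> N y \<le> sqrt (1 - u\<^sup>2)"
            using N0[of y] by (metis real_le_rsqrt real_sqrt_le_iff real_sqrt_unique)
          finally have 2: "(N y)\<^sup>2 + ?t\<^sup>2 \<le> 1 \<longleftrightarrow> N y \<le> sqrt (1 - u\<^sup>2)" .
          show ?thesis using True 1 2 N0[of y]
            by (auto simp: G_def ennreal_mult split: split_indicator)
        qed simp
      qed
      finally show "(\<integral>\<^sup>+t. indicator E (y(q := t)) \<partial>lborel) = (\<integral>\<^sup>+u. ?R u y * ?w u \<partial>lborel)" .
    qed
    also have "\<dots> = (\<integral>\<^sup>+u. (\<integral>\<^sup>+y. ?R u y * ?w u \<partial>leb q) \<partial>lborel)"
    proof (rule PS.Fubini'[symmetric])
      have ind: "indicator {y. N y \<le> c} y = (if N y \<le> c then 1 else 0 :: ennreal)" for y c by simp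
      show "(\<lambda>(y, u). ?R u y * ?w u) \<in> borel_measurable (leb q \<Otimes>\<^sub>M lborel)"
        unfolding ind by measurable
    qed
    also have "\<dots> = (\<integral>\<^sup>+u. K0 * (?d u * indicator A u) \<partial>lborel)"
    proof (rule nn_integral_cong)
      fix u :: real
      have [measurable]: "(\<lambda>y. indicator {y. N y \<le> c} y :: ennreal) \<in> borel_measurable (bor q)" for c
      proof -
        have "(\<lambda>y. if N y \<le> c then 1 else 0 :: ennreal) \<in> borel_measurable (bor q)" by measurable
        moreover have "(\<lambda>y. if N y \<le> c then 1 else 0 :: ennreal) = (\<lambda>y. indicator {y. N y \<le> c} y)"
          by (auto simp: fun_eq_iff)
        ultimately show ?thesis by simp
      qed
      show "(\<integral>\<^sup>+y. ?R u y * ?w u \<partial>leb q)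
        = K0 * (?d u * indicator A u)"
      proof (cases "u \<in> {-1<..<1}")
        case True
        then have pos: "1 - u\<^sup>2 > 0" by (rule one_minus_square_pos)
        define s where "s = sqrt (1 - u\<^sup>2)"
        have s: "s > 0" using pos by (simp add: s_def)
        have Ns: "N (\<lambda>k\<in>{..<q}. 0 + s * y k) = s * N y" for y
        proof -
          have "N (\<lambda>k\<in>{..<q}. 0 + s * y k) = L2_set (\<lambda>k. s * y k) {..<q}"
            unfolding N_def by (intro L2_set_cong) auto
          also have "\<dots> = s * N y" unfolding N_def using s by (intro L2_set_right_distrib[symmetric]) auto
          finally show ?thesis .
        qed
        have "(\<integral>\<^sup>+y. ennreal (N y) * indicator {y. N y \<le> s} y \<partial>leb q)
          = ennreal (\<bar>s\<bar> ^ q) * (\<integral>\<^sup>+y. ennreal (N (\<lambda>k\<in>{..<q}. 0 + s * y k)) * indicator {y. N y \<le> s} (\<lambda>k\<in>{..<q}. 0 + s * y k) \<partial>leb q)"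
          by (rule nn_integral_leb_affine[where a = "\<lambda>_. 0"]) (use s in auto)
        also have "(\<integral>\<^sup>+y. ennreal (N (\<lambda>k\<in>{..<q}. 0 + s * y k)) * indicator {y. N y \<le> s} (\<lambda>k\<in>{..<q}. 0 + s * y k) \<partial>leb q)
          = (\<integral>\<^sup>+y. ennreal s * (ennreal (N y) * indicator {y. N y \<le> 1} y) \<partial>leb q)"
          unfolding Ns using s N0 unfolding indicator_def mem_Collect_eq Ns
          by (intro nn_integral_cong) (auto simp: ennreal_mult)
        also have "\<dots> = ennreal s * K0" unfolding K0_def by (rule nn_integral_cmult) measurable
        finally have S: "(\<integral>\<^sup>+y. ennreal (N y) * indicator {y. N y \<le> s} y \<partial>leb q) = ennreal (s ^ Suc q) * K0"
          using s by (simp add: ennreal_mult mult_ac)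
        have "s ^ Suc q = s powr (real q + 1)" using s by (simp add: powr_realpow[symmetric] powr_add)
        also have "\<dots> = (1 - u\<^sup>2) powr ((real q + 1) / 2)"
          using pos by (simp add: s_def powr_half_sqrt[symmetric] powr_powr)
        moreover have e: "(real q + 1) / 2 + - 3 / 2 = (real q - 2) / 2" by (simp add: field_simps)
        ultimately have "s ^ Suc q * (1 - u\<^sup>2) powr (- 3 / 2) = (1 - u\<^sup>2) powr ((real q - 2) / 2)"
          using e by (simp only: powr_add[symmetric])
        then have P: "ennreal (s ^ Suc q) * ennreal ((1 - u\<^sup>2) powr (- 3 / 2)) = ennreal ((1 - u\<^sup>2) powr ((real q - 2) / 2))"
          using s by (simp flip: ennreal_mult)
        have "(\<integral>\<^sup>+y. ennreal (N y) * indicator {y. N y \<le> s} y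
            * ?w u \<partial>leb q)
          = (\<integral>\<^sup>+y. ennreal (N y) * indicator {y. N y \<le> s} y \<partial>leb q)
            * ?w u"
          by (rule nn_integral_multc) measurable
        also have "\<dots> = K0 * ((ennreal (s ^ Suc q) * ennreal ((1 - u\<^sup>2) powr (- 3 / 2))) * indicator {-1<..<1} u * indicator A u)"
          unfolding S by (simp only: mult_ac)
        also have "\<dots> = K0 * (ennreal ((1 - u\<^sup>2) powr ((real q - 2) / 2)) * indicator {-1<..<1} u * indicator A u)"
          by (simp only: P)
        finally show ?thesis unfolding s_def using True by simp
      qed simp
    qed
    also have "\<dots> = K0 * (\<integral>\<^sup>+u. ?d u * indicator A u \<partial>lborel)"
      by (rule nn_integral_cmult) measurable
    finally show ?thesis by (simp add: E_def)
  qed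
  show ?thesis
  proof (rule exI[of _ "K0 / V"], rule measure_eqI)
    fix A assume "A \<in> sets (distr (uniform_sphere ?p) borel (\<lambda>x. x q))"
    then have A [measurable]: "A \<in> sets borel" by simp
    have X: "(\<lambda>x. x q) \<in> borel_measurable (uniform_sphere ?p)"
      by (rule coord_measurable_sphere[OF measurable_ident_sets[OF refl]]) simp
    have B: "(\<lambda>x. x q) -` A \<inter> space (uniform_sphere ?p) \<in> sets (uniform_sphere ?p)"
      by (rule measurable_sets[OF X A])
    have "emeasure (distr (uniform_sphere ?p) borel (\<lambda>x. x q)) A
        = emeasure (uniform_sphere ?p) ((\<lambda>x. x q) -` A \<inter> space (uniform_sphere ?p))"
      by (rule emeasure_distr[OF X A])
    also have "\<dots> = emeasure (leb ?p) {x \<in> unit_ball ?p. vnormalize ?p x \<in> unit_sphere ?p \<and> vnormalize ?p x q \<in> A} / V"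
      unfolding emeasure_uniform_sphere[OF B] V_def by (simp add: conj_commute)
    also have "\<dots> = (K0 / V) * (\<integral>\<^sup>+u. ?d u * indicator A u \<partial>lborel)"
      unfolding main[OF A] by (simp add: divide_ennreal_def mult_ac)
    also have "\<dots> = (\<integral>\<^sup>+u. (K0 / V) * ?d u * indicator A u \<partial>lborel)"
      by (subst nn_integral_cmult[symmetric]) (measurable, simp add: mult.assoc)
    also have "\<dots> = emeasure (density lborel (\<lambda>u. (K0 / V) * ?d u)) A"
      by (rule emeasure_density[symmetric]) auto
    finally show "emeasure (distr (uniform_sphere ?p) borel (\<lambda>x. x q)) A = \<dots>" .
  qed auto
qed

section \<open>Moments and moment generating function of one coordinate\<close>

text \<open>
  The density, up to normalization, of one coordinate on the unit sphere of dimension \<open>q\<close>, that is,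
  in the space of dimension \<open>q + 1\<close>.
\<close>

definition coord_weight :: "nat \<Rightarrow> real \<Rightarrow> real" where
  "coord_weight q u = indicator {-1<..<1} u * (1 - u\<^sup>2) powr ((real q - 2) / 2)"

definition coord_const :: "nat \<Rightarrow> real" where
  "coord_const q = (LINT u|lborel. coord_weight q u)"

lemma coord_weight_measurable [measurable]: "coord_weight q \<in> borel_measurable borel"
  unfolding coord_weight_def[abs_def] by measurable

lemma coord_weight_nonneg: "coord_weight q u \<ge> 0"
  by (simp add: coord_weight_def)

lemma coord_weight_le:
  assumes "q \<ge> 2" shows "coord_weight q u \<le> indicator {-1..1} u"
proof -
  have "(1 - u\<^sup>2) powr ((real q - 2) / 2) \<le> 1" if "u \<in> {-1<..<1}"
  proof -
    have "u\<^sup>2 < 1" using that by (simp add: abs_square_less_1 abs_less_iff)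
    then show ?thesis using assms by (intro powr_le1) auto
  qed
  then show ?thesis by (auto simp: coord_weight_def split: split_indicator)
qed

lemma coord_weight_even: "coord_weight q (- u) = coord_weight q u"
  by (auto simp: coord_weight_def split: split_indicator)

lemma integrable_coord_weight_mult:
  assumes q: "q \<ge> 2" and [measurable]: "f \<in> borel_measurable borel"
    and B: "\<And>u. \<bar>u\<bar> \<le> 1 \<Longrightarrow> \<bar>f u\<bar> \<le> B"
  shows "integrable lborel (\<lambda>u. f u * coord_weight q u)"
proof (rule Bochner_Integration.integrable_bound[where f = "\<lambda>u::real. B * indicator {-1..1} u"])
  show "integrable lborel (\<lambda>u::real. B * indicator {-1..1} u)"
    by (intro integrable_mult_right integrable_real_indicator) auto
  have "\<bar>f u\<bar> * coord_weight q u \<le> \<bar>B\<bar> * indicator {-1..1} u" for u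
  proof (cases "\<bar>u\<bar> \<le> 1")
    case True
    then have "\<bar>f u\<bar> \<le> \<bar>B\<bar>" using B[of u] by linarith
    then show ?thesis using coord_weight_le[OF q, of u] coord_weight_nonneg[of q u]
      by (intro mult_mono) auto
  next
    case False
    then show ?thesis by (auto simp: coord_weight_def split: split_indicator)
  qed
  then show "AE u in lborel. norm (f u * coord_weight q u) \<le> norm (B * indicator {-1..1} u)"
    by (intro AE_I2) (simp add: abs_mult coord_weight_nonneg)
qed measurable

lemma integrable_coord_weight: "q \<ge> 2 \<Longrightarrow> integrable lborel (coord_weight q)"
  using integrable_coord_weight_mult[of q "\<lambda>_. 1" 1] by simp

lemma powr_half_eq_coord_weight:
  assumes "u \<in> {-1<..<1}"
  shows "(1 - u\<^sup>2) powr (real q / 2) = (1 - u\<^sup>2) * coord_weight q u"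
    and "(1 - u\<^sup>2) powr (real q / 2 - 1) = coord_weight q u"
proof -
  have "(1 - u\<^sup>2) powr (real q / 2) = (1 - u\<^sup>2) powr (1 + (real q - 2) / 2)"
    by (simp add: field_simps)
  also have "\<dots> = (1 - u\<^sup>2) * (1 - u\<^sup>2) powr ((real q - 2) / 2)"
    using one_minus_square_pos[OF assms] by (simp only: powr_add powr_one)
  finally show "(1 - u\<^sup>2) powr (real q / 2) = (1 - u\<^sup>2) * coord_weight q u"
    using assms by (simp add: coord_weight_def)
  show "(1 - u\<^sup>2) powr (real q / 2 - 1) = coord_weight q u"
    using assms by (simp add: coord_weight_def diff_divide_distrib)
qed

definition coord_law :: "nat \<Rightarrow> real measure" where
  "coord_law q = distr (uniform_sphere (Suc q)) borel (\<lambda>x. x q)"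

lemma prob_space_coord_law: "prob_space (coord_law q)"
  unfolding coord_law_def
  by (intro prob_space.prob_space_distr prob_space_uniform_sphere
      coord_measurable_sphere measurable_ident_sets) auto

lemma coord_law_eq:
  assumes q: "q \<ge> 2"
  shows "coord_const q > 0"
    and "coord_law q = density lborel (\<lambda>u. ennreal (coord_weight q u / coord_const q))"
proof -
  obtain K where K: "coord_law q = density lborel (\<lambda>u. K * ennreal (coord_weight q u))"
    using distr_sphere_coordinate[of q] q unfolding coord_law_def coord_weight_def by auto
  interpret prob_space "coord_law q" by (rule prob_space_coord_law)
  have "1 = emeasure (coord_law q) UNIV"
    using emeasure_space_1 by (simp add: coord_law_def)
  also have "\<dots> = (\<integral>\<^sup>+u. K * ennreal (coord_weight q u) \<partial>lborel)"
    unfolding K by (simp add: emeasure_density)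
  also have "\<dots> = K * (\<integral>\<^sup>+u. ennreal (coord_weight q u) \<partial>lborel)"
    by (rule nn_integral_cmult) measurable
  also have "(\<integral>\<^sup>+u. ennreal (coord_weight q u) \<partial>lborel) = ennreal (coord_const q)"
    unfolding coord_const_def using q
    by (intro nn_integral_eq_integral integrable_coord_weight) (auto simp: coord_weight_nonneg)
  finally have 1: "1 = K * ennreal (coord_const q)" .
  have "coord_const q \<ge> 0" unfolding coord_const_def
    by (intro integral_nonneg_AE AE_I2 coord_weight_nonneg)
  moreover have "coord_const q \<noteq> 0" using 1 by auto
  ultimately show c: "coord_const q > 0" by simp
  have "K \<noteq> \<top>" using 1 c by (auto simp: ennreal_top_mult)
  then obtain k where k: "K = ennreal k" "k \<ge> 0" by (cases K) auto
  then have "1 = ennreal (k * coord_const q)" using 1 c by (simp add: ennreal_mult)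
  then have "k * coord_const q = 1" using k c by (metis ennreal_eq_1)
  then have "k = 1 / coord_const q" using c by (simp add: field_simps)
  then show "coord_law q = density lborel (\<lambda>u. ennreal (coord_weight q u / coord_const q))"
    unfolding K k using c coord_weight_nonneg[of q] by (simp flip: ennreal_mult)
qed

lemma integral_coord_law:
  assumes "q \<ge> 2" and [measurable]: "f \<in> borel_measurable borel"
  shows "(LINT u|coord_law q. f u) = (LINT u|lborel. f u * coord_weight q u) / coord_const q"
proof -
  have "(LINT u|coord_law q. f u) = (LINT u|lborel. (coord_weight q u / coord_const q) *\<^sub>R f u)"
    unfolding coord_law_eq(2)[OF assms(1)] using coord_law_eq(1)[OF assms(1)]
    by (intro integral_density) (auto intro!: AE_I2 divide_nonneg_pos coord_weight_nonneg)
  also have "\<dots> = (LINT u|lborel. (f u * coord_weight q u) / coord_const q)"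
    by (intro Bochner_Integration.integral_cong) auto
  finally show ?thesis by simp
qed

lemma AE_coord_law_bounded:
  assumes "q \<ge> 2" shows "AE u in coord_law q. \<bar>u\<bar> \<le> 1"
  unfolding coord_law_eq(2)[OF assms]
  by (subst AE_density) (auto simp: coord_weight_def intro!: AE_I2 split: split_indicator)

lemma coord_moment_odd:
  assumes "q \<ge> 2" "odd n" shows "(LINT u|coord_law q. u ^ n) = 0"
proof -
  have "(LINT u|lborel. u ^ n * coord_weight q u) = (LINT u|lborel. (0 + - 1 * u) ^ n * coord_weight q (0 + - 1 * u))"
    by (subst lborel_integral_real_affine[of "-1" _ 0]) auto
  also have "\<dots> = - (LINT u|lborel. u ^ n * coord_weight q u)"
    using assms(2) by (simp add: coord_weight_even)
  finally show ?thesis using assms by (subst integral_coord_law) auto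
qed

text \<open>
  The derivative of \<open>u ^ (2 k + 1) * (1 - u\<^sup>2) powr (q / 2)\<close>, which vanishes at both end points,
  integrates to 0.
\<close>

lemma coord_moment_rec:
  assumes q: "q \<ge> 3"
  shows "(2 * real k + 1) * (LINT u|coord_law q. u ^ (2 * k))
    = (2 * real k + real (Suc q)) * (LINT u|coord_law q. u ^ (2 * Suc k))"
proof -
  let ?I = "\<lambda>k. LINT u|lborel. u ^ (2 * k) * coord_weight q u"
  define F where "F u = u ^ (2 * k + 1) * (1 - u\<^sup>2) powr (real q / 2)" for u :: real
  define F' where "F' u = ((2 * real k + 1) * u ^ (2 * k) - (2 * real k + real (Suc q)) * u ^ (2 * Suc k)) * coord_weight q u" for u
  have int: "integrable lborel (\<lambda>u. u ^ (2 * k) * coord_weight q u)" for k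
    by (rule integrable_coord_weight_mult[where B = 1])
       (use q in \<open>auto simp: power_abs power_le_one\<close>)
  have F'_eq: "F' u = (2 * real k + 1) * (u ^ (2 * k) * coord_weight q u)
      - (2 * real k + real (Suc q)) * (u ^ (2 * Suc k) * coord_weight q u)" for u
    unfolding F'_def left_diff_distrib by (simp only: mult.assoc)
  have "integrable lborel F'" unfolding F'_eq[abs_def]
    by (intro Bochner_Integration.integrable_diff integrable_mult_right int)
  then have "(F' has_integral (LINT u|lborel. F' u)) UNIV" by (rule has_integral_integral_lborel)
  moreover have "(F' has_integral F 1 - F (- 1)) {-1..1}"
  proof (rule fundamental_theorem_of_calculus_interior)
    show "continuous_on {-1..1} F" unfolding F_def
      using q by (intro continuous_intros continuous_on_powr') (auto simp: abs_square_le_1 abs_le_iff)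
    fix x :: real assume x: "x \<in> {-1<..<1}"
    then have pos: "1 - x\<^sup>2 > 0" by (rule one_minus_square_pos)
    have d: "(F has_real_derivative (real (2 * k + 1) * x ^ (2 * k)) * (1 - x\<^sup>2) powr (real q / 2)
        + x ^ (2 * k + 1) * ((real q / 2) * (1 - x\<^sup>2) powr (real q / 2 - 1) * (- (2 * x)))) (at x)"
      unfolding F_def
      by (rule derivative_eq_intros refl | use pos in simp)+
    note e = powr_half_eq_coord_weight[OF x, of q]
    have "real (2 * k + 1) * x ^ (2 * k) * ((1 - x\<^sup>2) * coord_weight q x)
        + x ^ (2 * k + 1) * (real q / 2 * coord_weight q x * (- (2 * x))) = F' x"
      unfolding F'_def by (simp add: algebra_simps power2_eq_square power_add)
    with d have "(F has_real_derivative F' x) (at x)"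
      unfolding e by (simp only:)
    then show "(F has_vector_derivative F' x) (at x)"
      by (simp add: has_real_derivative_iff_has_vector_derivative)
  qed simp
  moreover have "F 1 - F (-1) = 0" using q by (simp add: F_def)
  moreover have "F' = (\<lambda>x. if x \<in> {-1..1} then F' x else 0)"
    by (auto simp: fun_eq_iff F'_def coord_weight_def split: split_indicator)
  ultimately have "(LINT u|lborel. F' u) = 0"
    by (metis has_integral_restrict_UNIV has_integral_unique)
  moreover have "(LINT u|lborel. F' u) = (2 * real k + 1) * ?I k - (2 * real k + real (Suc q)) * ?I (Suc k)"
    unfolding F'_eq
    by (subst Bochner_Integration.integral_diff)
       (intro integrable_mult_right int | simp only: integral_mult_right_zero)+
  ultimately show ?thesis using q by (subst (1 2) integral_coord_law) auto
qed

text \<open>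
  Odd moments vanish.  By the recursion for the even ones, term number \<open>k\<close> of the power series is
  \<open>y ^ k / fact k\<close> times the product of the factors \<open>p / (p + 2 j)\<close> over \<open>j < k\<close>, where \<open>p = q + 1\<close>.  This
  product lies between \<open>1 - k (k - 1) / p\<close> and 1, and the sum of \<open>y ^ k / fact k * (k (k - 1))\<close> is
  \<open>y\<^sup>2 * exp y\<close>.
\<close>

lemma coord_mgf_bounds:
  fixes s :: real
  assumes q: "q \<ge> 3"
  defines "y \<equiv> s\<^sup>2 / (2 * real (Suc q))"
  shows "(LINT u|coord_law q. exp (s * u)) \<le> exp y"
    and "exp y * (1 - y\<^sup>2 / real (Suc q)) \<le> (LINT u|coord_law q. exp (s * u))"
proof -
  interpret prob_space "coord_law q" by (rule prob_space_coord_law)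
  let ?p = "real (Suc q)"
  let ?m = "\<lambda>n. LINT u|coord_law q. u ^ n"
  have sc: "sets (coord_law q) = sets borel" by (simp add: coord_law_def)
  have AE: "AE u in coord_law q. \<bar>u\<bar> \<le> 1" using q by (intro AE_coord_law_bounded) auto
  have int: "integrable (coord_law q) (\<lambda>u. u ^ n)" for n
    by (rule integrable_const_bound[where B = 1])
       (use AE in \<open>auto simp: power_abs power_le_one measurable_cong_sets[OF sc refl]\<close>)
  have ex: "(\<Sum>n. (s * u) ^ n / fact n) = exp (s * u)" for u
    by (simp add: exp_def divide_inverse mult.commute)
  have "(\<lambda>n. LINT u|coord_law q. (s * u) ^ n / fact n) sums (LINT u|coord_law q. (\<Sum>n. (s * u) ^ n / fact n))"
  proof (rule sums_integral)
    show "integrable (coord_law q) (\<lambda>u. (s * u) ^ n / fact n)" for n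
      using int[of n] by (simp add: power_mult_distrib)
    show "AE u in coord_law q. summable (\<lambda>n. norm ((s * u) ^ n / fact n))"
    proof (rule AE_I2)
      fix u
      have "(\<lambda>n. norm ((s * u) ^ n / fact n)) = (\<lambda>n. norm ((s * u) ^ n /\<^sub>R fact n))"
        by (intro ext) (simp add: abs_mult divide_inverse mult.commute)
      then show "summable (\<lambda>n. norm ((s * u) ^ n / fact n))"
        using summable_norm_exp[of "s * u"] by (simp only:)
    qed
    show "summable (\<lambda>n. LINT u|coord_law q. norm ((s * u) ^ n / fact n))"
    proof (rule summable_comparison_test'[where g = "\<lambda>n. \<bar>s\<bar> ^ n / fact n"])
      show "summable (\<lambda>n. \<bar>s\<bar> ^ n / fact n)"
        using summable_exp[of "\<bar>s\<bar>"] by (simp add: divide_inverse mult.commute)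
      fix n
      have "(LINT u|coord_law q. norm ((s * u) ^ n / fact n)) \<le> (LINT u|coord_law q. \<bar>s\<bar> ^ n / fact n)"
      proof (rule integral_mono_AE)
        show "integrable (coord_law q) (\<lambda>u. norm ((s * u) ^ n / fact n))"
          using int[of n] by (intro integrable_norm) (simp add: power_mult_distrib)
        show "AE u in coord_law q. norm ((s * u) ^ n / fact n) \<le> \<bar>s\<bar> ^ n / fact n"
          using AE by eventually_elim
            (auto simp: power_abs abs_mult power_mult_distrib intro!: divide_right_mono mult_left_le power_le_one)
      qed auto
      then show "norm (LINT u|coord_law q. norm ((s * u) ^ n / fact n)) \<le> \<bar>s\<bar> ^ n / fact n"
        by (simp add: integral_nonneg_AE prob_space)
    qed
  qed
  then have "(\<lambda>n. s ^ n * ?m n / fact n) sums (LINT u|coord_law q. exp (s * u))"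
    unfolding ex by (simp add: power_mult_distrib)
  then have sums: "(\<lambda>k. s ^ (2 * k) * ?m (2 * k) / fact (2 * k)) sums (LINT u|coord_law q. exp (s * u))"
  proof (subst sums_mono_reindex[where g = "\<lambda>k. 2 * k" and f = "\<lambda>n. s ^ n * ?m n / fact n"])
    show "strict_mono (\<lambda>k::nat. 2 * k)" by (auto simp: strict_mono_def)
    fix n :: nat assume "n \<notin> range (\<lambda>k. 2 * k)"
    then have "odd n" by (auto elim!: evenE)
    then show "s ^ n * ?m n / fact n = 0" using q by (simp add: coord_moment_odd)
  qed
  define a where "a k = s ^ (2 * k) * ?m (2 * k) / fact (2 * k)" for k
  have a0: "a 0 = 1" by (simp add: a_def prob_space)
  have aS: "a (Suc k) = a k * (y / real (Suc k)) * (?p / (?p + 2 * real k))" for k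
  proof -
    have p0: "?p + 2 * real k > 0" by simp
    have m: "?m (2 * Suc k) = (2 * real k + 1) * ?m (2 * k) / (?p + 2 * real k)"
      using coord_moment_rec[OF q, of k] p0 by (simp add: field_simps)
    have f: "fact (2 * Suc k) = (2 * real k + 2) * (2 * real k + 1) * fact (2 * k)"
      by (simp add: algebra_simps)
    have "a (Suc k) = (s ^ (2 * k) * s\<^sup>2) * ((2 * real k + 1) * ?m (2 * k) / (?p + 2 * real k))
        / ((2 * real k + 2) * (2 * real k + 1) * fact (2 * k))"
      unfolding a_def m f by (simp add: power2_eq_square)
    also have "\<dots> = (s ^ (2 * k) * ?m (2 * k) / fact (2 * k)) * (s\<^sup>2 / (2 * real k + 2)) / (?p + 2 * real k)"
    proof -
      have "2 * real k + 1 \<noteq> 0" by simp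
      then show ?thesis by (simp add: mult_ac)
    qed
    also have "\<dots> = a k * (y / real (Suc k)) * (?p / (?p + 2 * real k))"
    proof -
      have "A * (S / (2 * K + 2)) / (P + 2 * K) = A * (S / (2 * P) / (K + 1)) * (P / (P + 2 * K))"
        if "P > 0" "K \<ge> 0" for A S P K :: real
      proof -
        have e: "2 * P * (K + 1) = (2 * K + 2) * P" by (simp add: algebra_simps)
        have "S / (2 * P) / (K + 1) * P = S * P / ((2 * K + 2) * P)"
          by (simp only: divide_divide_eq_left times_divide_eq_left e)
        also have "\<dots> = S / (2 * K + 2)"
          using that by (intro mult_divide_mult_cancel_right) simp
        finally have "S / (2 * K + 2) = S / (2 * P) / (K + 1) * P" by (rule sym)
        moreover have "A * (X * P) / D = A * X * (P / D)" for X D by simp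
        ultimately show ?thesis by (simp only:)
      qed
      from this[of ?p "real k" "s ^ (2 * k) * ?m (2 * k) / fact (2 * k)" "s\<^sup>2"]
      show ?thesis by (simp add: a_def y_def add.commute)
    qed
    finally show ?thesis .
  qed
  have y0: "y \<ge> 0" by (simp add: y_def)
  have up: "0 \<le> a k \<and> a k \<le> y ^ k / fact k" for k
  proof (induction k)
    case (Suc k)
    have "?p / (?p + 2 * real k) \<le> 1" by simp
    then have "(y / real (Suc k)) * (?p / (?p + 2 * real k)) \<le> y / real (Suc k)"
      using y0 by (intro mult_left_le) auto
    then have "a (Suc k) \<le> (y ^ k / fact k) * (y / real (Suc k))"
      unfolding aS mult.assoc using Suc y0 by (intro mult_mono) auto
    moreover have "0 \<le> a (Suc k)" unfolding aS using Suc y0 by simp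
    ultimately show ?case by (simp add: mult_ac)
  qed (simp add: a0)
  have lo: "y ^ k / fact k * (1 - real k * (real k - 1) / ?p) \<le> a k" for k
  proof (induction k)
    case (Suc k)
    show ?case
    proof (cases "1 - real k * (real k - 1) / ?p \<ge> 0")
      case False
      have "real k * (real k - 1) \<le> real (Suc k) * (real (Suc k) - 1)" by (simp add: algebra_simps)
      then have "real k * (real k - 1) / ?p \<le> real (Suc k) * (real (Suc k) - 1) / ?p"
        by (intro divide_right_mono) auto
      then have "1 - real (Suc k) * (real (Suc k) - 1) / ?p \<le> 0" using False by linarith
      then have "y ^ Suc k / fact (Suc k) * (1 - real (Suc k) * (real (Suc k) - 1) / ?p) \<le> 0"
        using y0 by (intro mult_nonneg_nonpos) auto
      then show ?thesis using up[of "Suc k"] by linarith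
    next
      case True
      let ?z = "2 * real k / ?p" and ?w = "real k * (real k - 1) / ?p"
      have z: "?z \<ge> 0" by simp
      have w: "?w \<ge> 0" by (cases k) auto
      have "1 - z \<le> 1 / (1 + z)" if "z \<ge> 0" for z :: real
        using that by (intro mult_imp_le_div_pos) (auto simp: algebra_simps)
      from this[OF z] have "1 - ?z \<le> 1 / (1 + ?z)" .
      moreover have "1 / (1 + 2 * K / P) = P / (P + 2 * K)" if "P > 0" for K P :: real
      proof -
        have "1 + 2 * K / P = (P + 2 * K) / P" using that by (simp add: add_divide_distrib)
        then show ?thesis by simp
      qed
      then have "1 / (1 + ?z) = ?p / (?p + 2 * real k)" by (metis of_nat_0_less_iff zero_less_Suc)
      ultimately have 1: "1 - ?z \<le> ?p / (?p + 2 * real k)" by (simp only:)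
      have prod_ge: "1 - a - b \<le> (1 - a) * (1 - b)" if "a \<ge> 0" "b \<ge> 0" for a b :: real
        using mult_nonneg_nonneg[OF that] by (simp add: algebra_simps)
      have "1 - real (Suc k) * (real (Suc k) - 1) / ?p = 1 - ?w - ?z"
      proof -
        have "real (Suc k) * (real (Suc k) - 1) = real k * (real k - 1) + 2 * real k"
          by (simp add: algebra_simps)
        then show ?thesis by (simp only: add_divide_distrib)
      qed
      also have "\<dots> \<le> (1 - ?w) * (1 - ?z)" by (rule prod_ge[OF w z])
      also have "\<dots> \<le> (1 - ?w) * (?p / (?p + 2 * real k))"
        using True 1 by (intro mult_left_mono) auto
      finally have 2: "1 - real (Suc k) * (real (Suc k) - 1) / ?p \<le> (1 - ?w) * (?p / (?p + 2 * real k))" .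
      have "y ^ Suc k / fact (Suc k) * (1 - real (Suc k) * (real (Suc k) - 1) / ?p)
          \<le> y ^ Suc k / fact (Suc k) * ((1 - ?w) * (?p / (?p + 2 * real k)))"
        using 2 y0 by (intro mult_left_mono) auto
      also have "\<dots> = (y ^ k / fact k * (1 - ?w)) * (y / real (Suc k)) * (?p / (?p + 2 * real k))"
        by (simp add: mult_ac)
      also have "\<dots> \<le> a (Suc k)" unfolding aS
        using Suc y0 by (intro mult_right_mono) auto
      finally show ?thesis .
    qed
  qed (simp add: a0)
  have e: "(\<lambda>k. y ^ k / fact k) sums exp y"
    using exp_converges[of y] by (simp add: divide_inverse mult.commute)
  show "(LINT u|coord_law q. exp (s * u)) \<le> exp y"
    using sums_le[OF _ sums e] up unfolding a_def by blast
  have "(\<lambda>k. y ^ (k + 2) / fact (k + 2) * (real (k + 2) * (real (k + 2) - 1))) sums (y\<^sup>2 * exp y)"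
  proof -
    have eq: "y ^ (k + 2) / fact (k + 2) * (real (k + 2) * (real (k + 2) - 1)) = y\<^sup>2 * (y ^ k / fact k)" for k
    proof -
      have f: "fact (k + 2) = (real (k + 2) * (real (k + 2) - 1)) * fact k" by (simp add: algebra_simps)
      have "real (k + 2) * (real (k + 2) - 1) \<noteq> 0" by simp
      then show ?thesis unfolding f by (simp add: power_add power2_eq_square)
    qed
    show ?thesis unfolding eq by (rule sums_mult[OF e])
  qed
  moreover define F where "F k = y ^ k / fact k * (real k * (real k - 1))" for k
  ultimately have "(\<lambda>k. F (k + 2)) sums (y\<^sup>2 * exp y)" by (simp only:)
  then have "F sums (y\<^sup>2 * exp y + (\<Sum>k<2. F k))" by (rule iffD1[OF sums_iff_shift])
  moreover have "(\<Sum>k<2. F k) = 0" by (simp add: F_def numeral_2_eq_2)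
  ultimately have "(\<lambda>k. y ^ k / fact k * (real k * (real k - 1))) sums (y\<^sup>2 * exp y)"
    by (simp add: F_def[abs_def])
  from sums_diff[OF e sums_divide[OF this, of ?p]]
  have "(\<lambda>k. y ^ k / fact k * (1 - real k * (real k - 1) / ?p)) sums (exp y * (1 - y\<^sup>2 / ?p))"
    by (simp add: right_diff_distrib mult.commute)
  from sums_le[OF _ this sums] lo
  show "exp y * (1 - y\<^sup>2 / real (Suc q)) \<le> (LINT u|coord_law q. exp (s * u))"
    unfolding a_def by blast
qed

section \<open>The tail of one coordinate\<close>

text \<open>
  After the rescaling \<open>u = s / sqrt q\<close> the weight converges to \<open>exp (- s\<^sup>2 / 2)\<close>.  From \<open>q = 3\<close> on it is
  dominated by \<open>exp (- s\<^sup>2 / 6)\<close>, because \<open>(q - 2) / (2 q) \<ge> 1 / 6\<close>.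
\<close>

lemma coord_const_asymp: "(\<lambda>q. sqrt (real q) * coord_const q) \<longlonglongrightarrow> sqrt (2 * pi)"
proof -
  define f where "f q s = coord_weight (q + 3) (s / sqrt (real (q + 3)))" for q and s :: real
  have f_meas [measurable]: "f q \<in> borel_measurable borel" for q unfolding f_def[abs_def] by measurable
  have f_int: "(LINT s|lborel. f q s) = sqrt (real (q + 3)) * coord_const (q + 3)" for q
  proof -
    let ?r = "sqrt (real (q + 3))"
    have r: "?r > 0" by simp
    have "(LINT s|lborel. f q s) = \<bar>?r\<bar> *\<^sub>R (LINT s|lborel. f q (0 + ?r * s))"
      by (rule lborel_integral_real_affine) (use r in simp)
    moreover have "f q (0 + ?r * s) = coord_weight (q + 3) s" for s
      unfolding f_def using r by simp
    ultimately show ?thesis by (simp add: coord_const_def)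
  qed
  have bound: "\<bar>f q s\<bar> \<le> exp (- s\<^sup>2 / 6)" for q s
  proof (cases "s / sqrt (real (q + 3)) \<in> {-1<..<1}")
    case True
    let ?u = "s / sqrt (real (q + 3))"
    have u2: "?u\<^sup>2 = s\<^sup>2 / real (q + 3)" by (simp add: power_divide)
    have pos: "1 - ?u\<^sup>2 > 0" using True by (rule one_minus_square_pos)
    have "ln (1 - ?u\<^sup>2) \<le> - ?u\<^sup>2" using ln_add_one_self_le_self2[of "- ?u\<^sup>2"] pos by simp
    then have "(real (q + 3) - 2) / 2 * ln (1 - ?u\<^sup>2) \<le> (real (q + 3) - 2) / 2 * (- ?u\<^sup>2)"
      by (intro mult_left_mono) auto
    also have "\<dots> = - (s\<^sup>2) * ((real (q + 3) - 2) / (2 * real (q + 3)))"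
      unfolding u2 by (simp add: field_simps)
    also have "\<dots> \<le> - (s\<^sup>2) * (1 / 6)"
    proof (rule mult_left_mono_neg)
      show "1 / 6 \<le> (real (q + 3) - 2) / (2 * real (q + 3))" by (simp add: field_simps)
    qed simp
    finally have "(1 - ?u\<^sup>2) powr ((real (q + 3) - 2) / 2) \<le> exp (- s\<^sup>2 / 6)"
      using pos by (simp add: powr_def)
    then show ?thesis using True by (simp add: f_def coord_weight_def)
  qed (simp add: f_def coord_weight_def)
  have lim: "(\<lambda>q. f q s) \<longlonglongrightarrow> exp (- s\<^sup>2 / 2)" for s
  proof -
    have "(\<lambda>q. (1 - s\<^sup>2 / real (q + 3)) powr ((real (q + 3) - 2) / 2)) \<longlonglongrightarrow> exp (- s\<^sup>2 / 2)"
      by real_asymp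
    moreover have "eventually (\<lambda>q. f q s = (1 - s\<^sup>2 / real (q + 3)) powr ((real (q + 3) - 2) / 2)) sequentially"
    proof -
      have "eventually (\<lambda>q. \<bar>s\<bar> < sqrt (real (q + 3))) sequentially" by real_asymp
      then show ?thesis
      proof eventually_elim
        case (elim q)
        then have "s / sqrt (real (q + 3)) \<in> {-1<..<1}"
          by (auto simp: abs_less_iff pos_divide_less_eq pos_less_divide_eq)
        then show ?case by (simp add: f_def coord_weight_def power_divide)
      qed
    qed
    ultimately show ?thesis by (simp add: tendsto_cong)
  qed
  have "(\<lambda>q. LINT s|lborel. f q s) \<longlonglongrightarrow> (LINT s|lborel. exp (- s\<^sup>2 / 2))"
  proof (rule integral_dominated_convergence[where w = "\<lambda>s. exp (- s\<^sup>2 / 6)"])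
    have "integrable lborel (\<lambda>s. sqrt (2 * pi * (sqrt 3)\<^sup>2) * normal_density 0 (sqrt 3) s)"
      by (intro integrable_mult_right integrable_normal_density) simp
    then show "integrable lborel (\<lambda>s::real. exp (- s\<^sup>2 / 6))"
      by (simp add: normal_density_def)
  qed (use lim bound in auto)
  also have "(LINT s|lborel. exp (- s\<^sup>2 / 2)) = sqrt (2 * pi)"
  proof -
    have "(LINT s|lborel. exp (- s\<^sup>2 / 2)) = (LINT s|lborel. sqrt (2 * pi) * std_normal_density s)"
      by (intro Bochner_Integration.integral_cong) (auto simp: std_normal_density_def)
    also have "\<dots> = sqrt (2 * pi) * (LINT s|lborel. std_normal_density s)"
      by (rule integral_mult_right_zero)
    finally show ?thesis using integral_normal_density[of 1 0] by simp
  qed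
  finally have "(\<lambda>q. sqrt (real (q + 3)) * coord_const (q + 3)) \<longlonglongrightarrow> sqrt (2 * pi)"
    unfolding f_int .
  then show ?thesis by (rule LIMSEQ_offset)
qed

text \<open>
  Bounds of Mills ratio type: \<open>- ((1 - v\<^sup>2) powr (q / 2)) / (q * v)\<close> has the derivative
  \<open>(1 + (1 - v\<^sup>2) / (q * v\<^sup>2)) * coord_weight q v\<close>, and for \<open>v \<ge> u\<close> the first factor lies between 1 and
  \<open>1 + 1 / (q * u\<^sup>2)\<close>.
\<close>

lemma coord_tail_bounds:
  fixes u :: real
  assumes q: "q \<ge> 3" and u: "0 < u" "u < 1"
  defines "T \<equiv> 2 * (1 - u\<^sup>2) powr (real q / 2) / (real q * u * coord_const q)"
  shows "measure (coord_law q) {v. u < \<bar>v\<bar>} \<le> T"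
    and "T \<le> (1 + 1 / (real q * u\<^sup>2)) * measure (coord_law q) {v. u < \<bar>v\<bar>}"
proof -
  let ?w = "coord_weight q"
  have c: "coord_const q > 0" using q by (intro coord_law_eq) auto
  define I where "I = (LINT v|lborel. indicator {u<..} v * ?w v)"
  have int1: "integrable lborel (\<lambda>v. indicator {u<..} v * ?w v)"
    using q by (intro integrable_coord_weight_mult[where B = 1]) (auto split: split_indicator)
  have meas: "measure (coord_law q) {v. u < \<bar>v\<bar>} = 2 * I / coord_const q"
  proof -
    have "{v. u < \<bar>v\<bar>} \<in> sets borel" by measurable
    then have "measure (coord_law q) {v. u < \<bar>v\<bar>} = (LINT v|coord_law q. indicator {v. u < \<bar>v\<bar>} v)"
      by (simp add: coord_law_def)
    also have "\<dots> = (LINT v|lborel. indicator {v. u < \<bar>v\<bar>} v * ?w v) / coord_const q"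
      using q by (intro integral_coord_law) auto
    also have "(LINT v|lborel. indicator {v. u < \<bar>v\<bar>} v * ?w v)
        = (LINT v|lborel. indicator {u<..} v * ?w v + indicator {u<..} (- v) * ?w (- v))"
      using u by (intro Bochner_Integration.integral_cong) (auto simp: coord_weight_even split: split_indicator)
    also have "\<dots> = I + (LINT v|lborel. indicator {u<..} (- v) * ?w (- v))"
    proof -
      have "integrable lborel (\<lambda>v. indicator {u<..} (0 + - 1 * v) * ?w (0 + - 1 * v))"
        by (rule lborel_integrable_real_affine[OF int1]) simp
      then show ?thesis unfolding I_def using int1
        by (intro Bochner_Integration.integral_add) simp_all
    qed
    also have "(LINT v|lborel. indicator {u<..} (- v) * ?w (- v)) = I"
      unfolding I_def by (subst (2) lborel_integral_real_affine[of "-1" _ 0]) auto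
    finally show ?thesis by simp
  qed
  define A where "A = (1 - u\<^sup>2) powr (real q / 2) / (real q * u)"
  define F where "F v = - ((1 - v\<^sup>2) powr (real q / 2) / (real q * v))" for v
  define h where "h v = 1 + (1 - v\<^sup>2) / (real q * v\<^sup>2)" for v
  have FTC: "((\<lambda>v. h v * ?w v) has_integral F 1 - F u) {u..1}"
  proof (rule fundamental_theorem_of_calculus_interior)
    show "continuous_on {u..1} F" unfolding F_def
      using q u by (intro continuous_intros continuous_on_powr') (auto simp: abs_square_le_1 abs_le_iff)
    fix v assume v: "v \<in> {u<..<1}"
    then have v': "v \<in> {-1<..<1}" "v > 0" using u by auto
    then have pos: "1 - v\<^sup>2 > 0" by (intro one_minus_square_pos)
    note e = powr_half_eq_coord_weight[OF v'(1), of q]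
    have dN: "((\<lambda>v. (1 - v\<^sup>2) powr (real q / 2)) has_real_derivative
        real q / 2 * (1 - v\<^sup>2) powr (real q / 2 - 1) * (- (2 * v))) (at v)"
      by (rule derivative_eq_intros refl | use pos in simp)+
    have dD: "((\<lambda>v. real q * v) has_real_derivative real q) (at v)"
      by (auto intro!: derivative_eq_intros)
    have "real q * v \<noteq> 0" using q v' by simp
    note d = DERIV_minus[OF DERIV_divide[OF dN dD this]]
    have "- ((real q / 2 * ?w v * (- (2 * v)) * (real q * v) - (1 - v\<^sup>2) * ?w v * real q)
        / (real q * v * (real q * v))) = h v * ?w v"
    proof -
      have "- ((Q / 2 * W * (- (2 * v)) * (Q * v) - Y * W * Q) / (Q * v * (Q * v))) = (1 + Y / (Q * v\<^sup>2)) * W"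
        if "Q > 0" for Q W Y
        using that v' by (simp add: field_simps power2_eq_square)
      then show ?thesis unfolding h_def using q by simp
    qed
    with d have "(F has_real_derivative h v * ?w v) (at v)"
      unfolding e F_def[abs_def] by (simp only:)
    then show "(F has_vector_derivative h v * ?w v) (at v)"
      by (simp add: has_real_derivative_iff_has_vector_derivative)
  qed (use u in simp)
  have FA: "F 1 - F u = A" using q by (simp add: F_def A_def)
  have h1: "1 \<le> h v" "h v \<le> 1 + 1 / (real q * u\<^sup>2)" if "v \<in> {u<..<1}" for v
  proof -
    have v: "v > 0" "v\<^sup>2 \<le> 1" "u\<^sup>2 \<le> v\<^sup>2" using that u by (auto simp: power_le_one power_mono)
    then show "1 \<le> h v" by (simp add: h_def)
    have "(1 - v\<^sup>2) / (real q * v\<^sup>2) \<le> 1 / (real q * u\<^sup>2)"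
      using v u q by (intro frac_le mult_left_mono) auto
    then show "h v \<le> 1 + 1 / (real q * u\<^sup>2)" by (simp add: h_def)
  qed
  have intw: "((\<lambda>v. ?w v) has_integral I) {u..1}"
  proof -
    have "((\<lambda>v. indicator {u<..} v * ?w v) has_integral I) UNIV"
      unfolding I_def by (rule has_integral_integral_lborel[OF int1])
    then have "((\<lambda>v. if v \<in> {u<..<1} then ?w v else 0) has_integral I) UNIV"
      by (rule has_integral_eq[rotated]) (use u in \<open>auto simp: coord_weight_def split: split_indicator\<close>)
    then have "(?w has_integral I) {u<..<1}" by (simp only: has_integral_restrict_UNIV)
    then show ?thesis using has_integral_Icc_iff_Ioo by blast
  qed
  have "(?w has_integral I) {u<..<1}" using intw has_integral_Icc_iff_Ioo by blast
  moreover have FTC': "((\<lambda>v. h v * ?w v) has_integral A) {u<..<1}"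
    using FTC has_integral_Icc_iff_Ioo unfolding FA by blast
  ultimately have "I \<le> A"
  proof (rule has_integral_le)
    fix v assume "v \<in> {u<..<1}"
    then have "1 * ?w v \<le> h v * ?w v" by (intro mult_right_mono h1 coord_weight_nonneg)
    then show "?w v \<le> h v * ?w v" by simp
  qed
  then have "2 * I / coord_const q \<le> 2 * A / coord_const q"
    using c by (simp add: divide_right_mono)
  also have TA: "2 * A / coord_const q = T" by (simp add: A_def T_def)
  finally show "measure (coord_law q) {v. u < \<bar>v\<bar>} \<le> T" unfolding meas .
  have "((\<lambda>v. (1 + 1 / (real q * u\<^sup>2)) * ?w v) has_integral (1 + 1 / (real q * u\<^sup>2)) * I) {u<..<1}"
    using intw has_integral_Icc_iff_Ioo by (intro has_integral_mult_right) blast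
  with FTC' have "A \<le> (1 + 1 / (real q * u\<^sup>2)) * I"
    by (rule has_integral_le) (use h1 coord_weight_nonneg[of q] in \<open>simp add: mult_right_mono\<close>)
  then have "2 * A / coord_const q \<le> 2 * ((1 + 1 / (real q * u\<^sup>2)) * I) / coord_const q"
    using c by (intro divide_right_mono) auto
  then show "T \<le> (1 + 1 / (real q * u\<^sup>2)) * measure (coord_law q) {v. u < \<bar>v\<bar>}"
    unfolding meas TA by (simp add: mult_ac)
qed

text \<open>
  The tail bounds at \<open>u = sqrt (t / p)\<close>, \<open>p = q + 1\<close>, coincide in the limit because \<open>t\<close> tends to infinity.
  Their common value contains \<open>(1 - t / p) powr (q / 2)\<close>, which differs from \<open>exp (- t / 2)\<close> by a factor
  \<open>exp (O(t\<^sup>2 / p))\<close>; as \<open>t\<close> is of the order of \<open>log n\<close>, the growth condition makes this factor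
  tend to 1.
\<close>

lemma coord_tail_asymp:
  fixes q :: "nat \<Rightarrow> nat" and x :: real
  assumes growth: "filterlim (\<lambda>n. real (Suc (q n)) / (ln (real n))\<^sup>2) at_top sequentially"
  defines "t \<equiv> \<lambda>n. 4 * ln (real n) - ln (ln (real n)) + x"
  shows "(\<lambda>n. (real n)\<^sup>2 * measure (coord_law (q n)) {v. t n < real (Suc (q n)) * v\<^sup>2})
    \<longlonglongrightarrow> 2 * ((8 * pi) powr (- 1 / 2) * exp (- x / 2))"
proof -
  define p where "p n = real (Suc (q n))" for n
  have p_pos: "p n > 0" for n by (simp add: p_def)
  have g: "filterlim (\<lambda>n. p n / (ln (real n))\<^sup>2) at_top sequentially" using growth by (simp add: p_def)
  have t_top: "filterlim t at_top sequentially" unfolding t_def by real_asymp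
  have t_ln: "(\<lambda>n. (t n / ln (real n))\<^sup>2) \<longlonglongrightarrow> 16" unfolding t_def by real_asymp
  have ln_p: "(\<lambda>n. (ln (real n))\<^sup>2 / p n) \<longlonglongrightarrow> 0"
    using tendsto_inverse_0_at_top[OF g] by (simp add: inverse_eq_divide)
  have ln_pos: "eventually (\<lambda>n. ln (real n) > 0) sequentially" by real_asymp
  have t2p: "(\<lambda>n. (t n)\<^sup>2 / p n) \<longlonglongrightarrow> 0"
  proof -
    have "(\<lambda>n. (t n / ln (real n))\<^sup>2 * ((ln (real n))\<^sup>2 / p n)) \<longlonglongrightarrow> 16 * 0"
      by (intro tendsto_mult t_ln ln_p)
    then have "(\<lambda>n. (t n / ln (real n))\<^sup>2 * ((ln (real n))\<^sup>2 / p n)) \<longlonglongrightarrow> 0" by simp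
    moreover have "eventually (\<lambda>n. (t n / ln (real n))\<^sup>2 * ((ln (real n))\<^sup>2 / p n) = (t n)\<^sup>2 / p n) sequentially"
      using ln_pos by eventually_elim (simp add: power_divide)
    ultimately show ?thesis by (rule Lim_transform_eventually)
  qed
  have t1: "eventually (\<lambda>n. t n \<ge> 1) sequentially"
    by (rule filterlim_at_top[THEN iffD1, rule_format, OF t_top])
  have p_top: "filterlim p at_top sequentially"
  proof (rule filterlim_at_top_mono[OF g])
    have "eventually (\<lambda>n. (ln (real n))\<^sup>2 \<ge> 1) sequentially" by real_asymp
    then show "eventually (\<lambda>n. p n / (ln (real n))\<^sup>2 \<le> p n) sequentially"
    proof eventually_elim
      case (elim n)
      then have "p n / (ln (real n))\<^sup>2 \<le> p n / 1" using p_pos[of n] by (intro divide_left_mono) auto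
      then show ?case by simp
    qed
  qed
  define z where "z n = t n / p n" for n
  have z0: "z \<longlonglongrightarrow> 0"
  proof (rule tendsto_sandwich[OF _ _ tendsto_const t2p])
    show "eventually (\<lambda>n. 0 \<le> z n) sequentially"
      using t1 by eventually_elim (use p_pos in \<open>simp add: z_def less_imp_le\<close>)
    show "eventually (\<lambda>n. z n \<le> (t n)\<^sup>2 / p n) sequentially"
      using t1 by eventually_elim
        (use p_pos in \<open>auto simp: z_def power2_eq_square less_imp_le intro!: divide_right_mono\<close>)
  qed
  have z_half: "eventually (\<lambda>n. 0 < z n \<and> z n \<le> 1 / 2) sequentially"
  proof -
    have "eventually (\<lambda>n. z n < 1 / 2) sequentially" using z0 by (rule order_tendstoD) simp
    then show ?thesis using t1
      by eventually_elim (use p_pos in \<open>auto simp: z_def intro!: divide_pos_pos\<close>)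
  qed
  have corr: "(\<lambda>n. (1 - z n) powr (real (q n) / 2) * exp (t n / 2)) \<longlonglongrightarrow> 1"
  proof -
    have a: "(\<lambda>n. p n / 2 * (ln (1 - z n) + z n)) \<longlonglongrightarrow> 0"
    proof (rule tendsto_rabs_zero_cancel, rule tendsto_sandwich[OF _ _ tendsto_const t2p])
      show "eventually (\<lambda>n. 0 \<le> \<bar>p n / 2 * (ln (1 - z n) + z n)\<bar>) sequentially" by simp
      show "eventually (\<lambda>n. \<bar>p n / 2 * (ln (1 - z n) + z n)\<bar> \<le> (t n)\<^sup>2 / p n) sequentially"
        using z_half
      proof eventually_elim
        case (elim n)
        then have "\<bar>ln (1 + (- z n)) - (- z n)\<bar> \<le> 2 * (- z n)\<^sup>2"
          by (intro abs_ln_one_plus_x_minus_x_bound) auto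
        then have "p n / 2 * \<bar>ln (1 - z n) + z n\<bar> \<le> p n / 2 * (2 * (z n)\<^sup>2)"
          using p_pos[of n] by (intro mult_left_mono) auto
        also have "\<dots> = (t n)\<^sup>2 / p n"
          using p_pos[of n] by (simp add: z_def power_divide power2_eq_square)
        finally show ?case using p_pos[of n] by (simp add: abs_mult)
      qed
    qed
    have b: "(\<lambda>n. ln (1 - z n)) \<longlonglongrightarrow> ln (1 - 0)"
      by (intro tendsto_intros z0) simp
    have "(\<lambda>n. exp (p n / 2 * (ln (1 - z n) + z n) - ln (1 - z n) / 2)) \<longlonglongrightarrow> exp (0 - ln (1 - 0) / 2)"
      by (intro tendsto_exp tendsto_diff a tendsto_divide b tendsto_const) simp
    moreover have "eventually (\<lambda>n. exp (p n / 2 * (ln (1 - z n) + z n) - ln (1 - z n) / 2)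
        = (1 - z n) powr (real (q n) / 2) * exp (t n / 2)) sequentially"
      using z_half
    proof eventually_elim
      case (elim n)
      have qp: "real (q n) = p n - 1" by (simp add: p_def)
      have zp: "p n * z n = t n" using p_pos[of n] by (simp add: z_def)
      have "(1 - z n) powr (real (q n) / 2) * exp (t n / 2) = exp (real (q n) / 2 * ln (1 - z n) + t n / 2)"
        using elim by (simp add: powr_def exp_add)
      also have "real (q n) / 2 * ln (1 - z n) + t n / 2 = p n / 2 * (ln (1 - z n) + z n) - ln (1 - z n) / 2"
        unfolding qp zp[symmetric] by (simp add: field_simps)
      finally show ?case by simp
    qed
    ultimately have "(\<lambda>n. (1 - z n) powr (real (q n) / 2) * exp (t n / 2)) \<longlonglongrightarrow> exp (0 - ln (1 - 0) / 2)"
      by (rule Lim_transform_eventually)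
    then show ?thesis by simp
  qed
  have main: "(\<lambda>n. (real n)\<^sup>2 * exp (- t n / 2) / sqrt (t n)) \<longlonglongrightarrow> exp (- x / 2) / 2"
  proof -
    have "(\<lambda>n. exp (- x / 2) * sqrt (ln (real n) / t n)) \<longlonglongrightarrow> exp (- x / 2) * sqrt (1 / 4)"
      unfolding t_def by (intro tendsto_mult tendsto_const tendsto_real_sqrt) real_asymp
    moreover have "eventually (\<lambda>n. exp (- x / 2) * sqrt (ln (real n) / t n) = (real n)\<^sup>2 * exp (- t n / 2) / sqrt (t n)) sequentially"
      using ln_pos eventually_gt_at_top[of 0]
    proof eventually_elim
      case (elim n)
      have "exp (- t n / 2) = exp (- 2 * ln (real n) + ln (ln (real n)) / 2 + - x / 2)"
        by (simp add: t_def field_simps)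
      also have "\<dots> = exp (- (ln (real n) + ln (real n))) * exp (ln (sqrt (ln (real n)))) * exp (- x / 2)"
        using elim by (simp add: ln_sqrt exp_add[symmetric])
      also have "\<dots> = sqrt (ln (real n)) * exp (- x / 2) / (real n)\<^sup>2"
      proof -
        have "exp (- (ln (real n) + ln (real n))) = inverse (exp (ln (real n)) * exp (ln (real n)))"
          by (simp only: exp_minus exp_add)
        also have "\<dots> = 1 / (real n)\<^sup>2" using elim by (simp add: power2_eq_square divide_inverse)
        finally show ?thesis using elim by simp
      qed
      finally show ?case using elim by (simp add: real_sqrt_divide)
    qed
    ultimately show ?thesis by (auto intro: Lim_transform_eventually simp: real_sqrt_divide)
  qed
  have q_top: "filterlim q at_top sequentially"
  proof -
    have "filterlim (\<lambda>n. real (q n)) at_top sequentially"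
    proof (rule filterlim_at_top_mono[OF filterlim_tendsto_add_at_top[OF tendsto_const[of "-1"] p_top]])
      show "eventually (\<lambda>n. - 1 + p n \<le> real (q n)) sequentially" by (simp add: p_def)
    qed
    then show ?thesis by (rule filterlim_sequentially_iff_filterlim_real[THEN iffD2])
  qed
  have cc: "(\<lambda>n. sqrt (real (q n)) * coord_const (q n)) \<longlonglongrightarrow> sqrt (2 * pi)"
    by (rule filterlim_compose[OF coord_const_asymp q_top])
  have qp: "(\<lambda>n. real (q n) / p n) \<longlonglongrightarrow> 1"
  proof -
    have "(\<lambda>n. 1 - inverse (p n)) \<longlonglongrightarrow> 1 - 0"
      by (intro tendsto_diff tendsto_const tendsto_inverse_0_at_top p_top)
    moreover have "real (q n) / p n = 1 - inverse (p n)" for n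
      using p_pos[of n] by (simp add: p_def field_simps)
    ultimately show ?thesis by simp
  qed
  define T where "T n = (real n)\<^sup>2 * (2 * (1 - (sqrt (z n))\<^sup>2) powr (real (q n) / 2) / (real (q n) * sqrt (z n) * coord_const (q n)))" for n
  let ?L = "2 * ((8 * pi) powr (- 1 / 2) * exp (- x / 2))"
  have T_lim: "T \<longlonglongrightarrow> ?L"
  proof -
    let ?e = "\<lambda>n. 2 * ((real n)\<^sup>2 * exp (- t n / 2) / sqrt (t n)) * ((1 - z n) powr (real (q n) / 2) * exp (t n / 2))
        / (sqrt (real (q n) / p n) * (sqrt (real (q n)) * coord_const (q n)))"
    have "?e
      \<longlonglongrightarrow> 2 * (exp (- x / 2) / 2) * 1 / (sqrt 1 * sqrt (2 * pi))"
      by (intro tendsto_divide tendsto_mult tendsto_const main corr tendsto_real_sqrt qp cc) simp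
    moreover have "eventually (\<lambda>n. ?e n = T n) sequentially"
      using z_half t1
    proof eventually_elim
      case (elim n)
      have e: "exp (- t n / 2) * exp (t n / 2) = 1" by (simp flip: exp_add)
      have z2: "(sqrt (z n))\<^sup>2 = z n" using elim by simp
      have d: "sqrt (t n) * (sqrt (real (q n) / p n) * (sqrt (real (q n)) * coord_const (q n)))
          = real (q n) * sqrt (z n) * coord_const (q n)"
        unfolding z_def real_sqrt_divide by simp
      have "?e n
        = 2 * (real n)\<^sup>2 * (1 - z n) powr (real (q n) / 2) * (exp (- t n / 2) * exp (t n / 2))
        / (sqrt (t n) * (sqrt (real (q n) / p n) * (sqrt (real (q n)) * coord_const (q n))))"
        by (simp add: mult_ac)
      also have "\<dots> = T n" unfolding e d T_def z2 by simp
      finally show ?case .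
    qed
    ultimately have "T \<longlonglongrightarrow> 2 * (exp (- x / 2) / 2) * 1 / (sqrt 1 * sqrt (2 * pi))"
      by (rule Lim_transform_eventually)
    moreover have "2 * (exp (- x / 2) / 2) * 1 / (sqrt 1 * sqrt (2 * pi)) = ?L"
    proof -
      have "(8 * pi) powr (- 1 / 2) = 1 / sqrt (8 * pi)"
        by (simp add: powr_minus_divide powr_half_sqrt)
      also have "sqrt (8 * pi) = 2 * sqrt (2 * pi)"
      proof -
        have "sqrt (8 * pi) = sqrt (2\<^sup>2 * (2 * pi))" by simp
        then show ?thesis by (simp only: real_sqrt_mult real_sqrt_abs)
      qed
      finally show ?thesis by simp
    qed
    ultimately show ?thesis by simp
  qed
  define m where "m n = (real n)\<^sup>2 * measure (coord_law (q n)) {v. t n < real (Suc (q n)) * v\<^sup>2}" for n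
  have ev: "eventually (\<lambda>n. m n \<le> T n \<and> T n / (1 + 1 / (real (q n) / p n * t n)) \<le> m n) sequentially"
    using z_half t1 filterlim_at_top[THEN iffD1, rule_format, OF q_top, of 3]
  proof eventually_elim
    case (elim n)
    have s: "0 < sqrt (z n)" "sqrt (z n) < 1" using elim by auto
    have eq: "{v. t n < real (Suc (q n)) * v\<^sup>2} = {v. sqrt (z n) < \<bar>v\<bar>}"
    proof -
      have "t n < p n * v\<^sup>2 \<longleftrightarrow> z n < v\<^sup>2" for v
        using p_pos[of n] by (simp add: z_def pos_divide_less_eq mult.commute)
      also have "z n < v\<^sup>2 \<longleftrightarrow> sqrt (z n) < \<bar>v\<bar>" for v
        by (simp flip: real_sqrt_abs)
      finally show ?thesis by (simp add: p_def)
    qed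
    note b = coord_tail_bounds[OF elim(3) s]
    have z2: "(sqrt (z n))\<^sup>2 = z n" using elim by simp
    have qz: "real (q n) * z n = real (q n) / p n * t n" by (simp add: z_def)
    have pos: "1 + 1 / (real (q n) / p n * t n) > 0"
      using elim p_pos[of n] by (intro add_pos_nonneg) auto
    have "m n \<le> T n" unfolding m_def T_def eq using b(1) by (intro mult_left_mono) auto
    moreover have "T n \<le> (1 + 1 / (real (q n) / p n * t n)) * m n"
    proof -
      have "T n \<le> (real n)\<^sup>2 * ((1 + 1 / (real (q n) * (sqrt (z n))\<^sup>2)) * measure (coord_law (q n)) {v. sqrt (z n) < \<bar>v\<bar>})"
        unfolding T_def using b(2) by (intro mult_left_mono) auto
      then show ?thesis unfolding m_def eq z2 qz by (simp add: mult_ac)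
    qed
    ultimately show ?case using pos by (simp add: pos_divide_le_eq mult.commute)
  qed
  have "(\<lambda>n. T n / (1 + 1 / (real (q n) / p n * t n))) \<longlonglongrightarrow> ?L / (1 + 0)"
  proof (intro tendsto_divide T_lim tendsto_add tendsto_const)
    have "filterlim (\<lambda>n. real (q n) / p n * t n) at_top sequentially"
      by (rule filterlim_tendsto_pos_mult_at_top[OF qp _ t_top]) simp
    then show "(\<lambda>n. 1 / (real (q n) / p n * t n)) \<longlonglongrightarrow> 0"
      using tendsto_inverse_0_at_top by (simp only: inverse_eq_divide)
  qed simp
  then have lo: "(\<lambda>n. T n / (1 + 1 / (real (q n) / p n * t n))) \<longlonglongrightarrow> ?L" by simp
  have "m \<longlonglongrightarrow> ?L"
    by (rule tendsto_sandwich[OF _ _ lo T_lim]; rule eventually_mono[OF ev]; simp)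
  then show ?thesis unfolding m_def[abs_def] .
qed

section \<open>Rotation averaging\<close>

lemma reflection_between:
  assumes "x \<in> unit_sphere p" "y \<in> unit_sphere p" "x \<noteq> y"
  obtains v where "vinner p v v \<noteq> 0" "vrefl p v x = y"
proof -
  have "vinner p x x = vinner p y y" using assms by (simp add: vinner_self unit_sphere_def)
  then show thesis using assms vrefl_swap[of x p y] that by (auto simp: unit_sphere_def)
qed

text \<open>
  A reflection takes the last unit vector to \<open>y\<close> and preserves the uniform distribution.
\<close>

lemma distr_vinner_sphere:
  assumes y: "y \<in> unit_sphere (Suc q)"
  shows "distr (uniform_sphere (Suc q)) borel (vinner (Suc q) y) = coord_law q"
proof -
  let ?p = "Suc q" and ?S = "uniform_sphere (Suc q)"
  define e where "e = (\<lambda>k\<in>{..<?p}. if k = q then 1 else 0 :: real)"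
  have e: "e \<in> unit_sphere ?p"
    by (auto simp: unit_sphere_def e_def L2_set_def if_distrib cong: if_cong)
  have ve: "vinner ?p e x = x q" for x
    by (simp add: vinner_def e_def if_distrib cong: if_cong)
  have vm: "vinner ?p z \<in> borel_measurable ?S" for z
    by (rule vinner_measurable_sphere_const[OF measurable_ident_sets[OF refl]])
  have base: "distr ?S borel (vinner ?p e) = coord_law q"
    unfolding ve[abs_def] coord_law_def ..
  show ?thesis
  proof (cases "e = y")
    case False
    obtain v where v: "vinner ?p v v \<noteq> 0" "vrefl ?p v e = y"
      using reflection_between[OF e y False] .
    have "distr ?S borel (vinner ?p y) = distr (distr ?S ?S (vrefl ?p v)) borel (vinner ?p y)"
      using v by (simp add: distr_uniform_sphere_vrefl)
    also have "\<dots> = distr ?S borel (vinner ?p y \<circ> vrefl ?p v)"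
      using v(1) by (intro distr_distr vm vrefl_measurable_sphere)
    also have "vinner ?p y \<circ> vrefl ?p v = vinner ?p e"
      using vinner_vrefl[OF v(1), of e] by (simp add: fun_eq_iff v(2))
    finally show ?thesis using base by simp
  qed (use base in simp)
qed

definition sphere_mgf :: "nat \<Rightarrow> real \<Rightarrow> real" where
  "sphere_mgf q s = (LINT u|coord_law q. exp (s * u))"

lemma nn_integral_exp_coord_law:
  assumes "q \<ge> 2"
  shows "(\<integral>\<^sup>+u. ennreal (exp (s * u)) \<partial>coord_law q) = ennreal (sphere_mgf q s)"
proof -
  interpret prob_space "coord_law q" by (rule prob_space_coord_law)
  have sc: "sets (coord_law q) = sets borel" by (simp add: coord_law_def)
  have "AE u in coord_law q. norm (exp (s * u)) \<le> exp \<bar>s\<bar>"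
    using AE_coord_law_bounded[OF assms]
  proof eventually_elim
    case (elim u)
    have "s * u \<le> \<bar>s\<bar> * \<bar>u\<bar>" by (metis abs_ge_self abs_mult)
    also have "\<dots> \<le> \<bar>s\<bar> * 1" using elim by (intro mult_left_mono) auto
    finally show ?case by simp
  qed
  then have "integrable (coord_law q) (\<lambda>u. exp (s * u))"
    by (rule integrable_const_bound) (simp add: measurable_cong_sets[OF sc refl])
  then show ?thesis unfolding sphere_mgf_def
    by (intro nn_integral_eq_integral) auto
qed

lemma sphere_mgf_measurable [measurable]: "sphere_mgf q \<in> borel_measurable borel"
proof -
  interpret prob_space "coord_law q" by (rule prob_space_coord_law)
  have [measurable_cong]: "sets (coord_law q) = sets borel" by (simp add: coord_law_def)
  show ?thesis unfolding sphere_mgf_def[abs_def] by measurable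
qed

lemma sphere_mgf_nonneg: "sphere_mgf q s \<ge> 0"
  unfolding sphere_mgf_def by (intro integral_nonneg_AE AE_I2) simp

lemma sphere_mgf_zero: "sphere_mgf q 0 = 1"
proof -
  interpret prob_space "coord_law q" by (rule prob_space_coord_law)
  show ?thesis by (simp add: sphere_mgf_def prob_space)
qed

lemma nn_integral_exp_vinner:
  assumes q: "q \<ge> 2" and a: "a \<in> {..<Suc q} \<rightarrow>\<^sub>E UNIV"
  shows "(\<integral>\<^sup>+x. ennreal (exp (s * vinner (Suc q) a x)) \<partial>uniform_sphere (Suc q))
    = ennreal (sphere_mgf q (s * L2_set a {..<Suc q}))"
proof -
  let ?p = "Suc q" and ?S = "uniform_sphere (Suc q)"
  interpret S: prob_space ?S by (rule prob_space_uniform_sphere) simp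
  let ?n = "L2_set a {..<?p}"
  show ?thesis
  proof (cases "?n = 0")
    case True
    then have "\<And>k. k < ?p \<Longrightarrow> a k = 0" by (auto simp: L2_set_eq_0_iff)
    then have "vinner ?p a x = 0" for x by (simp add: vinner_def)
    then show ?thesis using True S.emeasure_space_1 by (simp add: sphere_mgf_zero)
  next
    case False
    define y where "y = (\<lambda>k\<in>{..<?p}. a k / ?n)"
    have n: "?n > 0" using False L2_set_nonneg[of a "{..<?p}"] by linarith
    have "L2_set y {..<?p} = L2_set (\<lambda>k. (1 / ?n) * a k) {..<?p}"
      unfolding y_def by (intro L2_set_cong) auto
    also have "\<dots> = (1 / ?n) * ?n" using n by (intro L2_set_right_distrib[symmetric]) auto
    also have "\<dots> = 1" using False by (simp del: L2_set_eq_0_iff)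
    finally have y: "y \<in> unit_sphere ?p"
      by (simp add: unit_sphere_def) (simp add: y_def)
    have ay: "vinner ?p a x = ?n * vinner ?p y x" for x
      unfolding vinner_def sum_distrib_left using False
      by (intro sum.cong refl) (auto simp: y_def)
    have vm: "vinner ?p y \<in> borel_measurable ?S"
      by (rule vinner_measurable_sphere_const[OF measurable_ident_sets[OF refl]])
    have "(\<integral>\<^sup>+x. ennreal (exp (s * vinner ?p a x)) \<partial>?S)
        = (\<integral>\<^sup>+x. ennreal (exp (s * ?n * vinner ?p y x)) \<partial>?S)"
      unfolding ay by (simp only: mult.assoc)
    also have "\<dots> = (\<integral>\<^sup>+u. ennreal (exp (s * ?n * u)) \<partial>distr ?S borel (vinner ?p y))"
      by (rule nn_integral_distr[symmetric, OF vm]) auto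
    also have "\<dots> = ennreal (sphere_mgf q (s * ?n))"
      unfolding distr_vinner_sphere[OF y] by (rule nn_integral_exp_coord_law[OF q])
    finally show ?thesis .
  qed
qed

lemma sphere_mgf_bounds:
  assumes "q \<ge> 3"
  shows "sphere_mgf q s \<le> exp (s\<^sup>2 / (2 * real (Suc q)))"
    and "exp (s\<^sup>2 / (2 * real (Suc q))) * (1 - (s\<^sup>2 / (2 * real (Suc q)))\<^sup>2 / real (Suc q)) \<le> sphere_mgf q s"
  unfolding sphere_mgf_def by (rule coord_mgf_bounds[OF assms])+

lemma FvML_eq:
  assumes q: "q \<ge> 2" and mu: "\<mu> \<in> unit_sphere (Suc q)"
  shows "FvML (Suc q) \<kappa> \<mu> = density (uniform_sphere (Suc q))
    (\<lambda>x. ennreal (exp (\<kappa> * vinner (Suc q) \<mu> x) / sphere_mgf q \<kappa>))"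
    and "sphere_mgf q \<kappa> > 0"
proof -
  let ?p = "Suc q" and ?S = "uniform_sphere (Suc q)"
  have vm: "vinner ?p \<mu> \<in> borel_measurable ?S"
    by (rule vinner_measurable_sphere_const[OF measurable_ident_sets[OF refl]])
  have "(LINT x|?S. exp (\<kappa> * vinner ?p \<mu> x)) = (LINT u|distr ?S borel (vinner ?p \<mu>). exp (\<kappa> * u))"
    by (rule integral_distr[symmetric, OF vm]) auto
  also have "\<dots> = sphere_mgf q \<kappa>"
    unfolding distr_vinner_sphere[OF mu] sphere_mgf_def ..
  finally have Z: "(LINT x|?S. exp (\<kappa> * vinner ?p \<mu> x)) = sphere_mgf q \<kappa>" .
  show "FvML (Suc q) \<kappa> \<mu> = density ?S (\<lambda>x. ennreal (exp (\<kappa> * vinner ?p \<mu> x) / sphere_mgf q \<kappa>))"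
    unfolding FvML_def Z ..
  interpret prob_space "coord_law q" by (rule prob_space_coord_law)
  note sphere_mgf_nonneg[of q \<kappa>]
  moreover have "sphere_mgf q \<kappa> \<noteq> 0"
  proof
    assume "sphere_mgf q \<kappa> = 0"
    then have "(\<integral>\<^sup>+u. ennreal (exp (\<kappa> * u)) \<partial>coord_law q) = 0"
      using nn_integral_exp_coord_law[OF q] by simp
    then have "AE u in coord_law q. ennreal (exp (\<kappa> * u)) = 0"
      by (subst (asm) nn_integral_0_iff_AE) (auto simp: coord_law_def)
    then have "AE u in coord_law q. False" by simp
    then show False by simp
  qed
  ultimately show "sphere_mgf q \<kappa> > 0" by simp
qed

lemma PiM_density:
  fixes M :: "'i \<Rightarrow> 'a measure" and f :: "'i \<Rightarrow> 'a \<Rightarrow> ennreal"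
  assumes J: "finite J" and M: "\<And>i. sigma_finite_measure (M i)" "\<And>i. sigma_finite_measure (density (M i) (f i))"
    and f [measurable]: "\<And>i. f i \<in> borel_measurable (M i)"
  shows "PiM J (\<lambda>i. density (M i) (f i)) = density (PiM J M) (\<lambda>x. \<Prod>i\<in>J. f i (x i))"
proof -
  interpret D: product_sigma_finite "\<lambda>i. density (M i) (f i)" by (simp add: product_sigma_finite_def M)
  interpret M: product_sigma_finite M by (simp add: product_sigma_finite_def M)
  have pm: "(\<lambda>x. \<Prod>i\<in>J. f i (x i)) \<in> borel_measurable (PiM J M)"
  proof (rule borel_measurable_prod_ennreal)
    fix i assume "i \<in> J"
    then have "(\<lambda>x. x i) \<in> PiM J M \<rightarrow>\<^sub>M M i" by (rule measurable_component_singleton)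
    from measurable_compose[OF this f] show "(\<lambda>x. f i (x i)) \<in> borel_measurable (PiM J M)" .
  qed
  have "density (PiM J M) (\<lambda>x. \<Prod>i\<in>J. f i (x i)) = PiM J (\<lambda>i. density (M i) (f i))"
  proof (rule D.PiM_eqI[OF J])
    show "sets (density (PiM J M) (\<lambda>x. \<Prod>i\<in>J. f i (x i))) = sets (PiM J (\<lambda>i. density (M i) (f i)))"
      by (simp cong: sets_PiM_cong)
    fix A assume "\<And>i. i \<in> J \<Longrightarrow> A i \<in> sets (density (M i) (f i))"
    then have A: "A i \<in> sets (M i)" if "i \<in> J" for i using that by simp
    then have PA: "Pi\<^sub>E J A \<in> sets (PiM J M)" using J by (intro sets_PiM_I_finite)
    have "emeasure (density (PiM J M) (\<lambda>x. \<Prod>i\<in>J. f i (x i))) (Pi\<^sub>E J A)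
        = (\<integral>\<^sup>+x. (\<Prod>i\<in>J. f i (x i)) * indicator (Pi\<^sub>E J A) x \<partial>PiM J M)"
      by (rule emeasure_density[OF pm PA])
    also have "\<dots> = (\<integral>\<^sup>+x. (\<Prod>i\<in>J. f i (x i) * indicator (A i) (x i)) \<partial>PiM J M)"
    proof (rule nn_integral_cong)
      fix x assume "x \<in> space (PiM J M)"
      then have "indicator (Pi\<^sub>E J A) x = (\<Prod>i\<in>J. indicator (A i) (x i) :: ennreal)"
        using J by (auto simp: space_PiM PiE_iff indicator_def prod_zero_iff intro!: prod.neutral)
      then show "(\<Prod>i\<in>J. f i (x i)) * indicator (Pi\<^sub>E J A) x = (\<Prod>i\<in>J. f i (x i) * indicator (A i) (x i))"
        by (simp add: prod.distrib)
    qed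
    also have "\<dots> = (\<Prod>i\<in>J. \<integral>\<^sup>+x. f i x * indicator (A i) x \<partial>M i)"
      using A by (intro M.product_nn_integral_prod J) auto
    also have "\<dots> = (\<Prod>i\<in>J. emeasure (density (M i) (f i)) (A i))"
      using A by (intro prod.cong refl emeasure_density[symmetric]) auto
    finally show "emeasure (density (PiM J M) (\<lambda>x. \<Prod>i\<in>J. f i (x i))) (Pi\<^sub>E J A)
        = (\<Prod>i\<in>J. emeasure (density (M i) (f i)) (A i))" .
  qed
  then show ?thesis by simp
qed

definition sphere_sample :: "nat \<Rightarrow> 'i set \<Rightarrow> ('i \<Rightarrow> nat \<Rightarrow> real) measure" where
  "sphere_sample p J = PiM J (\<lambda>_. uniform_sphere p)"

text \<open>
  Invariance under simultaneous reflections of all points is enough, since reflections act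
  transitively on the sphere.
\<close>

definition rotation_invariant :: "nat \<Rightarrow> 'i set \<Rightarrow> ('i \<Rightarrow> nat \<Rightarrow> real) set \<Rightarrow> bool" where
  "rotation_invariant p J A \<longleftrightarrow> A \<in> sets (sphere_sample p J) \<and>
    (\<forall>v x. vinner p v v \<noteq> 0 \<longrightarrow> x \<in> space (sphere_sample p J) \<longrightarrow> (compose J (vrefl p v) x \<in> A \<longleftrightarrow> x \<in> A))"

text \<open>
  The sum of the off-diagonal entries of the Gram matrix, hence the excess of
  \<open>|\<Sum>i\<in>J. x i|\<^sup>2\<close> over the number of points.
\<close>

definition off_diag :: "nat \<Rightarrow> 'i set \<Rightarrow> ('i \<Rightarrow> nat \<Rightarrow> real) \<Rightarrow> real" where
  "off_diag p J x = (\<Sum>(i, j) \<in> {(i, j) \<in> J \<times> J. i \<noteq> j}. vinner p (x i) (x j))"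

lemma prob_space_sphere_sample: "p > 0 \<Longrightarrow> prob_space (sphere_sample p J)"
  unfolding sphere_sample_def by (intro prob_space_PiM prob_space_uniform_sphere)

lemma sphere_sample_component [measurable (raw)]:
  "i \<in> J \<Longrightarrow> (\<lambda>x. x i) \<in> sphere_sample p J \<rightarrow>\<^sub>M uniform_sphere p"
  unfolding sphere_sample_def by (rule measurable_component_singleton)

lemma sphere_sample_vinner:
  "i \<in> J \<Longrightarrow> j \<in> J \<Longrightarrow> (\<lambda>x. vinner p (x i) (x j)) \<in> borel_measurable (sphere_sample p J)"
  by (intro vinner_measurable_sphere sphere_sample_component)

lemma off_diag_measurable [measurable]: "off_diag p J \<in> borel_measurable (sphere_sample p J)"
  unfolding off_diag_def[abs_def]
  by (intro borel_measurable_sum) (auto intro!: sphere_sample_vinner)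

lemma space_sphere_sample: "space (sphere_sample p J) = J \<rightarrow>\<^sub>E unit_sphere p"
  by (simp add: sphere_sample_def space_PiM)

lemma distr_sphere_sample_vrefl:
  assumes "finite J" "p > 0" "vinner p v v \<noteq> 0"
  shows "distr (sphere_sample p J) (sphere_sample p J) (compose J (vrefl p v)) = sphere_sample p J"
  unfolding sphere_sample_def using assms
  by (subst distr_PiM_finite_prob_space')
     (auto simp: distr_uniform_sphere_vrefl prob_space_uniform_sphere)

lemma vinner_sum: "vinner p (\<lambda>k\<in>{..<p}. \<Sum>i\<in>J. x i k) y = (\<Sum>i\<in>J. vinner p y (x i))"
  unfolding vinner_def by (subst sum.swap) (simp add: sum_distrib_left mult.commute)

lemma vinner_sum_self:
  assumes J: "finite J" and x: "\<And>i. i \<in> J \<Longrightarrow> x i \<in> unit_sphere p"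
  defines "s \<equiv> (\<lambda>k\<in>{..<p}. \<Sum>i\<in>J. x i k)"
  shows "vinner p s s = real (card J) + off_diag p J x"
proof -
  have sv: "vinner p s y = (\<Sum>i\<in>J. vinner p y (x i))" for y
    unfolding s_def by (rule vinner_sum)
  have "vinner p s s = (\<Sum>i\<in>J. \<Sum>j\<in>J. vinner p (x i) (x j))"
    unfolding sv[of s] by (simp add: vinner_commute[of p s "x _"] sv)
  also have "\<dots> = (\<Sum>z\<in>J \<times> J. vinner p (x (fst z)) (x (snd z)))"
    by (simp add: sum.cartesian_product case_prod_unfold)
  also have "J \<times> J = {(i, j) \<in> J \<times> J. i \<noteq> j} \<union> (\<lambda>i. (i, i)) ` J" by auto
  also have "(\<Sum>z\<in>\<dots>. vinner p (x (fst z)) (x (snd z)))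
      = (\<Sum>z\<in>{(i, j) \<in> J \<times> J. i \<noteq> j}. vinner p (x (fst z)) (x (snd z)))
        + (\<Sum>z\<in>(\<lambda>i. (i, i)) ` J. vinner p (x (fst z)) (x (snd z)))"
    using J by (intro sum.union_disjoint) (auto intro: finite_subset[of _ "J \<times> J"])
  also have "(\<Sum>z\<in>{(i, j) \<in> J \<times> J. i \<noteq> j}. vinner p (x (fst z)) (x (snd z))) = off_diag p J x"
    by (simp add: off_diag_def case_prod_unfold)
  also have "(\<Sum>z\<in>(\<lambda>i. (i, i)) ` J. vinner p (x (fst z)) (x (snd z))) = (\<Sum>i\<in>J. vinner p (x i) (x i))"
    by (subst sum.reindex) (auto simp: inj_on_def)
  also have "\<dots> = real (card J)"
    using x by (simp add: vinner_self unit_sphere_def)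
  finally show ?thesis by simp
qed

text \<open>
  The density of the sample with respect to the uniform one is \<open>exp (\<kappa> * (\<Sum>i\<in>J. \<mu> \<bullet> x i)) / Z ^ card J\<close>.
  For an invariant \<open>A\<close> its integral over \<open>A\<close> does not depend on the unit vector \<open>\<mu>\<close>, so it equals
  its average over a uniform \<open>\<mu>\<close>.  Averaging inside the integral produces the moment generating
  function of one coordinate at \<open>\<kappa>\<close> times the norm of the sum of the points.
\<close>

lemma emeasure_FvML_sample:
  fixes J :: "'i set"
  assumes q: "q \<ge> 2" and mu: "\<mu> \<in> unit_sphere (Suc q)" and J: "finite J"
    and inv: "rotation_invariant (Suc q) J A"
  shows "emeasure (PiM J (\<lambda>_. FvML (Suc q) \<kappa> \<mu>)) A =
    (\<integral>\<^sup>+x. indicator A x * ennreal (sphere_mgf q (\<kappa> * sqrt (real (card J) + off_diag (Suc q) J x))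
      / sphere_mgf q \<kappa> ^ card J) \<partial>sphere_sample (Suc q) J)"
proof -
  let ?p = "Suc q" and ?S = "uniform_sphere (Suc q)"
  let ?SS = "sphere_sample ?p J"
  let ?Z = "sphere_mgf q \<kappa>"
  let ?e = "\<lambda>m x. ennreal (exp (\<kappa> * (\<Sum>i\<in>J. vinner ?p m (x i))))"
  let ?g = "\<lambda>x. sphere_mgf q (\<kappa> * sqrt (real (card J) + off_diag ?p J x))"
  interpret S: prob_space ?S by (rule prob_space_uniform_sphere) simp
  interpret SS: prob_space ?SS by (rule prob_space_sphere_sample) simp
  interpret PP: pair_prob_space ?S ?SS ..
  have Z: "?Z > 0" by (rule FvML_eq(2)[OF q mu])
  have A [measurable]: "A \<in> sets ?SS" using inv by (simp add: rotation_invariant_def)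
  have id [measurable]: "(\<lambda>x. x) \<in> ?S \<rightarrow>\<^sub>M ?S" by simp
  interpret F: prob_space "FvML ?p \<kappa> \<mu>" by (rule prob_space_FvML) simp
  have den: "PiM J (\<lambda>_. FvML ?p \<kappa> \<mu>) = density ?SS (\<lambda>x. \<Prod>i\<in>J. ennreal (exp (\<kappa> * vinner ?p \<mu> (x i)) / ?Z))"
    unfolding FvML_eq(1)[OF q mu] sphere_sample_def
  proof (rule PiM_density[OF J])
    show "sigma_finite_measure (density ?S (\<lambda>x. ennreal (exp (\<kappa> * vinner ?p \<mu> x) / ?Z)))"
      using F.sigma_finite_measure_axioms unfolding FvML_eq(1)[OF q mu] .
    show "sigma_finite_measure ?S" by (rule S.sigma_finite_measure_axioms)
  qed (use vinner_measurable_sphere_const[OF id] in measurable)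
  define K where "K m = (\<integral>\<^sup>+x. indicator A x * ?e m x \<partial>?SS)" for m
  have lin [measurable]: "(\<lambda>x. \<Sum>i\<in>J. vinner ?p m (x i)) \<in> borel_measurable ?SS" for m
    by (intro borel_measurable_sum vinner_measurable_sphere_const sphere_sample_component)
  have Km: "(\<lambda>x. indicator A x * ?e m x) \<in> borel_measurable ?SS" for m
    by measurable
  have prodm: "(\<lambda>x. \<Prod>i\<in>J. ennreal (exp (\<kappa> * vinner ?p \<mu> (x i)) / ?Z)) \<in> borel_measurable ?SS"
  proof (rule borel_measurable_prod_ennreal)
    fix i assume "i \<in> J"
    then have [measurable]: "(\<lambda>x. vinner ?p \<mu> (x i)) \<in> borel_measurable ?SS"
      by (intro vinner_measurable_sphere_const sphere_sample_component)
    show "(\<lambda>x. ennreal (exp (\<kappa> * vinner ?p \<mu> (x i)) / ?Z)) \<in> borel_measurable ?SS" by measurable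
  qed
  have eK: "emeasure (PiM J (\<lambda>_. FvML ?p \<kappa> \<mu>)) A = ennreal (1 / ?Z ^ card J) * K \<mu>"
  proof -
    have "(\<Prod>i\<in>J. ennreal (exp (\<kappa> * vinner ?p \<mu> (x i)) / ?Z))
        = ennreal (1 / ?Z ^ card J) * ?e \<mu> x" for x
    proof -
      have "(\<Prod>i\<in>J. ennreal (exp (\<kappa> * vinner ?p \<mu> (x i)) / ?Z))
          = ennreal (\<Prod>i\<in>J. exp (\<kappa> * vinner ?p \<mu> (x i)) / ?Z)"
        using Z by (intro prod_ennreal) simp
      also have "(\<Prod>i\<in>J. exp (\<kappa> * vinner ?p \<mu> (x i)) / ?Z)
          = 1 / ?Z ^ card J * exp (\<kappa> * (\<Sum>i\<in>J. vinner ?p \<mu> (x i)))"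
        using J by (simp add: prod_dividef exp_sum sum_distrib_left)
      finally show ?thesis using Z by (subst (asm) ennreal_mult) auto
    qed
    then have "emeasure (PiM J (\<lambda>_. FvML ?p \<kappa> \<mu>)) A
        = (\<integral>\<^sup>+x. ennreal (1 / ?Z ^ card J) * (indicator A x * ?e \<mu> x) \<partial>?SS)"
      unfolding den by (subst emeasure_density) (auto simp: prodm A mult_ac intro!: nn_integral_cong)
    also have "\<dots> = ennreal (1 / ?Z ^ card J) * K \<mu>"
      unfolding K_def by (rule nn_integral_cmult[OF Km])
    finally show ?thesis .
  qed
  have K_const: "K m = K \<mu>" if m: "m \<in> unit_sphere ?p" for m
  proof (cases "\<mu> = m")
    case False
    obtain v where v: "vinner ?p v v \<noteq> 0" "vrefl ?p v \<mu> = m"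
      using reflection_between[OF mu m False] .
    let ?H = "compose J (vrefl ?p v)"
    have Hm: "?H \<in> ?SS \<rightarrow>\<^sub>M ?SS"
      unfolding compose_def sphere_sample_def
    proof (rule measurable_restrict)
      fix i assume i: "i \<in> J"
      show "(\<lambda>x. vrefl ?p v (x i)) \<in> PiM J (\<lambda>_. ?S) \<rightarrow>\<^sub>M ?S"
        by (rule measurable_compose[OF sphere_sample_component[OF i, unfolded sphere_sample_def]
            vrefl_measurable_sphere[OF v(1)]])
    qed
    have "K m = (\<integral>\<^sup>+x. indicator A x * ?e m x \<partial>distr ?SS ?SS ?H)"
      unfolding K_def using v J by (simp add: distr_sphere_sample_vrefl)
    also have "\<dots> = (\<integral>\<^sup>+x. indicator A (?H x) * ?e m (?H x) \<partial>?SS)"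
      by (rule nn_integral_distr[OF Hm]) (use Km in simp)
    also have "\<dots> = K \<mu>" unfolding K_def
    proof (rule nn_integral_cong)
      fix x assume x: "x \<in> space ?SS"
      have "indicator A (?H x) = (indicator A x :: ennreal)"
        using inv v(1) x by (auto simp: rotation_invariant_def indicator_def)
      moreover have "(\<Sum>i\<in>J. vinner ?p m (?H x i)) = (\<Sum>i\<in>J. vinner ?p \<mu> (x i))"
        using vinner_vrefl[OF v(1), of \<mu>] by (intro sum.cong refl) (simp add: compose_def v(2))
      ultimately show "indicator A (?H x) * ?e m (?H x)
          = indicator A x * ?e \<mu> x" by simp
    qed
    finally show ?thesis .
  qed simp
  have "K \<mu> = (\<integral>\<^sup>+m. K \<mu> \<partial>?S)" using S.emeasure_space_1 by simp
  also have "\<dots> = (\<integral>\<^sup>+m. K m \<partial>?S)"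
    using K_const by (intro nn_integral_cong) simp
  also have "\<dots> = (\<integral>\<^sup>+x. (\<integral>\<^sup>+m. indicator A x * ?e m x \<partial>?S) \<partial>?SS)"
    unfolding K_def
  proof (rule PP.Fubini'[symmetric])
    have [measurable]: "(\<lambda>z. \<Sum>i\<in>J. vinner ?p (fst z) (snd z i)) \<in> borel_measurable (?S \<Otimes>\<^sub>M ?SS)"
    proof (intro borel_measurable_sum vinner_measurable_sphere)
      fix i assume "i \<in> J"
      show "(\<lambda>z. snd z i) \<in> ?S \<Otimes>\<^sub>M ?SS \<rightarrow>\<^sub>M ?S"
        by (rule measurable_compose[OF measurable_snd sphere_sample_component[OF \<open>i \<in> J\<close>]])
    qed simp
    show "(\<lambda>(m, x). indicator A x * ?e m x) \<in> borel_measurable (?S \<Otimes>\<^sub>M ?SS)"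
      unfolding case_prod_unfold by measurable
  qed
  also have "\<dots> = (\<integral>\<^sup>+x. indicator A x * ennreal (?g x) \<partial>?SS)"
  proof (rule nn_integral_cong)
    fix x assume "x \<in> space ?SS"
    then have x: "x i \<in> unit_sphere ?p" if "i \<in> J" for i using that by (auto simp: space_sphere_sample)
    define s where "s = (\<lambda>k\<in>{..<?p}. \<Sum>i\<in>J. x i k)"
    have sv: "(\<Sum>i\<in>J. vinner ?p m (x i)) = vinner ?p s m" for m
      unfolding s_def by (rule vinner_sum[symmetric])
    have n: "L2_set s {..<?p} = sqrt (real (card J) + off_diag ?p J x)"
      using vinner_sum_self[OF J x] by (simp add: L2_set_vinner s_def)
    have vm: "(\<lambda>m. ennreal (exp (\<kappa> * vinner ?p s m))) \<in> borel_measurable ?S"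
      using vinner_measurable_sphere_const[OF id] by measurable
    have "(\<integral>\<^sup>+m. indicator A x * ?e m x \<partial>?S)
        = indicator A x * (\<integral>\<^sup>+m. ennreal (exp (\<kappa> * vinner ?p s m)) \<partial>?S)"
      unfolding sv by (rule nn_integral_cmult[OF vm])
    also have "(\<integral>\<^sup>+m. ennreal (exp (\<kappa> * vinner ?p s m)) \<partial>?S) = ennreal (sphere_mgf q (\<kappa> * L2_set s {..<?p}))"
      by (rule nn_integral_exp_vinner[OF q]) (simp add: s_def)
    finally show "(\<integral>\<^sup>+m. indicator A x * ?e m x \<partial>?S)
        = indicator A x * ennreal (?g x)"
      unfolding n .
  qed
  finally have K: "K \<mu> = \<dots>" .
  have "(\<lambda>x. indicator A x * ennreal (?g x)) \<in> borel_measurable ?SS"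
    by measurable
  then have "emeasure (PiM J (\<lambda>_. FvML ?p \<kappa> \<mu>)) A = (\<integral>\<^sup>+x. ennreal (1 / ?Z ^ card J) *
      (indicator A x * ennreal (?g x)) \<partial>?SS)"
    unfolding eK K by (rule nn_integral_cmult[symmetric])
  also have "\<dots> = (\<integral>\<^sup>+x. indicator A x * ennreal (?g x / ?Z ^ card J) \<partial>?SS)"
  proof (rule nn_integral_cong)
    fix x
    have "ennreal (?g x / ?Z ^ card J)
        = ennreal (1 / ?Z ^ card J) * ennreal (?g x)"
      using Z sphere_mgf_nonneg by (simp flip: ennreal_mult)
    then show "ennreal (1 / ?Z ^ card J) * (indicator A x * ennreal (?g x))
        = indicator A x * ennreal (?g x / ?Z ^ card J)"
      by (simp add: mult_ac)
  qed
  finally show ?thesis .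
qed

section \<open>Comparing samples under the two laws\<close>

lemma vinner_sphere_le_1:
  assumes "x \<in> unit_sphere p" "y \<in> unit_sphere p"
  shows "\<bar>vinner p x y\<bar> \<le> 1"
proof -
  have "\<bar>vinner p x y\<bar> \<le> (\<Sum>k<p. \<bar>x k\<bar> * \<bar>y k\<bar>)"
    unfolding vinner_def by (rule order_trans[OF sum_abs]) (simp add: abs_mult)
  also have "\<dots> \<le> L2_set x {..<p} * L2_set y {..<p}" by (rule L2_set_mult_ineq)
  finally show ?thesis using assms by (simp add: unit_sphere_def)
qed

lemma card_off_diag:
  assumes "finite J" shows "card {(i, j) \<in> J \<times> J. i \<noteq> j} = card J * card J - card J"
proof -
  have "{(i, j) \<in> J \<times> J. i \<noteq> j} = J \<times> J - (\<lambda>i. (i, i)) ` J" by auto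
  also have "card \<dots> = card (J \<times> J) - card ((\<lambda>i. (i, i)) ` J)"
    using assms by (intro card_Diff_subset) auto
  finally show ?thesis by (simp add: card_image inj_on_def card_cartesian_product)
qed

lemma off_diag_bounds:
  assumes J: "finite J" and x: "x \<in> space (sphere_sample p J)"
  shows "0 \<le> real (card J) + off_diag p J x" "real (card J) + off_diag p J x \<le> (real (card J))\<^sup>2"
proof -
  have x': "x i \<in> unit_sphere p" if "i \<in> J" for i using x that by (auto simp: space_sphere_sample)
  show "0 \<le> real (card J) + off_diag p J x"
  proof -
    have "vinner p (\<lambda>k\<in>{..<p}. \<Sum>i\<in>J. x i k) (\<lambda>k\<in>{..<p}. \<Sum>i\<in>J. x i k)
        = real (card J) + off_diag p J x"
      using J x' by (rule vinner_sum_self)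
    then show ?thesis using vinner_self_nonneg by metis
  qed
  have "off_diag p J x \<le> (\<Sum>z\<in>{(i, j) \<in> J \<times> J. i \<noteq> j}. 1)"
    unfolding off_diag_def using vinner_sphere_le_1[OF x' x'] by (intro sum_mono) (auto simp: abs_le_iff)
  also have "\<dots> = real (card J * card J - card J)" using card_off_diag[OF J] by simp
  also have "\<dots> = (real (card J))\<^sup>2 - real (card J)"
    by (subst of_nat_diff) (auto simp: power2_eq_square)
  finally show "real (card J) + off_diag p J x \<le> (real (card J))\<^sup>2" by simp
qed

text \<open>
  Conditionally on the other points, \<open>x i \<bullet> x k\<close> has the law of one coordinate, whatever the value
  of \<open>x i\<close>.  This makes products along the edges of a tree independent.
\<close>

lemma nn_integral_sphere_sample_peel:
  assumes J: "finite J" "k \<notin> J" "i \<in> J"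
    and G [measurable]: "G \<in> borel_measurable (sphere_sample (Suc q) J)"
    and f [measurable]: "f \<in> borel_measurable borel"
  shows "(\<integral>\<^sup>+x. G (restrict x J) * f (vinner (Suc q) (x i) (x k)) \<partial>sphere_sample (Suc q) (insert k J))
    = (\<integral>\<^sup>+x. G x \<partial>sphere_sample (Suc q) J) * (\<integral>\<^sup>+u. f u \<partial>coord_law q)"
proof -
  let ?p = "Suc q" and ?S = "uniform_sphere (Suc q)"
  let ?h = "\<lambda>x y. G (restrict (x(k := y)) J) * f (vinner ?p ((x(k := y)) i) ((x(k := y)) k))"
  interpret S: prob_space ?S by (rule prob_space_uniform_sphere) simp
  interpret product_sigma_finite "\<lambda>_. ?S" by (simp add: product_sigma_finite_def S.sigma_finite_measure_axioms)
  have vm: "vinner ?p y \<in> borel_measurable ?S" for y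
    by (rule vinner_measurable_sphere_const[OF measurable_ident_sets[OF refl]])
  have [measurable]: "(\<lambda>x. restrict x J) \<in> PiM (insert k J) (\<lambda>_. ?S) \<rightarrow>\<^sub>M PiM J (\<lambda>_. ?S)"
    by (rule measurable_restrict_subset) auto
  have G' [measurable]: "G \<in> borel_measurable (PiM J (\<lambda>_. ?S))" using G unfolding sphere_sample_def .
  have [measurable]: "(\<lambda>x. vinner ?p (x i) (x k)) \<in> borel_measurable (PiM (insert k J) (\<lambda>_. ?S))"
    using J by (intro vinner_measurable_sphere measurable_component_singleton) auto
  have "(\<integral>\<^sup>+x. G (restrict x J) * f (vinner ?p (x i) (x k)) \<partial>PiM (insert k J) (\<lambda>_. ?S))
      = (\<integral>\<^sup>+x. (\<integral>\<^sup>+y. ?h x y \<partial>?S) \<partial>PiM J (\<lambda>_. ?S))"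
    by (rule product_nn_integral_insert[OF J(1,2)]) measurable
  also have "\<dots> = (\<integral>\<^sup>+x. G x * (\<integral>\<^sup>+u. f u \<partial>coord_law q) \<partial>PiM J (\<lambda>_. ?S))"
  proof (rule nn_integral_cong)
    fix x assume x: "x \<in> space (PiM J (\<lambda>_. ?S))"
    then have xi: "x i \<in> unit_sphere ?p" using J by (auto simp: space_PiM)
    have r: "restrict (x(k := y)) J = x" for y
      using x J by (auto simp: space_PiM PiE_iff extensional_def fun_eq_iff)
    have ik: "i \<noteq> k" using J by auto
    have "(\<integral>\<^sup>+y. ?h x y \<partial>?S)
        = (\<integral>\<^sup>+y. G x * f (vinner ?p (x i) y) \<partial>?S)"
      using ik by (simp add: r)
    also have "\<dots> = G x * (\<integral>\<^sup>+y. f (vinner ?p (x i) y) \<partial>?S)"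
      by (rule nn_integral_cmult) (rule measurable_compose[OF vm f])
    also have "(\<integral>\<^sup>+y. f (vinner ?p (x i) y) \<partial>?S) = (\<integral>\<^sup>+u. f u \<partial>distr ?S borel (vinner ?p (x i)))"
      by (rule nn_integral_distr[symmetric, OF vm]) simp
    finally show "(\<integral>\<^sup>+y. ?h x y \<partial>?S)
        = G x * (\<integral>\<^sup>+u. f u \<partial>coord_law q)"
      unfolding distr_vinner_sphere[OF xi] .
  qed
  also have "\<dots> = (\<integral>\<^sup>+x. G x \<partial>PiM J (\<lambda>_. ?S)) * (\<integral>\<^sup>+u. f u \<partial>coord_law q)"
    by (rule nn_integral_multc[OF G'])
  finally show ?thesis unfolding sphere_sample_def .
qed

lemma nn_integral_sphere_sample_pair:
  assumes J: "finite J" "i \<in> J" "j \<in> J" "i \<noteq> j" and f [measurable]: "f \<in> borel_measurable borel"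
  shows "(\<integral>\<^sup>+x. f (vinner (Suc q) (x i) (x j)) \<partial>sphere_sample (Suc q) J) = (\<integral>\<^sup>+u. f u \<partial>coord_law q)"
proof -
  interpret prob_space "sphere_sample (Suc q) (J - {j})" by (rule prob_space_sphere_sample) simp
  have "insert j (J - {j}) = J" using J by auto
  then show ?thesis
    using nn_integral_sphere_sample_peel[of "J - {j}" j i "\<lambda>_. 1" q f] J emeasure_space_1 by simp
qed

text \<open>
  The products of different pairs need not be jointly independent.  The convexity of \<open>exp\<close> bounds the exponential
  of their sum by the average over the \<open>N\<close> ordered pairs of \<open>exp (c * N * (x i \<bullet> x j))\<close>.
\<close>

lemma nn_integral_exp_off_diag:
  assumes q: "q \<ge> 3" and J: "finite J" "card J \<ge> 2"
  defines "N \<equiv> real (card J * card J - card J)"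
  shows "(\<integral>\<^sup>+x. ennreal (exp (c * off_diag (Suc q) J x)) \<partial>sphere_sample (Suc q) J)
    \<le> ennreal (exp ((c * N)\<^sup>2 / (2 * real (Suc q))))"
proof -
  let ?p = "Suc q" and ?SS = "sphere_sample (Suc q) J"
  let ?e = "\<lambda>z x. ennreal (exp (c * N * vinner ?p (x (fst z)) (x (snd z))))"
  define D where "D = {(i, j) \<in> J \<times> J. i \<noteq> j}"
  have D: "finite D" unfolding D_def using J(1) by (auto intro: finite_subset[of _ "J \<times> J"])
  have cD: "real (card D) = N" unfolding D_def N_def card_off_diag[OF J(1)] ..
  have N: "N > 0"
  proof -
    have "card J * 1 < card J * card J" using J(2) by (intro mult_strict_left_mono) auto
    then show ?thesis by (simp add: N_def)
  qed
  then have Dne: "D \<noteq> {}" using cD by auto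
  have am: "exp (c * off_diag ?p J x) \<le> (\<Sum>z\<in>D. (1 / N) * exp (c * N * vinner ?p (x (fst z)) (x (snd z))))" for x
  proof -
    have "exp (\<Sum>z\<in>D. (1 / N) *\<^sub>R (c * N * vinner ?p (x (fst z)) (x (snd z))))
        \<le> (\<Sum>z\<in>D. (1 / N) * exp (c * N * vinner ?p (x (fst z)) (x (snd z))))"
      using N cD by (intro convex_on_sum[OF D Dne exp_convex]) auto
    moreover have "(\<Sum>z\<in>D. (1 / N) *\<^sub>R (c * N * vinner ?p (x (fst z)) (x (snd z)))) = c * off_diag ?p J x"
      using N unfolding off_diag_def D_def[symmetric] sum_distrib_left
      by (intro sum.cong refl) (auto simp: case_prod_unfold)
    ultimately show ?thesis by simp
  qed
  have vm: "(\<lambda>x. ?e z x) \<in> borel_measurable ?SS" if "z \<in> D" for z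
  proof -
    have [measurable]: "(\<lambda>x. vinner ?p (x (fst z)) (x (snd z))) \<in> borel_measurable ?SS"
      using that by (intro sphere_sample_vinner) (auto simp: D_def)
    show ?thesis by measurable
  qed
  have "(\<integral>\<^sup>+x. ennreal (exp (c * off_diag ?p J x)) \<partial>?SS)
      \<le> (\<integral>\<^sup>+x. (\<Sum>z\<in>D. ennreal (1 / N) * ?e z x) \<partial>?SS)"
  proof (rule nn_integral_mono)
    fix x
    have "(\<Sum>z\<in>D. ennreal (1 / N) * ?e z x)
        = (\<Sum>z\<in>D. ennreal ((1 / N) * exp (c * N * vinner ?p (x (fst z)) (x (snd z)))))"
      using N by (intro sum.cong refl ennreal_mult[symmetric]) auto
    also have "\<dots> = ennreal (\<Sum>z\<in>D. (1 / N) * exp (c * N * vinner ?p (x (fst z)) (x (snd z))))"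
      using N by (intro sum_ennreal) simp
    finally show "ennreal (exp (c * off_diag ?p J x)) \<le> (\<Sum>z\<in>D. ennreal (1 / N) * ?e z x)"
      using am[of x] by (simp add: ennreal_leI)
  qed
  also have "\<dots> = (\<Sum>z\<in>D. (\<integral>\<^sup>+x. ennreal (1 / N) * ?e z x \<partial>?SS))"
    by (intro nn_integral_sum borel_measurable_times_ennreal vm) auto
  also have "\<dots> = (\<Sum>z\<in>D. ennreal (1 / N) * ennreal (sphere_mgf q (c * N)))"
  proof (rule sum.cong[OF refl])
    fix z assume z: "z \<in> D"
    have "(\<integral>\<^sup>+x. ennreal (1 / N) * ?e z x \<partial>?SS)
        = ennreal (1 / N) * (\<integral>\<^sup>+x. ?e z x \<partial>?SS)"
      by (rule nn_integral_cmult[OF vm[OF z]])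
    also have "(\<integral>\<^sup>+x. ?e z x \<partial>?SS)
        = (\<integral>\<^sup>+u. ennreal (exp (c * N * u)) \<partial>coord_law q)"
      using z J(1) by (intro nn_integral_sphere_sample_pair[where f = "\<lambda>u. ennreal (exp (c * N * u))"]) (auto simp: D_def)
    also have "\<dots> = ennreal (sphere_mgf q (c * N))" using q by (intro nn_integral_exp_coord_law) auto
    finally show "(\<integral>\<^sup>+x. ennreal (1 / N) * ?e z x \<partial>?SS)
        = ennreal (1 / N) * ennreal (sphere_mgf q (c * N))" .
  qed
  also have "\<dots> = ennreal (N * (1 / N * sphere_mgf q (c * N)))"
    using N cD sphere_mgf_nonneg[of q] by (simp add: ennreal_mult[symmetric] ennreal_of_nat_eq_real_of_nat)
  also have "N * (1 / N * sphere_mgf q (c * N)) = sphere_mgf q (c * N)" using N by simp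
  also have "ennreal (sphere_mgf q (c * N)) \<le> ennreal (exp ((c * N)\<^sup>2 / (2 * real ?p)))"
    using sphere_mgf_bounds(1)[OF q] by (rule ennreal_leI)
  finally show ?thesis .
qed

text \<open>
  On invariant sets the density of the FvML sample lies between \<open>(1 - \<eta> k ^ 4) * exp V\<close> and
  \<open>exp V / (1 - \<eta>) ^ k\<close>, where \<open>V = \<kappa>\<^sup>2 / (2 p) * off_diag\<close> and \<open>p = q + 1\<close>: the moment
  generating function is evaluated at \<open>\<kappa> * sqrt s\<close> with \<open>s = 1\<close> in the denominator and
  \<open>0 \<le> s \<le> k\<^sup>2\<close> in the numerator, and its relative error is at most \<open>\<eta> s\<^sup>2\<close>.  Where \<open>\<bar>V\<bar> \<le> \<delta>\<close> the
  factor \<open>exp V\<close> is between \<open>exp (- \<delta>)\<close> and \<open>exp \<delta>\<close>.  Elsewhere an exponential Markov inequality with the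
  free parameter \<open>m\<close> is used, and \<open>b\<close> bounds the expectations of \<open>exp (m * V)\<close> and \<open>exp (- m * V)\<close>.
\<close>

lemma FvML_sample_comparison:
  fixes J :: "'i set" and \<kappa> \<delta> m :: real
  assumes q: "q \<ge> 3" and mu: "\<mu> \<in> unit_sphere (Suc q)" and J: "finite J" "card J \<ge> 2"
    and inv: "rotation_invariant (Suc q) J A" and \<delta>: "\<delta> > 0" and m: "m \<ge> 1"
  defines "\<eta> \<equiv> \<kappa> ^ 4 / (4 * real (Suc q) ^ 3)" and "k \<equiv> real (card J)"
  defines "b \<equiv> exp (m\<^sup>2 * (k\<^sup>2 - k)\<^sup>2 * \<eta> / 2)"
  assumes small: "\<eta> * k ^ 4 < 1"
  shows "measure (PiM J (\<lambda>_. FvML (Suc q) \<kappa> \<mu>)) A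
      \<le> (exp \<delta> * measure (sphere_sample (Suc q) J) A + exp (- ((m - 1) * \<delta>)) * b) / (1 - \<eta>) ^ card J"
    and "(1 - \<eta> * k ^ 4) * (exp (- \<delta>) * measure (sphere_sample (Suc q) J) A - exp (- (m * \<delta>)) * b)
      \<le> measure (PiM J (\<lambda>_. FvML (Suc q) \<kappa> \<mu>)) A"
proof -
  let ?p = "Suc q" and ?SS = "sphere_sample (Suc q) J" and ?F = "PiM J (\<lambda>_. FvML (Suc q) \<kappa> \<mu>)"
  let ?P = "real (Suc q)"
  interpret SS: prob_space ?SS by (rule prob_space_sphere_sample) simp
  interpret F: prob_space ?F by (intro prob_space_PiM prob_space_FvML) simp
  have A [measurable]: "A \<in> sets ?SS" using inv by (simp add: rotation_invariant_def)
  have k: "k \<ge> 2" using J by (simp add: k_def)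
  have k4: "k ^ 4 \<ge> 1" using k by (intro one_le_power) auto
  have \<eta>0: "\<eta> \<ge> 0" by (simp add: \<eta>_def)
  have \<eta>1: "\<eta> < 1"
  proof -
    have "\<eta> * 1 \<le> \<eta> * k ^ 4" using \<eta>0 k4 by (intro mult_left_mono) auto
    then show ?thesis using small by simp
  qed
  let ?Z = "sphere_mgf q \<kappa>"
  define y where "y = \<kappa>\<^sup>2 / (2 * ?P)"
  have y0: "y \<ge> 0" by (simp add: y_def)
  have y\<eta>: "y\<^sup>2 / ?P = \<eta>"
  proof -
    have "(a\<^sup>2 / (2 * c))\<^sup>2 / c = a ^ 4 / (4 * c ^ 3)" for a c :: real
      by (simp add: power_divide power_mult_distrib power2_eq_square power3_eq_cube power4_eq_xxxx mult_ac)
    then show ?thesis unfolding y_def \<eta>_def .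
  qed
  have Zup: "?Z \<le> exp y" using sphere_mgf_bounds(1)[OF q, of \<kappa>] by (simp add: y_def)
  have Zlo: "exp y * (1 - \<eta>) \<le> ?Z"
    using sphere_mgf_bounds(2)[OF q, of \<kappa>] unfolding y_def[symmetric] y\<eta> .
  have Zpos: "?Z > 0" using Zlo \<eta>1 by (meson diff_gt_0_iff_gt exp_gt_zero mult_pos_pos order_less_le_trans)
  define V where "V x = y * off_diag ?p J x" for x
  have Vm [measurable]: "V \<in> borel_measurable ?SS" unfolding V_def[abs_def] by measurable
  define R where "R x = sphere_mgf q (\<kappa> * sqrt (real (card J) + off_diag ?p J x)) / ?Z ^ card J" for x
  have Rm [measurable]: "R \<in> borel_measurable ?SS" unfolding R_def[abs_def] by measurable
  have eF: "ennreal (measure ?F A) = (\<integral>\<^sup>+x. indicator A x * ennreal (R x) \<partial>?SS)"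
    unfolding F.emeasure_eq_measure[symmetric] R_def
    by (rule emeasure_FvML_sample[OF _ mu J(1) inv]) (use q in simp)
  have R_bounds: "R x \<le> exp (V x) / (1 - \<eta>) ^ card J" "(1 - \<eta> * k ^ 4) * exp (V x) \<le> R x"
    if x: "x \<in> space ?SS" for x
  proof -
    define n where "n = k + off_diag ?p J x"
    have n: "0 \<le> n" "n \<le> k\<^sup>2" using off_diag_bounds[OF J(1) x] by (auto simp: n_def k_def)
    have arg: "(\<kappa> * sqrt n)\<^sup>2 / (2 * ?P) = y * n"
      using n by (simp add: power_mult_distrib y_def)
    have Vn: "exp (y * n) = exp (V x) * exp y ^ card J"
    proof -
      have "y * n = V x + y * real (card J)" by (simp add: V_def n_def k_def algebra_simps)
      then show ?thesis by (simp only: exp_add exp_of_nat2_mult)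
    qed
    have up: "sphere_mgf q (\<kappa> * sqrt n) \<le> exp (V x) * exp y ^ card J"
      using sphere_mgf_bounds(1)[OF q, of "\<kappa> * sqrt n"] unfolding arg Vn .
    have "(exp y * (1 - \<eta>)) ^ card J \<le> ?Z ^ card J"
      using Zlo \<eta>1 by (intro power_mono) auto
    then have Zk: "exp y ^ card J * (1 - \<eta>) ^ card J \<le> ?Z ^ card J" by (simp add: power_mult_distrib)
    have p1: "(1 - \<eta>) ^ card J > 0" using \<eta>1 by simp
    have "R x \<le> (exp (V x) * exp y ^ card J) / (exp y ^ card J * (1 - \<eta>) ^ card J)"
      unfolding R_def k_def[symmetric] n_def[symmetric]
      using up Zk p1 Zpos by (intro frac_le) auto
    then show "R x \<le> exp (V x) / (1 - \<eta>) ^ card J" by simp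
    have "(y * n)\<^sup>2 / ?P = \<eta> * n\<^sup>2" unfolding y\<eta>[symmetric] by (simp add: power_mult_distrib)
    also have "\<dots> \<le> \<eta> * (k\<^sup>2)\<^sup>2" using n \<eta>0 by (intro mult_left_mono power_mono) auto
    also have "(k\<^sup>2)\<^sup>2 = k ^ 4" by simp
    finally have "exp (y * n) * (1 - \<eta> * k ^ 4) \<le> exp (y * n) * (1 - (y * n)\<^sup>2 / ?P)" by simp
    also have "\<dots> \<le> sphere_mgf q (\<kappa> * sqrt n)"
      using sphere_mgf_bounds(2)[OF q, of "\<kappa> * sqrt n"] unfolding arg .
    finally have lo: "exp (y * n) * (1 - \<eta> * k ^ 4) \<le> sphere_mgf q (\<kappa> * sqrt n)" .
    have "?Z ^ card J \<le> exp y ^ card J" using Zup Zpos by (intro power_mono) auto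
    then have "exp (y * n) * (1 - \<eta> * k ^ 4) / exp y ^ card J \<le> R x"
      unfolding R_def k_def[symmetric] n_def[symmetric]
      using lo Zpos small by (intro frac_le) (auto intro: order_trans[OF _ lo])
    then show "(1 - \<eta> * k ^ 4) * exp (V x) \<le> R x" unfolding Vn by (simp add: mult_ac)
  qed
  have mV: "(\<integral>\<^sup>+x. ennreal (exp (s * V x)) \<partial>?SS) \<le> ennreal b" if s: "s\<^sup>2 = m\<^sup>2" for s
  proof -
    have N: "real (card J * card J - card J) = k\<^sup>2 - k"
      unfolding k_def by (subst of_nat_diff) (auto simp: power2_eq_square)
    have eq: "(s * y * (k\<^sup>2 - k))\<^sup>2 / (2 * ?P) = m\<^sup>2 * (k\<^sup>2 - k)\<^sup>2 * \<eta> / 2"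
    proof -
      have "(s * y * (k\<^sup>2 - k))\<^sup>2 / (2 * c) = s\<^sup>2 * (k\<^sup>2 - k)\<^sup>2 * (y\<^sup>2 / c) / 2" for c
        by (simp add: power_mult_distrib mult_ac)
      then show ?thesis unfolding s y\<eta>[symmetric] .
    qed
    show ?thesis
      using nn_integral_exp_off_diag[OF q J, of "s * y"]
      unfolding N eq b_def V_def by (simp only: mult.assoc)
  qed
  have eA: "(\<integral>\<^sup>+x. indicator A x \<partial>?SS) = ennreal (measure ?SS A)"
    by (simp add: SS.emeasure_eq_measure)
  have b0: "b \<ge> 0" by (simp add: b_def)
  define c1 where "c1 = 1 / (1 - \<eta>) ^ card J"
  let ?u = "\<lambda>x. ennreal (c1 * exp (- ((m - 1) * \<delta>))) * ennreal (exp (m * V x))"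
  have c1: "c1 \<ge> 0" using \<eta>1 by (simp add: c1_def)
  have "ennreal (measure ?F A) \<le> (\<integral>\<^sup>+x. ennreal (c1 * exp \<delta>) * indicator A x
      + ?u x \<partial>?SS)"
    unfolding eF
  proof (rule nn_integral_mono)
    fix x assume x: "x \<in> space ?SS"
    have "exp (V x) \<le> exp \<delta> + exp (- ((m - 1) * \<delta>)) * exp (m * V x)"
    proof (cases "V x \<le> \<delta>")
      case True
      then have "exp (V x) \<le> exp \<delta>" by simp
      then show ?thesis by (simp add: add_increasing2)
    next
      case False
      then have "(m - 1) * (V x - \<delta>) \<ge> 0" using m by (intro mult_nonneg_nonneg) auto
      then have "V x \<le> - ((m - 1) * \<delta>) + m * V x" by (simp add: algebra_simps)
      then have "exp (V x) \<le> exp (- ((m - 1) * \<delta>) + m * V x)" by (simp only: exp_le_cancel_iff)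
      then show ?thesis using exp_gt_zero[of \<delta>] unfolding exp_add by linarith
    qed
    then have "c1 * exp (V x) \<le> c1 * (exp \<delta> + exp (- ((m - 1) * \<delta>)) * exp (m * V x))"
      using c1 by (rule mult_left_mono)
    then have "R x \<le> c1 * exp \<delta> + c1 * exp (- ((m - 1) * \<delta>)) * exp (m * V x)"
      using R_bounds(1)[OF x] by (simp add: c1_def distrib_left mult.assoc)
    then have "ennreal (R x) \<le> ennreal (c1 * exp \<delta>) + ?u x"
      using c1 by (simp add: ennreal_leI flip: ennreal_mult ennreal_plus)
    then show "indicator A x * ennreal (R x) \<le> ennreal (c1 * exp \<delta>) * indicator A x
      + ?u x"
      by (auto split: split_indicator)
  qed
  also have "\<dots> = ennreal (c1 * exp \<delta>) * ennreal (measure ?SS A)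
      + ennreal (c1 * exp (- ((m - 1) * \<delta>))) * (\<integral>\<^sup>+x. ennreal (exp (m * V x)) \<partial>?SS)"
    by (subst nn_integral_add) (auto simp: nn_integral_cmult eA[symmetric])
  also have "\<dots> \<le> ennreal (c1 * exp \<delta>) * ennreal (measure ?SS A) + ennreal (c1 * exp (- ((m - 1) * \<delta>))) * ennreal b"
    using mV[of m] by (intro add_left_mono mult_left_mono) auto
  also have "\<dots> = ennreal (c1 * exp \<delta> * measure ?SS A + c1 * exp (- ((m - 1) * \<delta>)) * b)"
    using c1 b0 by (simp flip: ennreal_mult ennreal_plus)
  finally have "measure ?F A \<le> c1 * exp \<delta> * measure ?SS A + c1 * exp (- ((m - 1) * \<delta>)) * b"
    using c1 b0 by (subst (asm) ennreal_le_iff) auto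
  then show "measure ?F A \<le> (exp \<delta> * measure ?SS A + exp (- ((m - 1) * \<delta>)) * b) / (1 - \<eta>) ^ card J"
    by (simp add: c1_def add_divide_distrib)
  define c2 where "c2 = 1 - \<eta> * k ^ 4"
  let ?l = "\<lambda>x. ennreal (c2 * exp (- (m * \<delta>))) * ennreal (exp (- m * V x))"
  have c2: "c2 \<ge> 0" using small by (simp add: c2_def)
  have "ennreal (c2 * exp (- \<delta>) * measure ?SS A) = (\<integral>\<^sup>+x. ennreal (c2 * exp (- \<delta>)) * indicator A x \<partial>?SS)"
    using c2 by (subst nn_integral_cmult) (auto simp: ennreal_mult eA)
  also have "\<dots> \<le> (\<integral>\<^sup>+x. indicator A x * ennreal (R x)
      + ?l x \<partial>?SS)"
  proof (rule nn_integral_mono)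
    fix x assume x: "x \<in> space ?SS"
    have "exp (- \<delta>) \<le> exp (V x) + exp (- (m * \<delta>)) * exp (- m * V x)"
    proof (cases "V x \<ge> - \<delta>")
      case True
      then have "exp (- \<delta>) \<le> exp (V x)" by simp
      then show ?thesis by (simp add: add_increasing2)
    next
      case False
      then have "m * (- V x - \<delta>) \<ge> 0" using m by (intro mult_nonneg_nonneg) auto
      then have "- \<delta> \<le> - (m * \<delta>) + - m * V x" using \<delta> by (simp add: algebra_simps)
      then have "exp (- \<delta>) \<le> exp (- (m * \<delta>) + - m * V x)" by (simp only: exp_le_cancel_iff)
      then show ?thesis using exp_gt_zero[of "V x"] unfolding exp_add by linarith
    qed
    then have "c2 * exp (- \<delta>) \<le> c2 * (exp (V x) + exp (- (m * \<delta>)) * exp (- m * V x))"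
      using c2 by (rule mult_left_mono)
    then have "c2 * exp (- \<delta>) \<le> R x + c2 * exp (- (m * \<delta>)) * exp (- m * V x)"
      using R_bounds(2)[OF x] unfolding c2_def[symmetric] by (simp only: distrib_left mult.assoc)
    moreover have "R x \<ge> 0" using Zpos by (simp add: R_def sphere_mgf_nonneg)
    ultimately have "ennreal (c2 * exp (- \<delta>)) \<le> ennreal (R x) + ?l x"
      using c2 by (simp add: ennreal_leI flip: ennreal_mult ennreal_plus)
    then show "ennreal (c2 * exp (- \<delta>)) * indicator A x \<le> indicator A x * ennreal (R x)
      + ?l x"
      by (auto split: split_indicator)
  qed
  also have "\<dots> = ennreal (measure ?F A)
      + ennreal (c2 * exp (- (m * \<delta>))) * (\<integral>\<^sup>+x. ennreal (exp (- m * V x)) \<partial>?SS)"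
    unfolding eF by (subst nn_integral_add) (auto simp: nn_integral_cmult)
  also have "\<dots> \<le> ennreal (measure ?F A) + ennreal (c2 * exp (- (m * \<delta>))) * ennreal b"
    using mV[of "- m"] by (intro add_left_mono mult_left_mono) auto
  also have "\<dots> = ennreal (measure ?F A + c2 * exp (- (m * \<delta>)) * b)"
    using c2 b0 by (simp flip: ennreal_mult ennreal_plus)
  finally have "c2 * exp (- \<delta>) * measure ?SS A \<le> measure ?F A + c2 * exp (- (m * \<delta>)) * b"
    using c2 b0 by (subst (asm) ennreal_le_iff) auto
  then show "(1 - \<eta> * k ^ 4) * (exp (- \<delta>) * measure ?SS A - exp (- (m * \<delta>)) * b) \<le> measure ?F A"
    by (simp add: c2_def right_diff_distrib mult.assoc)
qed

section \<open>Exceedances of the pairwise inner products\<close>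

definition index_pairs :: "nat \<Rightarrow> (nat \<times> nat) set" where
  "index_pairs n = {(i, j). 1 \<le> i \<and> i < j \<and> j \<le> n}"

lemma finite_index_pairs [simp]: "finite (index_pairs n)"
  by (rule finite_subset[of _ "{..n} \<times> {..n}"]) (auto simp: index_pairs_def)

lemma card_index_pairs: "real (card (index_pairs n)) = real n * (real n - 1) / 2"
proof -
  let ?I = "index_pairs n"
  have "{(i, j) \<in> {1..n} \<times> {1..n}. i \<noteq> j} = ?I \<union> prod.swap ` ?I"
  proof (intro equalityI subsetI)
    fix z assume "z \<in> {(i, j) \<in> {1..n} \<times> {1..n}. i \<noteq> j}"
    then obtain i j where z: "z = (i, j)" "1 \<le> i" "i \<le> n" "1 \<le> j" "j \<le> n" "i \<noteq> j" by auto
    show "z \<in> ?I \<union> prod.swap ` ?I"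
    proof (cases "i < j")
      case False
      then have "(j, i) \<in> ?I" using z by (auto simp: index_pairs_def)
      then have "prod.swap (j, i) \<in> prod.swap ` ?I" by (rule imageI)
      then show ?thesis using z by simp
    qed (use z in \<open>auto simp: index_pairs_def\<close>)
  qed (auto simp: index_pairs_def)
  moreover have "?I \<inter> prod.swap ` ?I = {}" by (auto simp: index_pairs_def)
  ultimately have "card {(i, j) \<in> {1..n} \<times> {1..n}. i \<noteq> j} = card ?I + card (prod.swap ` ?I)"
    by (simp add: card_Un_disjoint)
  also have "card (prod.swap ` ?I) = card ?I" by (rule card_image) (auto simp: inj_on_def)
  finally have "n * n - n = 2 * card ?I" using card_off_diag[of "{1..n}"] by simp
  then have "2 * real (card ?I) = real (n * n - n)" by simp
  also have "\<dots> = real n * real n - real n" by (subst of_nat_diff) auto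
  finally show ?thesis by (simp add: algebra_simps)
qed

definition adjacent_pairs :: "nat \<Rightarrow> nat \<times> nat \<Rightarrow> (nat \<times> nat) set" where
  "adjacent_pairs n a = {b \<in> index_pairs n. {fst a, snd a} \<inter> {fst b, snd b} \<noteq> {}}"

lemma card_adjacent_pairs: "card (adjacent_pairs n a) \<le> 2 * n"
proof -
  let ?f = "\<lambda>(e, l). (min e l, max e l :: nat)"
  have "adjacent_pairs n a \<subseteq> ?f ` ({fst a, snd a} \<times> {1..n})"
  proof
    fix b assume b: "b \<in> adjacent_pairs n a"
    then obtain k l where kl: "b = (k, l)" "1 \<le> k" "k < l" "l \<le> n"
      by (auto simp: adjacent_pairs_def index_pairs_def)
    then consider "k \<in> {fst a, snd a}" | "l \<in> {fst a, snd a}" using b by (auto simp: adjacent_pairs_def)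
    then show "b \<in> ?f ` ({fst a, snd a} \<times> {1..n})"
    proof cases
      case 1 then show ?thesis using kl by (intro image_eqI[of _ _ "(k, l)"]) auto
    next
      case 2 then show ?thesis using kl by (intro image_eqI[of _ _ "(l, k)"]) auto
    qed
  qed
  then have "card (adjacent_pairs n a) \<le> card (?f ` ({fst a, snd a} \<times> {1..n}))"
    by (rule card_mono[rotated]) simp
  also have "\<dots> \<le> card ({fst a, snd a} \<times> {1..n})" by (rule card_image_le) simp
  also have "\<dots> \<le> 2 * n" by (auto simp: card_insert_if)
  finally show ?thesis .
qed

definition exceedance :: "nat \<Rightarrow> real \<Rightarrow> 'i set \<Rightarrow> 'i \<times> 'i \<Rightarrow> ('i \<Rightarrow> nat \<Rightarrow> real) set" where
  "exceedance p t J a = {x \<in> space (sphere_sample p J). t < real p * (vinner p (x (fst a)) (x (snd a)))\<^sup>2}"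

lemma exceedance_sets:
  assumes "fst a \<in> J" "snd a \<in> J"
  shows "exceedance p t J a \<in> sets (sphere_sample p J)"
proof -
  have [measurable]: "(\<lambda>x. vinner p (x (fst a)) (x (snd a))) \<in> borel_measurable (sphere_sample p J)"
    using assms by (rule sphere_sample_vinner)
  show ?thesis unfolding exceedance_def by measurable
qed

lemma space_sphere_sample_vrefl:
  assumes "vinner p v v \<noteq> 0" "x \<in> space (sphere_sample p J)"
  shows "compose J (vrefl p v) x \<in> space (sphere_sample p J)"
proof -
  have "vrefl p v (x i) \<in> unit_sphere p" if "i \<in> J" for i
    using assms that vrefl_sphere_iff[OF assms(1), of "x i"]
    by (auto simp: space_sphere_sample unit_sphere_def)
  then show ?thesis by (auto simp: space_sphere_sample compose_def)
qed

lemma rotation_invariant_exceedance: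
  assumes "fst a \<in> J" "snd a \<in> J"
  shows "rotation_invariant p J (exceedance p t J a)"
  unfolding rotation_invariant_def
proof (intro conjI allI impI exceedance_sets assms)
  fix v x assume v: "vinner p v v \<noteq> 0" and x: "x \<in> space (sphere_sample p J)"
  then show "compose J (vrefl p v) x \<in> exceedance p t J a \<longleftrightarrow> x \<in> exceedance p t J a"
    using space_sphere_sample_vrefl[OF v x] assms by (simp add: exceedance_def compose_def vinner_vrefl)
qed

lemma rotation_invariant_Int:
  "rotation_invariant p J A \<Longrightarrow> rotation_invariant p J B \<Longrightarrow> rotation_invariant p J (A \<inter> B)"
  by (auto simp: rotation_invariant_def)

lemma measure_exceedance_pair:
  assumes J: "finite J" "i \<in> J" "j \<in> J" "i \<noteq> j"
  shows "measure (sphere_sample (Suc q) J) (exceedance (Suc q) t J (i, j))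
    = measure (coord_law q) {u. t < real (Suc q) * u\<^sup>2}"
proof -
  let ?SS = "sphere_sample (Suc q) J"
  define U where "U = {u. t < real (Suc q) * u\<^sup>2}"
  have U [measurable]: "U \<in> sets borel" unfolding U_def by measurable
  have E: "exceedance (Suc q) t J (i, j) \<in> sets ?SS" using J by (intro exceedance_sets) auto
  have "emeasure ?SS (exceedance (Suc q) t J (i, j)) = (\<integral>\<^sup>+x. indicator (exceedance (Suc q) t J (i, j)) x \<partial>?SS)"
    using E by simp
  also have "\<dots> = (\<integral>\<^sup>+x. indicator U (vinner (Suc q) (x i) (x j)) \<partial>?SS)"
    by (intro nn_integral_cong) (auto simp: exceedance_def U_def split: split_indicator)
  also have "\<dots> = (\<integral>\<^sup>+u. indicator U u \<partial>coord_law q)"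
    by (rule nn_integral_sphere_sample_pair[OF J]) simp
  also have "\<dots> = emeasure (coord_law q) U" by (rule nn_integral_indicator) (simp add: coord_law_def)
  finally show ?thesis by (simp add: measure_def U_def)
qed

text \<open>
  Two pairs with exactly one common index exceed independently under the uniform distribution.
\<close>

lemma measure_exceedance_triple:
  assumes J: "finite J" "l \<notin> J" "i \<in> J" "j \<in> J" "i \<noteq> j"
  shows "measure (sphere_sample (Suc q) (insert l J))
      (exceedance (Suc q) t (insert l J) (i, j) \<inter> exceedance (Suc q) t (insert l J) (i, l))
    = (measure (coord_law q) {u. t < real (Suc q) * u\<^sup>2})\<^sup>2"
proof -
  let ?SS = "sphere_sample (Suc q) (insert l J)"
  let ?iJ = "indicator (exceedance (Suc q) t J (i, j)) :: _ \<Rightarrow> ennreal"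
  let ?E = "exceedance (Suc q) t (insert l J) (i, j) \<inter> exceedance (Suc q) t (insert l J) (i, l)"
  interpret C: prob_space "coord_law q" by (rule prob_space_coord_law)
  interpret S: prob_space "sphere_sample (Suc q) J" by (rule prob_space_sphere_sample) simp
  define U where "U = {u. t < real (Suc q) * u\<^sup>2}"
  have U [measurable]: "U \<in> sets borel" unfolding U_def by measurable
  have EJ [measurable]: "exceedance (Suc q) t J (i, j) \<in> sets (sphere_sample (Suc q) J)"
    using J by (intro exceedance_sets) auto
  have E: "?E \<in> sets ?SS" using J by (intro sets.Int exceedance_sets) auto
  have "emeasure ?SS ?E = (\<integral>\<^sup>+x. indicator ?E x \<partial>?SS)" using E by simp
  also have "\<dots> = (\<integral>\<^sup>+x. ?iJ (restrict x J)
      * indicator U (vinner (Suc q) (x i) (x l)) \<partial>?SS)"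
  proof (rule nn_integral_cong)
    fix x assume "x \<in> space ?SS"
    then have "restrict x J \<in> space (sphere_sample (Suc q) J)" by (auto simp: space_sphere_sample)
    then show "indicator ?E x = (?iJ (restrict x J)
      * indicator U (vinner (Suc q) (x i) (x l)) :: ennreal)"
      using \<open>x \<in> space ?SS\<close> J by (auto simp: exceedance_def U_def split: split_indicator)
  qed
  also have "\<dots> = (\<integral>\<^sup>+x. ?iJ x \<partial>sphere_sample (Suc q) J)
      * (\<integral>\<^sup>+u. indicator U u \<partial>coord_law q)"
    using J by (intro nn_integral_sphere_sample_peel) auto
  also have "(\<integral>\<^sup>+u. indicator U u \<partial>coord_law q) = emeasure (coord_law q) U"
    by (rule nn_integral_indicator) (simp add: coord_law_def)
  also have "(\<integral>\<^sup>+x. ?iJ x \<partial>sphere_sample (Suc q) J)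
      = ennreal (measure (coord_law q) U)"
    using EJ measure_exceedance_pair[of J i j q t] J by (simp add: S.emeasure_eq_measure U_def)
  finally have "emeasure ?SS ?E = ennreal ((measure (coord_law q) U)\<^sup>2)"
    by (simp add: C.emeasure_eq_measure power2_eq_square ennreal_mult)
  then show ?thesis by (simp add: measure_def U_def)
qed

text \<open>
  The Poisson approximation and the comparison of the two laws combined, for fixed \<open>n\<close>.  Here \<open>lo\<close> and \<open>hi2\<close>
  bound the probability that a given pair exceeds, and \<open>hi3\<close> bounds the probability that two pairs
  with one common index both do.  The comparison is applied to \<open>k = 2\<close> and \<open>k = 3\<close> points, whence
  \<open>k ^ 4\<close> is 16 or 81 and \<open>(k\<^sup>2 - k)\<^sup>2\<close> is 4 or 36.
\<close>

lemma void_probability_FvML: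
  fixes X :: "nat \<Rightarrow> 'a \<Rightarrow> nat \<Rightarrow> real" and \<kappa> \<delta> m t :: real
  assumes q: "q \<ge> 3" and mu: "\<mu> \<in> unit_sphere (Suc q)" and n: "n \<ge> 2"
    and prob: "prob_space \<Omega>"
    and indep: "prob_space.indep_vars \<Omega> (\<lambda>_. FvML (Suc q) \<kappa> \<mu>) X {1..n}"
    and law: "\<And>i. 1 \<le> i \<Longrightarrow> i \<le> n \<Longrightarrow> distr \<Omega> (FvML (Suc q) \<kappa> \<mu>) (X i) = FvML (Suc q) \<kappa> \<mu>"
    and \<delta>: "\<delta> > 0" and m: "m \<ge> 1"
  defines "\<eta> \<equiv> \<kappa> ^ 4 / (4 * real (Suc q) ^ 3)"
    and "T \<equiv> measure (coord_law q) {u. t < real (Suc q) * u\<^sup>2}"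
  defines "lo \<equiv> (1 - \<eta> * 16) * (exp (- \<delta>) * T - exp (- (m * \<delta>)) * exp (m\<^sup>2 * 4 * \<eta> / 2))"
    and "hi2 \<equiv> (exp \<delta> * T + exp (- ((m - 1) * \<delta>)) * exp (m\<^sup>2 * 4 * \<eta> / 2)) / (1 - \<eta>)\<^sup>2"
    and "hi3 \<equiv> (exp \<delta> * T\<^sup>2 + exp (- ((m - 1) * \<delta>)) * exp (m\<^sup>2 * 36 * \<eta> / 2)) / (1 - \<eta>) ^ 3"
    and "V \<equiv> {\<omega> \<in> space \<Omega>. real (Suc q) * max_sq_inner (Suc q) n (\<lambda>i. X i \<omega>) \<le> t}"
  assumes small: "\<eta> * 81 < 1"
  shows "V \<in> sets \<Omega>"
    and "\<exists>S. real n * (real n - 1) / 2 * lo \<le> S \<and> S \<le> real n * (real n - 1) / 2 * hi2 \<and>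
      \<bar>measure \<Omega> V - exp (- S)\<bar> \<le> 2 * real n ^ 3 * (hi2\<^sup>2 + hi3)"
proof -
  let ?p = "Suc q" and ?F = "FvML (Suc q) \<kappa> \<mu>" and ?I = "index_pairs n"
  interpret prob_space \<Omega> by (rule prob)
  interpret F: prob_space ?F by (rule prob_space_FvML) simp
  have setsF: "sets ?F = sets (uniform_sphere ?p)" by (simp add: FvML_def)
  have spF: "space ?F = unit_sphere ?p" by (simp add: FvML_def)
  have Xm: "X i \<in> \<Omega> \<rightarrow>\<^sub>M ?F" if "i \<in> {1..n}" for i
    using indep that by (auto simp: indep_vars_def)
  have XmS: "X i \<in> \<Omega> \<rightarrow>\<^sub>M uniform_sphere ?p" if "i \<in> {1..n}" for i
    using Xm[OF that] measurable_cong_sets[OF refl setsF] by blast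
  have setsPF: "sets (PiM J (\<lambda>_. ?F)) = sets (sphere_sample ?p J)" for J :: "nat set"
    unfolding sphere_sample_def by (intro sets_PiM_cong) (auto simp: setsF)
  define XJ where "XJ J \<omega> = (\<lambda>i\<in>J. X i \<omega>)" for J \<omega>
  have XJm: "XJ J \<in> \<Omega> \<rightarrow>\<^sub>M PiM J (\<lambda>_. ?F)" if "J \<subseteq> {1..n}" for J
    unfolding XJ_def[abs_def] using that by (intro measurable_restrict Xm) auto
  have XJsp: "XJ J \<omega> \<in> space (sphere_sample ?p J)" if "J \<subseteq> {1..n}" "\<omega> \<in> space \<Omega>" for J \<omega>
    using measurable_space[OF XJm[OF that(1)] that(2)] sets_eq_imp_space_eq[OF setsPF] by simp
  have XJlaw: "prob {\<omega> \<in> space \<Omega>. XJ J \<omega> \<in> A} = measure (PiM J (\<lambda>_. ?F)) A"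
    if J: "J \<subseteq> {1..n}" "J \<noteq> {}" and A: "A \<in> sets (sphere_sample ?p J)" for J A
  proof -
    have "distr \<Omega> (PiM J (\<lambda>_. ?F)) (XJ J) = PiM J (\<lambda>i. distr \<Omega> ?F (X i))"
      using indep_vars_iff_distr_eq_PiM'[OF J(2), where X = X and M' = "\<lambda>_. ?F"] Xm J(1)
        indep_vars_subset[OF indep J(1)] unfolding XJ_def[abs_def] by blast
    also have "\<dots> = PiM J (\<lambda>_. ?F)" using law J(1) by (intro PiM_cong) auto
    finally have "measure (PiM J (\<lambda>_. ?F)) A = measure (distr \<Omega> (PiM J (\<lambda>_. ?F)) (XJ J)) A" by simp
    also have "\<dots> = prob (XJ J -` A \<inter> space \<Omega>)"
      using A XJm[OF J(1)] by (intro measure_distr) (auto simp: setsPF)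
    finally show ?thesis by (simp add: vimage_def Int_def conj_commute)
  qed
  define E where "E a = {\<omega> \<in> space \<Omega>. t < real ?p * (vinner ?p (X (fst a) \<omega>) (X (snd a) \<omega>))\<^sup>2}" for a
  have E_XJ: "\<omega> \<in> E a \<longleftrightarrow> XJ J \<omega> \<in> exceedance ?p t J a"
    if "\<omega> \<in> space \<Omega>" "J \<subseteq> {1..n}" "fst a \<in> J" "snd a \<in> J" for a J \<omega>
    using that XJsp[OF that(2,1)] by (auto simp: E_def exceedance_def XJ_def)
  have E_XJ': "E a = {\<omega> \<in> space \<Omega>. XJ J \<omega> \<in> exceedance ?p t J a}"
    if "J \<subseteq> {1..n}" "fst a \<in> J" "snd a \<in> J" for a J
    using E_XJ[OF _ that] by (auto simp: E_def)
  have Iin: "fst a \<in> {1..n}" "snd a \<in> {1..n}" "fst a < snd a" if "a \<in> ?I" for a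
    using that by (auto simp: index_pairs_def)
  have Esets: "E a \<in> events" if a: "a \<in> ?I" for a
  proof -
    have [measurable]: "(\<lambda>\<omega>. vinner ?p (X (fst a) \<omega>) (X (snd a) \<omega>)) \<in> borel_measurable \<Omega>"
      using Iin[OF a] by (intro vinner_measurable_sphere XmS)
    show ?thesis unfolding E_def by measurable
  qed
  have "(1, 2) \<in> ?I" using n by (simp add: index_pairs_def)
  then have Ine: "?I \<noteq> {}" by blast
  have V_eq: "V = {\<omega> \<in> space \<Omega>. \<forall>a\<in>?I. \<omega> \<notin> E a}"
  proof -
    have "real ?p * max_sq_inner ?p n x \<le> t \<longleftrightarrow> (\<forall>a\<in>?I. \<not> t < real ?p * (vinner ?p (x (fst a)) (x (snd a)))\<^sup>2)" for x
    proof -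
      have "real ?p * max_sq_inner ?p n x \<le> t \<longleftrightarrow> max_sq_inner ?p n x \<le> t / real ?p"
        by (subst pos_le_divide_eq) (auto simp: mult.commute)
      also have "\<dots> \<longleftrightarrow> (\<forall>a\<in>?I. (vinner ?p (x (fst a)) (x (snd a)))\<^sup>2 \<le> t / real ?p)"
        unfolding max_sq_inner_def index_pairs_def[symmetric] using Ine
        by (subst Max_le_iff) (auto simp: case_prod_unfold)
      also have "\<dots> \<longleftrightarrow> (\<forall>a\<in>?I. \<not> t < real ?p * (vinner ?p (x (fst a)) (x (snd a)))\<^sup>2)"
        by (subst pos_le_divide_eq) (auto simp: mult.commute not_less)
      finally show ?thesis .
    qed
    then show ?thesis unfolding V_def E_def by auto
  qed
  show "V \<in> sets \<Omega>"
    unfolding V_eq using Esets by (intro sets.sets_Collect_finite_All) (auto simp: E_def)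
  have \<eta>0: "\<eta> \<ge> 0" by (simp add: \<eta>_def)
  have T0: "T \<ge> 0" by (simp add: T_def)
  have P2: "lo \<le> prob (E a)" "prob (E a) \<le> hi2" if a: "a \<in> ?I" for a
  proof -
    let ?J = "{fst a, snd a}"
    have J: "?J \<subseteq> {1..n}" "card ?J = 2" "finite ?J" using Iin[OF a] by auto
    have e: "prob (E a) = measure (PiM ?J (\<lambda>_. ?F)) (exceedance ?p t ?J a)"
      unfolding E_XJ'[OF J(1), of a, simplified] using J(1) by (intro XJlaw exceedance_sets) auto
    have s: "measure (sphere_sample ?p ?J) (exceedance ?p t ?J a) = T"
      using measure_exceedance_pair[of ?J "fst a" "snd a" q t] Iin[OF a] by (simp add: T_def)
    have inv: "rotation_invariant ?p ?J (exceedance ?p t ?J a)"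
      by (intro rotation_invariant_exceedance) auto
    have small2: "\<kappa> ^ 4 / (4 * real ?p ^ 3) * real (card ?J) ^ 4 < 1"
      using small \<eta>0 unfolding J(2) \<eta>_def[symmetric] by simp
    note c = FvML_sample_comparison[OF q mu J(3) _ inv \<delta> m small2]
    show "lo \<le> prob (E a)" "prob (E a) \<le> hi2"
      using c unfolding J(2) e s \<eta>_def[symmetric] by (simp_all add: lo_def hi2_def)
  qed
  have P3: "prob (E a \<inter> E b) \<le> hi3" if a: "a \<in> ?I" and b: "b \<in> adjacent_pairs n a - {a}" for a b
  proof -
    have bI: "b \<in> ?I" using b by (simp add: adjacent_pairs_def)
    note ia = Iin[OF a] and ib = Iin[OF bI]
    \<comment> \<open>\<open>i\<close> is the common index of the two pairs, \<open>j\<close> and \<open>l\<close> are the other two\<close>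
    obtain i j l where ijl: "i \<noteq> j" "l \<noteq> i" "l \<noteq> j" "{i, j} = {fst a, snd a}" "{i, l} = {fst b, snd b}"
    proof -
      obtain a1 a2 b1 b2 where ab: "a = (a1, a2)" "b = (b1, b2)" by (cases a, cases b)
      have lt: "a1 < a2" "b1 < b2" "(a1, a2) \<noteq> (b1, b2)" using ia ib b ab by auto
      have "a1 = b1 \<or> a1 = b2 \<or> a2 = b1 \<or> a2 = b2" using b ab by (auto simp: adjacent_pairs_def)
      then consider "a1 = b1" | "a1 = b2" | "a2 = b1" | "a2 = b2" by blast
      then show thesis
      proof cases
        case 1 then show thesis using that[of a1 a2 b2] lt ab by auto
      next
        case 2 then show thesis using that[of a1 a2 b1] lt ab by auto
      next
        case 3 then show thesis using that[of a2 a1 b2] lt ab by auto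
      next
        case 4 then show thesis using that[of a2 a1 b1] lt ab by auto
      qed
    qed
    define J where "J = {i, j}"
    let ?K = "insert l J"
    have K: "?K \<subseteq> {1..n}" "card ?K = 3" "finite ?K" "l \<notin> J"
      "fst a \<in> ?K" "snd a \<in> ?K" "fst b \<in> ?K" "snd b \<in> ?K"
    proof -
      have "?K = {fst a, snd a} \<union> {fst b, snd b}" using ijl by (auto simp: J_def)
      then show "?K \<subseteq> {1..n}" "fst a \<in> ?K" "snd a \<in> ?K" "fst b \<in> ?K" "snd b \<in> ?K"
        using ia ib by auto
    qed (use ijl(1-3) in \<open>auto simp: J_def\<close>)
    have sym: "exceedance ?p t ?K (fst c, snd c) = exceedance ?p t ?K (snd c, fst c)" for c :: "nat \<times> nat"
      by (simp add: exceedance_def vinner_commute)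
    have ea: "exceedance ?p t ?K a = exceedance ?p t ?K (i, j)"
      using ijl(4) sym[of a] by (cases a) (auto simp: doubleton_eq_iff)
    have eb: "exceedance ?p t ?K b = exceedance ?p t ?K (i, l)"
      using ijl(5) sym[of b] by (cases b) (auto simp: doubleton_eq_iff)
    let ?A = "exceedance ?p t ?K a \<inter> exceedance ?p t ?K b"
    have "E a \<inter> E b = {\<omega> \<in> space \<Omega>. XJ ?K \<omega> \<in> ?A}"
      using E_XJ'[OF K(1), of a] E_XJ'[OF K(1), of b] K by auto
    then have e: "prob (E a \<inter> E b) = measure (PiM ?K (\<lambda>_. ?F)) ?A"
      using K by (simp only:) (intro XJlaw sets.Int exceedance_sets, auto)
    have s: "measure (sphere_sample ?p ?K) ?A = T\<^sup>2"
      unfolding ea eb T_def using K ijl by (intro measure_exceedance_triple) (auto simp: J_def)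
    have inv: "rotation_invariant ?p ?K ?A"
      using K by (intro rotation_invariant_Int rotation_invariant_exceedance) auto
    have small3: "\<kappa> ^ 4 / (4 * real ?p ^ 3) * real (card ?K) ^ 4 < 1"
      using small unfolding K(2) \<eta>_def[symmetric] by simp
    show ?thesis
      using FvML_sample_comparison(1)[OF q mu K(3) _ inv \<delta> m small3]
      unfolding K(2) e s \<eta>_def[symmetric] by (simp add: hi3_def)
  qed
  have ind: "indep_var (count_space UNIV) (indicator (E a)) (count_space UNIV)
      (\<lambda>\<omega>. card {b \<in> ?I - adjacent_pairs n a. \<omega> \<in> E b})" if a: "a \<in> ?I" for a
  proof -
    let ?J = "{fst a, snd a}" and ?K = "{1..n} - {fst a, snd a}"
    have J: "?J \<subseteq> {1..n}" using Iin[OF a] by auto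
    have bK: "fst b \<in> ?K" "snd b \<in> ?K" if "b \<in> ?I - adjacent_pairs n a" for b
      using that Iin[of b] by (auto simp: adjacent_pairs_def)
    have iv: "indep_var (PiM ?J (\<lambda>_. ?F)) (XJ ?J) (PiM ?K (\<lambda>_. ?F)) (XJ ?K)"
      unfolding XJ_def[abs_def] using J by (intro indep_var_restrict[OF indep]) auto
    let ?f = "indicator (exceedance ?p t ?J a) :: _ \<Rightarrow> nat"
    let ?g = "\<lambda>x. card {b \<in> ?I - adjacent_pairs n a. x \<in> exceedance ?p t ?K b}"
    have f: "?f \<in> PiM ?J (\<lambda>_. ?F) \<rightarrow>\<^sub>M count_space UNIV"
    proof -
      have [measurable]: "exceedance ?p t ?J a \<in> sets (PiM ?J (\<lambda>_. ?F))"
        unfolding setsPF by (intro exceedance_sets) auto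
      have "(\<lambda>x. if x \<in> exceedance ?p t ?J a then 1 else 0 :: nat) \<in> PiM ?J (\<lambda>_. ?F) \<rightarrow>\<^sub>M count_space UNIV"
        by measurable
      then show ?thesis by (simp add: indicator_def[abs_def] of_bool_def)
    qed
    have g: "?g \<in> PiM ?K (\<lambda>_. ?F) \<rightarrow>\<^sub>M count_space UNIV"
      using bK by (intro measurable_card_events) (auto simp: setsPF intro!: exceedance_sets)
    have "indep_var (count_space UNIV) (?f \<circ> XJ ?J) (count_space UNIV) (?g \<circ> XJ ?K)"
      by (rule indep_var_compose[OF iv f g])
    then show ?thesis
    proof (rule indep_var_cong_space)
      fix \<omega> assume \<omega>: "\<omega> \<in> space \<Omega>"
      show "(?f \<circ> XJ ?J) \<omega> = indicator (E a) \<omega>"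
        using E_XJ[OF \<omega> J, of a] by (simp add: indicator_def)
      have "{b \<in> ?I - adjacent_pairs n a. XJ ?K \<omega> \<in> exceedance ?p t ?K b} = {b \<in> ?I - adjacent_pairs n a. \<omega> \<in> E b}"
        using E_XJ[OF \<omega>, of ?K] bK by auto
      then show "(?g \<circ> XJ ?K) \<omega> = card {b \<in> ?I - adjacent_pairs n a. \<omega> \<in> E b}" by simp
    qed
  qed
  define S where "S = (\<Sum>a\<in>?I. prob (E a))"
  have hi2_0: "hi2 \<ge> 0" using T0 by (simp add: hi2_def)
  have hi3_0: "hi3 \<ge> 0" using T0 small \<eta>0 by (simp add: hi3_def)
  have "\<bar>prob V - exp (- S)\<bar>
      \<le> (\<Sum>a\<in>?I. \<Sum>b\<in>adjacent_pairs n a. prob (E a) * prob (E b))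
        + (\<Sum>a\<in>?I. \<Sum>b\<in>adjacent_pairs n a - {a}. prob (E a \<inter> E b))"
    unfolding V_eq S_def
    by (rule void_probability_poisson[OF finite_index_pairs Esets _ _ ind])
       (auto simp: adjacent_pairs_def)
  also have "\<dots> \<le> (\<Sum>a\<in>?I. 2 * real n * hi2\<^sup>2) + (\<Sum>a\<in>?I. 2 * real n * hi3)"
  proof (intro add_mono sum_mono)
    fix a assume a: "a \<in> ?I"
    have fin: "finite (adjacent_pairs n a)" by (simp add: adjacent_pairs_def)
    have c: "real (card (adjacent_pairs n a)) \<le> 2 * real n" using card_adjacent_pairs[of n a] by linarith
    have "(\<Sum>b\<in>adjacent_pairs n a. prob (E a) * prob (E b)) \<le> (\<Sum>b\<in>adjacent_pairs n a. hi2\<^sup>2)"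
      unfolding power2_eq_square using a hi2_0
      by (intro sum_mono mult_mono P2) (auto simp: adjacent_pairs_def)
    also have "\<dots> \<le> 2 * real n * hi2\<^sup>2" using c by (simp add: mult_right_mono)
    finally show "(\<Sum>b\<in>adjacent_pairs n a. prob (E a) * prob (E b)) \<le> 2 * real n * hi2\<^sup>2" .
    have "(\<Sum>b\<in>adjacent_pairs n a - {a}. prob (E a \<inter> E b)) \<le> (\<Sum>b\<in>adjacent_pairs n a - {a}. hi3)"
      using P3[OF a] by (intro sum_mono) auto
    also have "\<dots> \<le> (\<Sum>b\<in>adjacent_pairs n a. hi3)"
      using fin hi3_0 by (intro sum_mono2) auto
    also have "\<dots> \<le> 2 * real n * hi3" using c hi3_0 by (simp add: mult_right_mono)
    finally show "(\<Sum>b\<in>adjacent_pairs n a - {a}. prob (E a \<inter> E b)) \<le> 2 * real n * hi3" .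
  qed
  also have "\<dots> = real (card ?I) * (2 * real n * (hi2\<^sup>2 + hi3))" by (simp add: algebra_simps)
  also have "\<dots> \<le> real n ^ 2 * (2 * real n * (hi2\<^sup>2 + hi3))"
  proof (rule mult_right_mono)
    have "real n * (real n - 1) / 2 \<le> real n * real n" using n by (simp add: algebra_simps)
    then show "real (card ?I) \<le> real n ^ 2" by (simp add: card_index_pairs power2_eq_square)
    show "0 \<le> 2 * real n * (hi2\<^sup>2 + hi3)" using hi3_0 by simp
  qed
  also have "\<dots> = 2 * real n ^ 3 * (hi2\<^sup>2 + hi3)" by (simp add: power2_eq_square power3_eq_cube)
  finally have err: "\<bar>prob V - exp (- S)\<bar> \<le> 2 * real n ^ 3 * (hi2\<^sup>2 + hi3)" .
  have "real (card ?I) * lo \<le> S" unfolding S_def using P2(1) sum_bounded_below[of ?I lo] by simp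
  moreover have "S \<le> real (card ?I) * hi2" unfolding S_def using P2(2) sum_bounded_above[of ?I _ hi2] by simp
  ultimately show "\<exists>S. real n * (real n - 1) / 2 * lo \<le> S \<and> S \<le> real n * (real n - 1) / 2 * hi2 \<and>
      \<bar>prob V - exp (- S)\<bar> \<le> 2 * real n ^ 3 * (hi2\<^sup>2 + hi3)"
    using err unfolding card_index_pairs by blast
qed

section \<open>The limit law of the maximum\<close>

theorem mainTheorem5:
  fixes p :: "nat \<Rightarrow> nat"
    and \<tau> \<kappa> :: "nat \<Rightarrow> real" and \<tau>\<^sub>0 :: real
    and \<mu> :: "nat \<Rightarrow> nat \<Rightarrow> real"
    and \<Omega> :: "nat \<Rightarrow> 'a measure"
    and X :: "nat \<Rightarrow> nat \<Rightarrow> 'a \<Rightarrow> nat \<Rightarrow> real"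
    and P :: "nat \<Rightarrow> 'a \<Rightarrow> real"
  assumes p_pos: "\<And>n. n \<ge> 1 \<Longrightarrow> p n > 0"
    and p_growth: "filterlim (\<lambda>n. real (p n) / (ln (real n))\<^sup>2) at_top sequentially"
    and tau_pos: "\<And>n. n \<ge> 1 \<Longrightarrow> \<tau> n > 0"
    and tau_lim: "\<tau> \<longlonglongrightarrow> \<tau>\<^sub>0" "\<tau>\<^sub>0 > 0"
    and kappa: "\<And>n. n \<ge> 1 \<Longrightarrow> \<kappa> n = \<tau> n * real (p n) powr (3 / 4) / sqrt (real n)"
    and mu: "\<And>n. n \<ge> 1 \<Longrightarrow> \<mu> n \<in> unit_sphere (p n)"
    and prob: "\<And>n. n \<ge> 1 \<Longrightarrow> prob_space (\<Omega> n)"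
    and indep: "\<And>n. n \<ge> 1 \<Longrightarrow>
      prob_space.indep_vars (\<Omega> n) (\<lambda>_. FvML (p n) (\<kappa> n) (\<mu> n)) (X n) {1..n}"
    and law: "\<And>n i. 1 \<le> i \<Longrightarrow> i \<le> n \<Longrightarrow>
      distr (\<Omega> n) (FvML (p n) (\<kappa> n) (\<mu> n)) (X n i) = FvML (p n) (\<kappa> n) (\<mu> n)"
    and P: "\<And>n \<omega>. n \<ge> 1 \<Longrightarrow> \<omega> \<in> space (\<Omega> n) \<Longrightarrow>
      P n \<omega> = real (p n) * max_sq_inner (p n) n (\<lambda>i. X n i \<omega>) - 4 * ln (real n) + ln (ln (real n))"
  shows "weak_conv_m (\<lambda>n. distr (\<Omega> n) borel (P n)) limit_law"
proof -
  define q where "q n = p n - 1" for n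
  define \<eta> where "\<eta> n = \<kappa> n ^ 4 / (4 * real (Suc (q n)) ^ 3)" for n
  \<comment> \<open>With \<open>m = n\<close> in the comparison, \<open>m\<^sup>2 * \<eta>\<close> stays bounded while \<open>exp (m * \<delta>)\<close> is \<open>exp (sqrt n)\<close>.\<close>
  define \<delta> where "\<delta> n = 1 / sqrt (real n)" for n :: nat
  have pq: "Suc (q n) = p n" if "n \<ge> 1" for n using p_pos[OF that] by (simp add: q_def)
  have \<eta>_eq: "\<eta> n = \<tau> n ^ 4 / (4 * (real n)\<^sup>2)" if n: "n \<ge> 1" for n
  proof -
    have pp: "real (p n) > 0" using p_pos[OF n] by simp
    have "(real (p n) powr (3 / 4)) ^ 4 = real (p n) powr (real 4 * (3 / 4))"
      by (rule powr_power) (use p_pos[OF n] in simp)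
    also have "\<dots> = real (p n) ^ 3" using pp by simp
    finally have a: "(real (p n) powr (3 / 4)) ^ 4 = real (p n) ^ 3" .
    have "sqrt (real n) ^ (2 * 2) = ((sqrt (real n))\<^sup>2)\<^sup>2" by (rule power_mult)
    then have b: "sqrt (real n) ^ 4 = (real n)\<^sup>2" by simp
    have "\<eta> n = \<tau> n ^ 4 * real (p n) ^ 3 / (real n)\<^sup>2 / (4 * real (p n) ^ 3)"
      unfolding \<eta>_def pq[OF n] kappa[OF n] by (simp add: power_divide power_mult_distrib a b)
    also have "\<dots> = \<tau> n ^ 4 / (4 * (real n)\<^sup>2)" using pp by simp
    finally show ?thesis .
  qed
  have growth: "filterlim (\<lambda>n. real (Suc (q n)) / (ln (real n))\<^sup>2) at_top sequentially"
  proof (rule filterlim_cong[THEN iffD1, OF refl refl _ p_growth])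
    show "eventually (\<lambda>n. real (p n) / (ln (real n))\<^sup>2 = real (Suc (q n)) / (ln (real n))\<^sup>2) sequentially"
      using eventually_ge_at_top[of 1] by eventually_elim (simp add: pq)
  qed
  have q3: "eventually (\<lambda>n. q n \<ge> 3) sequentially"
  proof -
    have "eventually (\<lambda>n. real (p n) / (ln (real n))\<^sup>2 \<ge> 4) sequentially"
      by (rule filterlim_at_top[THEN iffD1, rule_format, OF p_growth])
    moreover have "eventually (\<lambda>n. (ln (real n))\<^sup>2 \<ge> 1) sequentially" by real_asymp
    ultimately show ?thesis
    proof eventually_elim
      case (elim n)
      have "4 * 1 \<le> 4 * (ln (real n))\<^sup>2" using elim by simp
      moreover have "(ln (real n))\<^sup>2 > 0" using elim(2) by linarith
      then have "4 * (ln (real n))\<^sup>2 \<le> real (p n)" using elim(1) by (simp only: pos_le_divide_eq)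
      ultimately show ?case by (simp add: q_def)
    qed
  qed
  have \<tau>4: "(\<lambda>n. \<tau> n ^ 4) \<longlonglongrightarrow> \<tau>\<^sub>0 ^ 4" by (intro tendsto_power tau_lim)
  have \<eta>0: "\<eta> \<longlonglongrightarrow> 0"
  proof -
    have "(\<lambda>n. 1 / (4 * (real n)\<^sup>2)) \<longlonglongrightarrow> 0" by real_asymp
    from tendsto_mult[OF \<tau>4 this] have "(\<lambda>n. \<tau> n ^ 4 / (4 * (real n)\<^sup>2)) \<longlonglongrightarrow> 0" by simp
    moreover have "eventually (\<lambda>n. \<tau> n ^ 4 / (4 * (real n)\<^sup>2) = \<eta> n) sequentially"
      using eventually_ge_at_top[of 1] by eventually_elim (simp add: \<eta>_eq)
    ultimately show ?thesis by (rule Lim_transform_eventually)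
  qed
  have \<eta>_small: "eventually (\<lambda>n. \<eta> n * 81 < 1) sequentially"
  proof -
    have "eventually (\<lambda>n. \<eta> n < 1 / 81) sequentially" using \<eta>0 by (rule order_tendstoD) simp
    then show ?thesis by eventually_elim simp
  qed
  have b_lim: "(\<lambda>n. exp ((real n)\<^sup>2 * c * \<eta> n / 2)) \<longlonglongrightarrow> exp (c * \<tau>\<^sub>0 ^ 4 / 8)" for c
  proof -
    have "(\<lambda>n. exp (c * \<tau> n ^ 4 / 8)) \<longlonglongrightarrow> exp (c * \<tau>\<^sub>0 ^ 4 / 8)"
      by (intro tendsto_intros \<tau>4) simp
    moreover have "eventually (\<lambda>n. exp (c * \<tau> n ^ 4 / 8) = exp ((real n)\<^sup>2 * c * \<eta> n / 2)) sequentially"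
      using eventually_ge_at_top[of 1] by eventually_elim (simp add: \<eta>_eq)
    ultimately show ?thesis by (rule Lim_transform_eventually)
  qed
  have cdf_lim: "(\<lambda>n. cdf (distr (\<Omega> n) borel (P n)) x) \<longlonglongrightarrow> limit_cdf x" for x
  proof -
    define L where "L = (8 * pi) powr (- 1 / 2) * exp (- x / 2)"
    define t where "t n = 4 * ln (real n) - ln (ln (real n)) + x" for n :: nat
    define T where "T n = measure (coord_law (q n)) {u. t n < real (Suc (q n)) * u\<^sup>2}" for n
    have T_lim: "(\<lambda>n. (real n)\<^sup>2 * T n) \<longlonglongrightarrow> 2 * L"
      unfolding T_def t_def L_def by (rule coord_tail_asymp[OF growth])
    define b2 where "b2 n = exp ((real n)\<^sup>2 * 4 * \<eta> n / 2)" for n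
    define b3 where "b3 n = exp ((real n)\<^sup>2 * 36 * \<eta> n / 2)" for n
    define lo where "lo n = (1 - \<eta> n * 16) * (exp (- \<delta> n) * T n - exp (- (real n * \<delta> n)) * b2 n)" for n
    define hi2 where "hi2 n = (exp (\<delta> n) * T n + exp (- ((real n - 1) * \<delta> n)) * b2 n) / (1 - \<eta> n)\<^sup>2" for n
    define hi3 where "hi3 n = (exp (\<delta> n) * (T n)\<^sup>2 + exp (- ((real n - 1) * \<delta> n)) * b3 n) / (1 - \<eta> n) ^ 3" for n
    define V where "V n = {\<omega> \<in> space (\<Omega> n). real (Suc (q n)) * max_sq_inner (Suc (q n)) n (\<lambda>i. X n i \<omega>) \<le> t n}" for n
    have e1: "(\<lambda>n. exp (\<delta> n)) \<longlonglongrightarrow> 1" "(\<lambda>n. exp (- \<delta> n)) \<longlonglongrightarrow> 1"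
      unfolding \<delta>_def by real_asymp+
    have e2: "(\<lambda>n. (real n)\<^sup>2 * exp (- (real n * \<delta> n))) \<longlonglongrightarrow> 0"
      "(\<lambda>n. (real n)\<^sup>2 * exp (- ((real n - 1) * \<delta> n))) \<longlonglongrightarrow> 0"
      "(\<lambda>n. (real n) ^ 3 * exp (- ((real n - 1) * \<delta> n))) \<longlonglongrightarrow> 0"
      unfolding \<delta>_def by real_asymp+
    have b2_lim: "b2 \<longlonglongrightarrow> exp (4 * \<tau>\<^sub>0 ^ 4 / 8)" and b3_lim: "b3 \<longlonglongrightarrow> exp (36 * \<tau>\<^sub>0 ^ 4 / 8)"
      unfolding b2_def b3_def by (rule b_lim)+
    have half: "(\<lambda>n. real n * (real n - 1) / 2 / (real n)\<^sup>2) \<longlonglongrightarrow> 1 / 2" by real_asymp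
    have rec: "(\<lambda>n. 1 / real n) \<longlonglongrightarrow> 0" by real_asymp
    have n1: "eventually (\<lambda>n. real n > 0) sequentially" by real_asymp
    have lo_lim: "(\<lambda>n. real n * (real n - 1) / 2 * lo n) \<longlonglongrightarrow> L"
    proof -
      let ?e1 = "\<lambda>n. real n * (real n - 1) / 2 / (real n)\<^sup>2 * ((1 - \<eta> n * 16) *
          (exp (- \<delta> n) * ((real n)\<^sup>2 * T n) - ((real n)\<^sup>2 * exp (- (real n * \<delta> n))) * b2 n))"
      have "?e1
          \<longlonglongrightarrow> 1 / 2 * ((1 - 0 * 16) * (1 * (2 * L) - 0 * exp (4 * \<tau>\<^sub>0 ^ 4 / 8)))"
        by (intro tendsto_mult half tendsto_diff tendsto_const \<eta>0 e1 T_lim e2 b2_lim)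
      moreover have "eventually (\<lambda>n. ?e1 n
          = real n * (real n - 1) / 2 * lo n) sequentially"
        using n1
      proof eventually_elim
        case (elim n)
        have "exp (- \<delta> n) * ((real n)\<^sup>2 * T n) - ((real n)\<^sup>2 * exp (- (real n * \<delta> n))) * b2 n
            = (real n)\<^sup>2 * (exp (- \<delta> n) * T n - exp (- (real n * \<delta> n)) * b2 n)"
          by (simp add: algebra_simps)
        then show ?case using elim by (simp add: lo_def)
      qed
      ultimately have "(\<lambda>n. real n * (real n - 1) / 2 * lo n)
          \<longlonglongrightarrow> 1 / 2 * ((1 - 0 * 16) * (1 * (2 * L) - 0 * exp (4 * \<tau>\<^sub>0 ^ 4 / 8)))"
        by (rule Lim_transform_eventually)
      then show ?thesis by simp
    qed
    have hi2_lim: "(\<lambda>n. (real n)\<^sup>2 * hi2 n) \<longlonglongrightarrow> 2 * L"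
    proof -
      let ?e2 = "\<lambda>n. (exp (\<delta> n) * ((real n)\<^sup>2 * T n) + ((real n)\<^sup>2 * exp (- ((real n - 1) * \<delta> n))) * b2 n) / (1 - \<eta> n)\<^sup>2"
      have "?e2
          \<longlonglongrightarrow> (1 * (2 * L) + 0 * exp (4 * \<tau>\<^sub>0 ^ 4 / 8)) / (1 - 0)\<^sup>2"
        by (intro tendsto_divide tendsto_add tendsto_mult tendsto_power tendsto_diff tendsto_const
            \<eta>0 e1 T_lim e2 b2_lim) simp
      moreover have "?e2 n
          = (real n)\<^sup>2 * hi2 n" for n
        by (simp add: hi2_def algebra_simps)
      ultimately show ?thesis by simp
    qed
    have hi2_lim': "(\<lambda>n. real n * (real n - 1) / 2 * hi2 n) \<longlonglongrightarrow> L"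
    proof -
      have "(\<lambda>n. real n * (real n - 1) / 2 / (real n)\<^sup>2 * ((real n)\<^sup>2 * hi2 n)) \<longlonglongrightarrow> 1 / 2 * (2 * L)"
        by (intro tendsto_mult half hi2_lim)
      moreover have "eventually (\<lambda>n. real n * (real n - 1) / 2 / (real n)\<^sup>2 * ((real n)\<^sup>2 * hi2 n)
          = real n * (real n - 1) / 2 * hi2 n) sequentially"
        using n1 by eventually_elim simp
      ultimately have "(\<lambda>n. real n * (real n - 1) / 2 * hi2 n) \<longlonglongrightarrow> 1 / 2 * (2 * L)"
        by (rule Lim_transform_eventually)
      then show ?thesis by simp
    qed
    have hi3_lim: "(\<lambda>n. real n ^ 3 * hi3 n) \<longlonglongrightarrow> 0"
    proof -
      let ?e3 = "\<lambda>n. (exp (\<delta> n) * (((real n)\<^sup>2 * T n)\<^sup>2 * (1 / real n)) + (real n ^ 3 * exp (- ((real n - 1) * \<delta> n))) * b3 n) / (1 - \<eta> n) ^ 3"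
      have "?e3
          \<longlonglongrightarrow> (1 * ((2 * L)\<^sup>2 * 0) + 0 * exp (36 * \<tau>\<^sub>0 ^ 4 / 8)) / (1 - 0) ^ 3"
        by (intro tendsto_divide tendsto_add tendsto_mult tendsto_power tendsto_diff tendsto_const
            \<eta>0 e1 T_lim e2 b3_lim rec) simp
      moreover have "eventually (\<lambda>n. ?e3 n
          = real n ^ 3 * hi3 n) sequentially"
        using n1
      proof eventually_elim
        case (elim n)
        have "((real n)\<^sup>2 * T n)\<^sup>2 * (1 / real n) = real n ^ 3 * (T n)\<^sup>2"
          using elim by (simp add: power_mult_distrib power2_eq_square power3_eq_cube)
        then show ?case by (simp add: hi3_def algebra_simps)
      qed
      ultimately have "(\<lambda>n. real n ^ 3 * hi3 n) \<longlonglongrightarrow> (1 * ((2 * L)\<^sup>2 * 0) + 0 * exp (36 * \<tau>\<^sub>0 ^ 4 / 8)) / (1 - 0) ^ 3"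
        by (rule Lim_transform_eventually)
      then show ?thesis by simp
    qed
    have err_lim: "(\<lambda>n. 2 * real n ^ 3 * ((hi2 n)\<^sup>2 + hi3 n)) \<longlonglongrightarrow> 0"
    proof -
      let ?e4 = "\<lambda>n. 2 * (((real n)\<^sup>2 * hi2 n)\<^sup>2 * (1 / real n) + real n ^ 3 * hi3 n)"
      have "?e4 \<longlonglongrightarrow> 2 * ((2 * L)\<^sup>2 * 0 + 0)"
        by (intro tendsto_mult tendsto_add tendsto_power tendsto_const hi2_lim hi3_lim rec)
      moreover have "eventually (\<lambda>n. ?e4 n
          = 2 * real n ^ 3 * ((hi2 n)\<^sup>2 + hi3 n)) sequentially"
        using n1
      proof eventually_elim
        case (elim n)
        have "((real n)\<^sup>2 * hi2 n)\<^sup>2 * (1 / real n) = real n ^ 3 * (hi2 n)\<^sup>2"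
          using elim by (simp add: power_mult_distrib power2_eq_square power3_eq_cube)
        then show ?case by (simp add: algebra_simps)
      qed
      ultimately have "(\<lambda>n. 2 * real n ^ 3 * ((hi2 n)\<^sup>2 + hi3 n)) \<longlonglongrightarrow> 2 * ((2 * L)\<^sup>2 * 0 + 0)"
        by (rule Lim_transform_eventually)
      then show ?thesis by simp
    qed
    have big: "eventually (\<lambda>n. n \<ge> 2 \<and> q n \<ge> 3 \<and> \<eta> n * 81 < 1) sequentially"
      using eventually_ge_at_top[of 2] q3 \<eta>_small by eventually_elim simp
    define Q where "Q n S \<longleftrightarrow> real n * (real n - 1) / 2 * lo n \<le> S \<and> S \<le> real n * (real n - 1) / 2 * hi2 n \<and>
      \<bar>measure (\<Omega> n) (V n) - exp (- S)\<bar> \<le> 2 * real n ^ 3 * ((hi2 n)\<^sup>2 + hi3 n)" for n S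
    have exQ: "eventually (\<lambda>n. \<exists>S. Q n S) sequentially"
      using big
    proof eventually_elim
      case (elim n)
      then have n: "n \<ge> 1" by simp
      have m: "\<mu> n \<in> unit_sphere (Suc (q n))" using mu[OF n] pq[OF n] by simp
      have i: "prob_space.indep_vars (\<Omega> n) (\<lambda>_. FvML (Suc (q n)) (\<kappa> n) (\<mu> n)) (X n) {1..n}"
        using indep[OF n] pq[OF n] by simp
      have l: "distr (\<Omega> n) (FvML (Suc (q n)) (\<kappa> n) (\<mu> n)) (X n i) = FvML (Suc (q n)) (\<kappa> n) (\<mu> n)"
        if "1 \<le> i" "i \<le> n" for i using law[OF that] pq[OF n] by simp
      have \<delta>: "\<delta> n > 0" using n by (simp add: \<delta>_def)
      have r: "real n \<ge> 1" using n by simp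
      have s: "\<kappa> n ^ 4 / (4 * real (Suc (q n)) ^ 3) * 81 < 1" using elim by (simp add: \<eta>_def)
      from elim have q: "q n \<ge> 3" and n2: "n \<ge> 2" by auto
      show ?case
        unfolding Q_def lo_def hi2_def hi3_def V_def b2_def b3_def T_def \<eta>_def
        by (rule void_probability_FvML(2)[OF q m n2 prob[OF n] i l \<delta> r s])
    qed
    define S where "S n = (SOME s. Q n s)" for n
    have QS: "eventually (\<lambda>n. Q n (S n)) sequentially"
      using exQ by eventually_elim (auto simp: S_def intro: someI_ex)
    have "S \<longlonglongrightarrow> L"
      by (rule tendsto_sandwich[OF _ _ lo_lim hi2_lim'])
         (use QS in \<open>auto simp: Q_def elim: eventually_mono\<close>)
    then have "(\<lambda>n. exp (- S n)) \<longlonglongrightarrow> exp (- L)" by (intro tendsto_intros)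
    moreover have "(\<lambda>n. measure (\<Omega> n) (V n) - exp (- S n)) \<longlonglongrightarrow> 0"
    proof (rule tendsto_rabs_zero_cancel, rule tendsto_sandwich[OF _ _ tendsto_const err_lim])
      show "eventually (\<lambda>n. 0 \<le> \<bar>measure (\<Omega> n) (V n) - exp (- S n)\<bar>) sequentially" by simp
      show "eventually (\<lambda>n. \<bar>measure (\<Omega> n) (V n) - exp (- S n)\<bar> \<le> 2 * real n ^ 3 * ((hi2 n)\<^sup>2 + hi3 n)) sequentially"
        using QS by eventually_elim (simp add: Q_def)
    qed
    ultimately have "(\<lambda>n. (measure (\<Omega> n) (V n) - exp (- S n)) + exp (- S n)) \<longlonglongrightarrow> 0 + exp (- L)"
      by (intro tendsto_add)
    then have V_lim: "(\<lambda>n. measure (\<Omega> n) (V n)) \<longlonglongrightarrow> limit_cdf x"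
      by (simp add: limit_cdf_def L_def)
    have "eventually (\<lambda>n. measure (\<Omega> n) (V n) = cdf (distr (\<Omega> n) borel (P n)) x) sequentially"
      using big
    proof eventually_elim
      case (elim n)
      then have n: "n \<ge> 1" by simp
      have P_le: "{\<omega> \<in> space (\<Omega> n). P n \<omega> \<le> a} = {\<omega> \<in> space (\<Omega> n).
          real (Suc (q n)) * max_sq_inner (Suc (q n)) n (\<lambda>i. X n i \<omega>) \<le> 4 * ln (real n) - ln (ln (real n)) + a}" for a
        unfolding pq[OF n] using P[OF n] by auto
      have m: "\<mu> n \<in> unit_sphere (Suc (q n))" using mu[OF n] pq[OF n] by simp
      have i: "prob_space.indep_vars (\<Omega> n) (\<lambda>_. FvML (Suc (q n)) (\<kappa> n) (\<mu> n)) (X n) {1..n}"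
        using indep[OF n] pq[OF n] by simp
      have l: "distr (\<Omega> n) (FvML (Suc (q n)) (\<kappa> n) (\<mu> n)) (X n i) = FvML (Suc (q n)) (\<kappa> n) (\<mu> n)"
        if "1 \<le> i" "i \<le> n" for i using law[OF that] pq[OF n] by simp
      have s: "\<kappa> n ^ 4 / (4 * real (Suc (q n)) ^ 3) * 81 < 1" using elim by (simp add: \<eta>_def)
      from elim have q: "q n \<ge> 3" and n2: "n \<ge> 2" by auto
      have "P n \<in> borel_measurable (\<Omega> n)"
        unfolding borel_measurable_iff_le P_le
        by (intro allI void_probability_FvML(1)[OF q m n2 prob[OF n] i l zero_less_one order_refl s])
      then have "cdf (distr (\<Omega> n) borel (P n)) x = measure (\<Omega> n) (P n -` {..x} \<inter> space (\<Omega> n))"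
        unfolding cdf_def by (rule measure_distr) simp
      also have "P n -` {..x} \<inter> space (\<Omega> n) = V n"
        using P_le[of x] by (auto simp: V_def t_def)
      finally show ?case by simp
    qed
    with V_lim show ?thesis by (rule Lim_transform_eventually)
  qed
  then show ?thesis by (simp add: weak_conv_m_def weak_conv_def limit_law)
qed

end
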